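(* Let $n\ge 2$, let $W=\mathfrak{S}_n$ be the symmetric group with Coxeter generators $S=\{s_1,\dots,s_{n-1}\}$, $s_i=(i,i+1)$ (the Coxeter group of type $A_{n-1}$), and let $u,v\in W$ with $u\le v$ in Bruhat order. Let $\sim$ be the equivalence relation on the set of amazing hypercube decompositions of $[u,v]$ generated by declaring $z\sim z'$ whenever $DS(z,z')=DS(z',z)$, where $DS(z,z')$ denotes the multiset of $(z,z')$-double shortcuts for $[u,v]$. Then the standard hypercube decompositions of $[u,v]$, namely $$z_n=\min([u,v]\cap W_{S\setminus\{s_{n-1}\}}v),\qquad z_1=\min([u,v]\cap W_{S\setminus\{s_1\}}v),$$ $$z^n=\min([u,v]\cap vW_{S\setminus\{s_{n-1}\}}),\qquad z^1=\min([u,v]\cap vW_{S\setminus\{s_1\}}),$$ all belong to the same equivalence class of $\sim$.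
   Context: Permutations are composed from right to left, $(xy)(i)=x(y(i))$. $\le$ is the Bruhat order on $W=\mathfrak{S}_n$, and $[u,v]=\{x\in W: u\le x\le v\}$. For $J\subseteq S$, $W_J$ is the subgroup generated by $J$; $W_Jv=\{wv:w\in W_J\}$ and $vW_J=\{vw:w\in W_J\}$. $\min$ denotes the minimum in Bruhat order (the minima defining $z_n,z_1,z^n,z^1$ are known to exist; these four elements need not be distinct). $\mathcal{B}(W)$ is the Bruhat graph: the directed graph with vertex set $W$ and an edge $x\to y$ whenever $y=tx$ for some reflection (transposition) $t$ and $\ell(x)<\ell(y)$, where $\ell$ on elements of $W$ is Coxeter length. A path $\Gamma=(u=x_0\to x_1\to\cdots\to x_r=v)$ in $\mathcal{B}(W)$ has length $\ell(\Gamma)=r$ and support $\mathrm{supp}(\Gamma)=\{x_0,\dots,x_r\}$. For $u\le v$, $d(u,v)$ is the minimal length of a path from $u$ to $v$ in $\mathcal{B}(W)$. Hypercube decompositions. For a finite set $E$, the hypercube $H_E$ is the directed graph whose vertices are the subsets of $E$, with an edge $E_1\to E_2$ if and only if $E_2$ is obtained from $E_1$ by adding one element. Let $p\in W$ and let $E$ be a set of edges of $\mathcal{B}(W)$ all having target $p$. $E$ spans a hypercube if there exists a unique embedding of directed graphs $\theta_E:H_E\to\mathcal{B}(W)$ such that for every $\alpha\in E$ the edge $(E\setminus\{\alpha\}\to E)$ is sent to $\alpha$. $E$ spans a hypercube cluster if every subset $E'\subseteq E$ consisting of edges with pairwise (Bruhat-)incomparable sources spans a hypercube. An element $z\in[u,v]$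 is a hypercube decomposition of $[u,v]$ if: (i) whenever $x\in[u,v]$ and $a_1,a_2,y\in[z,v]$ with $a_1\ne a_2$ satisfy $x\to a_1\to y$ and $x\to a_2\to y$, then $x\in[z,v]$; and (ii) for all $p\in[z,v]$ the set $E^p=\{x\to p: x\in[u,v]\setminus[z,v]\}$ of edges of $\mathcal{B}(W)$ spans a hypercube cluster. A hypercube decomposition $z$ of $[u,v]$ is amazing if for all $x\in[u,v]$ the intersection $[z,v]\cap[x,v]$ has a minimum, denoted $z\vee x$, and $z\vee x$ is a hypercube decomposition of $[x,v]$. The elements $z_n,z_1,z^n,z^1$, called the standard hypercube decompositions of $[u,v]$, are known to be amazing hypercube decompositions. Shortcuts. For $z\in[u,v]$, the set of shortcuts for $[u,v]$ with respect to $z$ is $$W^z_{[u,v]}=\{p\in[z,v]: \mathrm{supp}(\Gamma)\cap[z,v]=\{p\}\text{ for all paths }\Gamma\text{ from }u\text{ to }p\text{ of length }d(u,p)\}.$$ Double shortcuts. For amazing hypercube decompositions $z,z'$ of $[u,v]$, $DS(z,z')$ is the multiset $$\{(d(u,p)+d(p,b),\,b): p\in W^z_{[u,v]}\text{ and }b\in W^{z'\vee p}_{[p,v]}\},$$ where each such pair $(p,b)$ contributes one element, counted with multiplicity. *)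

theory Defs
  imports "HOL-Algebra.Sym_Groups" "HOL-Library.Multiset" "HOL-Library.FuncSet"
begin

type_synonym perm = "nat \<Rightarrow> nat"

section \<open>The symmetric group as a Coxeter group\<close>

definition simple_refl :: "nat \<Rightarrow> perm" where
  "simple_refl i = transpose i (i + 1)"

definition simple_refls :: "nat \<Rightarrow> perm set" where
  "simple_refls n = simple_refl ` {1..n - 1}"

definition refls :: "nat \<Rightarrow> perm set" where
  "refls n = {transpose i j | i j. 1 \<le> i \<and> i < j \<and> j \<le> n}"

definition cox_length :: "nat \<Rightarrow> perm \<Rightarrow> nat" where
  "cox_length n w =
     (LEAST k. \<exists>ss. set ss \<subseteq> simple_refls n \<and> length ss = k \<and> foldr (\<circ>) ss id = w)"

definition bruhat_graph :: "nat \<Rightarrow> (perm \<times> perm) set" where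
  "bruhat_graph n =
     {(x, y). x \<in> carrier (sym_group n) \<and> y \<in> carrier (sym_group n) \<and>
        (\<exists>t\<in>refls n. y = t \<circ> x) \<and> cox_length n x < cox_length n y}"

definition bruhat_le :: "nat \<Rightarrow> perm \<Rightarrow> perm \<Rightarrow> bool" where
  "bruhat_le n x y \<longleftrightarrow>
     x \<in> carrier (sym_group n) \<and> y \<in> carrier (sym_group n) \<and> (x, y) \<in> (bruhat_graph n)\<^sup>*"

definition bruhat_interval :: "nat \<Rightarrow> perm \<Rightarrow> perm \<Rightarrow> perm set" where
  "bruhat_interval n u v = {x. bruhat_le n u x \<and> bruhat_le n x v}"

definition is_bruhat_min :: "nat \<Rightarrow> perm set \<Rightarrow> perm \<Rightarrow> bool" where
  "is_bruhat_min n A m \<longleftrightarrow> m \<in> A \<and> (\<forall>a\<in>A. bruhat_le n m a)"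

text \<open>The Bruhat order is antisymmetric, so a minimum is unique if it exists; the value is
  unspecified otherwise.\<close>

definition bruhat_min :: "nat \<Rightarrow> perm set \<Rightarrow> perm" where
  "bruhat_min n A = (THE m. is_bruhat_min n A m)"

definition parabolic :: "nat \<Rightarrow> perm set \<Rightarrow> perm set" where
  "parabolic n J = generate (sym_group n) J"

section \<open>Paths in the Bruhat graph\<close>

text \<open>A path is the list of its vertices; its length is the number of edges.\<close>

definition bruhat_paths :: "nat \<Rightarrow> perm \<Rightarrow> perm \<Rightarrow> perm list set" where
  "bruhat_paths n u v =
     {xs. xs \<noteq> [] \<and> set xs \<subseteq> carrier (sym_group n) \<and> hd xs = u \<and> last xs = v \<and>
        successively (\<lambda>x y. (x, y) \<in> bruhat_graph n) xs}"

definition path_length :: "perm list \<Rightarrow> nat" where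
  "path_length xs = length xs - 1"

definition bruhat_dist :: "nat \<Rightarrow> perm \<Rightarrow> perm \<Rightarrow> nat" where
  "bruhat_dist n u v = (LEAST k. \<exists>xs\<in>bruhat_paths n u v. path_length xs = k)"

section \<open>Hypercube decompositions\<close>

definition hypercube_edges :: "'a set \<Rightarrow> ('a set \<times> 'a set) set" where
  "hypercube_edges E = {(A, insert a A) | A a. A \<subseteq> E \<and> a \<in> E - A}"

text \<open>An embedding is an injective map on vertices that sends edges to edges. It is required
  to be extensional, so that uniqueness refers to its values on the vertices only.\<close>

definition hypercube_embedding :: "nat \<Rightarrow> 'a set \<Rightarrow> ('a set \<Rightarrow> perm) \<Rightarrow> bool" where
  "hypercube_embedding n E \<theta> \<longleftrightarrow>
     \<theta> \<in> Pow E \<rightarrow>\<^sub>E carrier (sym_group n) \<and> inj_on \<theta> (Pow E) \<and>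
     (\<forall>(A, B)\<in>hypercube_edges E. (\<theta> A, \<theta> B) \<in> bruhat_graph n)"

text \<open>Here \<open>E\<close> is a set of edges with common target \<open>p\<close>. For nonempty \<open>E\<close> the condition
  \<open>\<theta> E = p\<close> follows from the condition on the edges; it is stated separately so that
  the empty set, whose hypercube is a single vertex, spans the hypercube \<open>{p}\<close>.\<close>

definition spans_hypercube :: "nat \<Rightarrow> perm \<Rightarrow> (perm \<times> perm) set \<Rightarrow> bool" where
  "spans_hypercube n p E \<longleftrightarrow>
     (\<exists>!\<theta>. hypercube_embedding n E \<theta> \<and> \<theta> E = p \<and> (\<forall>\<alpha>\<in>E. (\<theta> (E - {\<alpha>}), \<theta> E) = \<alpha>))"

definition bruhat_incomparable :: "nat \<Rightarrow> perm \<Rightarrow> perm \<Rightarrow> bool" where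
  "bruhat_incomparable n x y \<longleftrightarrow> \<not> bruhat_le n x y \<and> \<not> bruhat_le n y x"

definition spans_hypercube_cluster :: "nat \<Rightarrow> perm \<Rightarrow> (perm \<times> perm) set \<Rightarrow> bool" where
  "spans_hypercube_cluster n p E \<longleftrightarrow>
     (\<forall>E'\<subseteq>E. pairwise (\<lambda>\<alpha> \<beta>. bruhat_incomparable n (fst \<alpha>) (fst \<beta>)) E' \<longrightarrow>
        spans_hypercube n p E')"

definition hypercube_decomp :: "nat \<Rightarrow> perm \<Rightarrow> perm \<Rightarrow> perm \<Rightarrow> bool" where
  "hypercube_decomp n u v z \<longleftrightarrow>
     z \<in> bruhat_interval n u v \<and>
     (\<forall>x\<in>bruhat_interval n u v. \<forall>a1\<in>bruhat_interval n z v. \<forall>a2\<in>bruhat_interval n z v.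
        \<forall>y\<in>bruhat_interval n z v.
          a1 \<noteq> a2 \<and> (x, a1) \<in> bruhat_graph n \<and> (a1, y) \<in> bruhat_graph n \<and>
          (x, a2) \<in> bruhat_graph n \<and> (a2, y) \<in> bruhat_graph n \<longrightarrow>
          x \<in> bruhat_interval n z v) \<and>
     (\<forall>p\<in>bruhat_interval n z v.
        spans_hypercube_cluster n p
          {(x, p) | x. x \<in> bruhat_interval n u v - bruhat_interval n z v \<and>
             (x, p) \<in> bruhat_graph n})"

text \<open>\<open>bruhat_vee n v z x\<close> is the element \<open>z \<or> x\<close>, which depends on the top \<open>v\<close>
  of the interval.\<close>

definition bruhat_vee :: "nat \<Rightarrow> perm \<Rightarrow> perm \<Rightarrow> perm \<Rightarrow> perm" where
  "bruhat_vee n v z x = bruhat_min n (bruhat_interval n z v \<inter> bruhat_interval n x v)"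

definition amazing_decomp :: "nat \<Rightarrow> perm \<Rightarrow> perm \<Rightarrow> perm \<Rightarrow> bool" where
  "amazing_decomp n u v z \<longleftrightarrow>
     hypercube_decomp n u v z \<and>
     (\<forall>x\<in>bruhat_interval n u v.
        (\<exists>m. is_bruhat_min n (bruhat_interval n z v \<inter> bruhat_interval n x v) m) \<and>
        hypercube_decomp n x v (bruhat_vee n v z x))"

definition amazing_decomps :: "nat \<Rightarrow> perm \<Rightarrow> perm \<Rightarrow> perm set" where
  "amazing_decomps n u v = {z. amazing_decomp n u v z}"

section \<open>Shortcuts and double shortcuts\<close>

definition shortcuts :: "nat \<Rightarrow> perm \<Rightarrow> perm \<Rightarrow> perm \<Rightarrow> perm set" where
  "shortcuts n u v z =
     {p \<in> bruhat_interval n z v.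
        \<forall>xs\<in>bruhat_paths n u p. path_length xs = bruhat_dist n u p \<longrightarrow>
          set xs \<inter> bruhat_interval n z v = {p}}"

text \<open>The index set below is finite, as it consists of pairs of permutations of \<open>{1..n}\<close>.\<close>

definition double_shortcuts ::
    "nat \<Rightarrow> perm \<Rightarrow> perm \<Rightarrow> perm \<Rightarrow> perm \<Rightarrow> (nat \<times> perm) multiset" where
  "double_shortcuts n u v z z' =
     image_mset (\<lambda>(p, b). (bruhat_dist n u p + bruhat_dist n p b, b))
       (mset_set (SIGMA p:shortcuts n u v z. shortcuts n p v (bruhat_vee n v z' p)))"

text \<open>The equivalence relation on the set of amazing hypercube decompositions generated by
  \<open>DS(z, z') = DS(z', z)\<close>: all intermediate elements of a chain are amazing as well.\<close>

definition ds_equiv :: "nat \<Rightarrow> perm \<Rightarrow> perm \<Rightarrow> (perm \<times> perm) set" where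
  "ds_equiv n u v =
     {(z, z'). z \<in> amazing_decomps n u v \<and> z' \<in> amazing_decomps n u v \<and>
        equivclp (\<lambda>x y. x \<in> amazing_decomps n u v \<and> y \<in> amazing_decomps n u v \<and>
                    double_shortcuts n u v x y = double_shortcuts n u v y x) z z'}"

lemma equiv_ds_equiv: "equiv (amazing_decomps n u v) (ds_equiv n u v)"
  by (auto intro!: equivI refl_onI symI transI simp: ds_equiv_def
      intro: equivclp_sym equivclp_trans)

end

theory Submission
  imports Defs
begin

text \<open>
  A permutation is read as the word of its entries. An edge of the Bruhat graph exchanges two
  entries of which the smaller one stands further left (\<open>bruhat_edge_iff\<close>). The cosets
  of the maximal parabolic subgroups record the first entry, the last entry, the position of the
  value 1 and the position of the value \<open>n\<close>, so the four standard decompositions are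
  the minima of those fibers of these four functions on $[u, v]$ that contain \<open>v\<close>.

  \<^emph>\<open>The standard decompositions are amazing.\<close> Inversion and conjugation by the
  longest element are automorphisms of the Bruhat graph that permute the four functions. It is
  enough to consider the first entry. The minimum of its fiber exists by the lifting property
  (\<open>first_value_min_exists\<close>). An edge from outside the fiber to \<open>p\<close>
  exchanges position 1 with some position \<open>j\<close>. If the sources of several such edges are
  incomparable, \<open>p\<close> increases at the positions in question, and rotating the
  corresponding subwords of \<open>p\<close> gives the hypercube; a vertex is determined by two
  adjacent ones above it (\<open>star_spans_hypercube\<close>). For \<open>x\<close> in the
  interval, \<open>z \<or> x\<close> is the minimum of the fiber in $[x, v]$, so the requirements on
  it are those already verified, for another interval (\<open>min_amazing\<close>).

  \<^emph>\<open>Shortcuts.\<close> A shortcut for the first entry is obtained from \<open>u\<close>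
  by exchanging position 1 with positions $q_1 < \dots < q_r$ in turn, going up each time; this is
  called a star. Its distance from \<open>u\<close> is $r$, because $r$ exchanges are needed to
  connect $r + 1$ positions, and a shortest path cannot enter the fiber early, because it would run
  out of inversions (\<open>star_geodesic_vertex\<close>). Conversely each path can be rearranged
  into a star followed by steps that leave the first entry alone (\<open>star_normal_form\<close>),
  so that there are no other shortcuts.

  \<^emph>\<open>Double shortcuts.\<close> A double shortcut is then an ascending subsequence of one
  list of exchanges, the concatenation of two stars, followed by one fixed exchange if the position
  of \<open>n\<close> is involved and changes. Interchanging the two decompositions gives another
  list. The number of ascending subsequences with given length and end does not change if disjoint
  exchanges are interchanged or if the three exchanges of three positions are reversed, which is the
  Yang--Baxter equation (\<open>yang_baxter\<close>). Such moves lead from one list to the other,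
  both for the first and the last entry (\<open>first_last_commute\<close>) and for the first entry
  and the position of \<open>n\<close> (\<open>first_top_commute\<close>). Together with the image
  of the first case under inversion these equalities connect the decompositions $z^n$, $z^1$, $z_n$,
  $z_1$ in this order.
\<close>

section \<open>Inversions and the edges of the Bruhat graph\<close>

definition inversions :: "nat set \<Rightarrow> perm \<Rightarrow> (nat \<times> nat) set" where
  "inversions P x = {(p, q). p \<in> P \<and> q \<in> P \<and> p < q \<and> x q < x p}"

lemma finite_inversions: "finite P \<Longrightarrow> finite (inversions P x)"
  by (rule finite_subset[of _ "P \<times> P"]) (auto simp: inversions_def)

text \<open>Conjugating pairs of positions by the transposition of \<open>a\<close> and
  \<open>b\<close> sends inversions of \<open>x\<close> to inversions of the new word, except where
  it reverses the order of the two positions. Such a pair consists of $a$ or $b$ and a position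
  strictly between them, and it is an inversion of the new word as it stands. The resulting map is
  injective and misses the new inversion $(a, b)$. An arbitrary set \<open>P\<close> of positions is
  allowed because paths are later measured on the positions that they move.\<close>

lemma card_inversions_transpose_less:
  assumes P: "finite P" "a \<in> P" "b \<in> P" and ab: "a < b" "x a < x b"
  shows "card (inversions P x) < card (inversions P (x \<circ> transpose a b))"
proof -
  let ?t = "transpose a b"
  let ?y = "x \<circ> ?t"
  define F where "F = (\<lambda>(p, q). if ?t p < ?t q then (?t p, ?t q) else (p, q))"
  have t: "?t (?t p) = p" for p
    by simp
  have tP: "?t p \<in> P" if "p \<in> P" for p
    using that P by (auto simp: transpose_def)
  have "inj_on F (inversions P x)"
  proof (rule inj_onI, clarify)
    fix p q p' q'
    assume h: "(p, q) \<in> inversions P x" "(p', q') \<in> inversions P x" "F (p, q) = F (p', q')"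
    then have lt: "p < q" "p' < q'"
      by (auto simp: inversions_def)
    have inj: "?t r = ?t s \<Longrightarrow> r = s" for r s
      by (metis t)
    show "p = p' \<and> q = q'"
      using h(3) lt unfolding F_def by (auto split: if_splits dest: inj)
  qed
  moreover have "F ` inversions P x \<subseteq> inversions P ?y - {(a, b)}"
  proof (rule image_subsetI)
    fix r
    assume r: "r \<in> inversions P x"
    obtain p q where pq: "r = (p, q)"
      by fastforce
    with r have h: "p \<in> P" "q \<in> P" "p < q" "x q < x p"
      by (auto simp: inversions_def)
    show "F r \<in> inversions P ?y - {(a, b)}"
    proof (cases "?t p < ?t q")
      case True
      have "\<not> (?t p = a \<and> ?t q = b)"
        using h ab by (metis t not_less_iff_gr_or_eq transpose_apply_first transpose_apply_second)
      then show ?thesis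
        using True h tP by (auto simp: F_def inversions_def pq)
    next
      case False
      then have "?y q < ?y p"
        using h ab by (auto simp: transpose_def split: if_splits)
      moreover have "(p, q) \<noteq> (a, b)"
        using h ab by auto
      ultimately show ?thesis
        using False h by (auto simp: F_def inversions_def pq)
    qed
  qed
  ultimately have "card (inversions P x) \<le> card (inversions P ?y - {(a, b)})"
    by (meson card_inj_on_le finite_Diff finite_inversions P(1))
  moreover have "(a, b) \<in> inversions P ?y"
    using P ab by (auto simp: inversions_def)
  ultimately show ?thesis
    by (metis P(1) card_Diff1_less finite_inversions le_less_trans)
qed

lemma card_inversions_adjacent:
  assumes P: "finite P" "i \<in> P" "Suc i \<in> P" and lt: "x i < x (Suc i)"
  shows "card (inversions P (x \<circ> transpose i (Suc i))) = Suc (card (inversions P x))"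
proof -
  let ?t = "transpose i (Suc i)"
  have t: "?t (?t p) = p" for p
    by simp
  have mem: "?t p \<in> P \<longleftrightarrow> p \<in> P" for p
    using P by (auto simp: transpose_def)
  have ord: "?t p < ?t q \<longleftrightarrow> p < q" if "{p, q} \<noteq> {i, Suc i}" "p \<noteq> q" for p q
    using that by (auto simp: transpose_def doubleton_eq_iff)
  have "inversions P (x \<circ> ?t) = insert (i, Suc i) (map_prod ?t ?t ` inversions P x)" (is "?L = ?R")
  proof (intro equalityI subsetI; clarify)
    fix p q
    assume pq: "(p, q) \<in> ?L" and "(p, q) \<notin> map_prod ?t ?t ` inversions P x"
    then have "(?t p, ?t q) \<notin> inversions P x"
      by (metis map_prod_simp rev_image_eqI t)
    with pq have "\<not> ?t p < ?t q" "p < q"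
      by (auto simp: inversions_def mem)
    then show "p = i \<and> q = Suc i"
      using ord[of p q] by (auto simp: doubleton_eq_iff)
  next
    fix p q
    assume "(p, q) \<in> ?R"
    then consider "(p, q) = (i, Suc i)" | "(?t p, ?t q) \<in> inversions P x"
      by (auto simp: t)
    then show "(p, q) \<in> ?L"
    proof cases
      case 2
      then have "?t p < ?t q" "x (?t q) < x (?t p)" "{?t p, ?t q} \<noteq> {i, Suc i}"
        using lt by (auto simp: inversions_def doubleton_eq_iff)
      then have "p < q"
        using ord[of "?t p" "?t q"] by auto
      then show ?thesis
        using 2 by (auto simp: inversions_def mem)
    qed (use P lt in \<open>auto simp: inversions_def\<close>)
  qed
  moreover have "(i, Suc i) \<notin> map_prod ?t ?t ` inversions P x"
    using lt by (auto simp: inversions_def transpose_def split: if_splits)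
  moreover have "inj_on (map_prod ?t ?t) (inversions P x)"
    by (rule inj_onI) (metis (no_types, opaque_lifting) map_prod_simp prod.inject surj_pair t)
  ultimately show ?thesis
    by (simp add: card_image finite_inversions P(1))
qed

lemma foldr_comp_append: "foldr (\<circ>) ss f = foldr (\<circ>) ss id \<circ> f"
  by (induction ss) (auto simp: comp_assoc)

lemma increasing_permutes_id:
  fixes w :: perm
  assumes w: "w permutes {l..m}" and inc: "\<And>i. i \<in> {l..<m} \<Longrightarrow> w i < w (Suc i)"
  shows "w = id"
proof -
  have lower: "l + k \<le> w (l + k)" if "l + k \<le> m" for k
    using that
  proof (induction k)
    case 0
    then show ?case using permutes_in_image[OF w, of l] by auto
  next
    case (Suc k)
    then show ?case using inc[of "l + k"] by auto
  qed
  have upper: "w (m - k) \<le> m - k" if "l \<le> m - k" "k \<le> m" for k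
    using that
  proof (induction k)
    case 0
    then show ?case using permutes_in_image[OF w, of m] by auto
  next
    case (Suc k)
    then have "Suc (m - Suc k) = m - k" "m - Suc k \<in> {l..<m}"
      by auto
    then have "w (m - Suc k) < w (m - k)"
      using inc by metis
    moreover have "w (m - k) \<le> m - k"
      using Suc by auto
    ultimately show ?case by auto
  qed
  show ?thesis
  proof
    fix i
    show "w i = id i"
    proof (cases "i \<in> {l..m}")
      case True
      then show ?thesis
        using lower[of "i - l"] upper[of "m - i"] by auto
    next
      case False
      then show ?thesis
        using w by (simp add: permutes_def)
    qed
  qed
qed

text \<open>Sorting a word by exchanging adjacent entries removes one inversion at a time. The
  interval \<open>{l..m}\<close> is general because the stabilizers of the points 1 and
  \<open>n\<close> are of this form too.\<close>

lemma reduced_word_exists: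
  assumes "w permutes {l..m}"
  shows "\<exists>ss. set ss \<subseteq> simple_refl ` {l..<m} \<and> length ss = card (inversions {l..m} w) \<and>
    foldr (\<circ>) ss id = w"
  using assms
proof (induction "card (inversions {l..m} w)" arbitrary: w)
  case 0
  then have e: "inversions {l..m} w = {}"
    by (simp add: finite_inversions)
  have "w = id"
  proof (rule increasing_permutes_id[OF 0(2)])
    fix i assume i: "i \<in> {l..<m}"
    then have "(i, Suc i) \<notin> inversions {l..m} w"
      using e by simp
    then have "w i \<le> w (Suc i)"
      using i by (auto simp: inversions_def)
    moreover have "w i \<noteq> w (Suc i)"
      using permutes_inj[OF 0(2)] by (metis injD n_not_Suc_n)
    ultimately show "w i < w (Suc i)"
      by simp
  qed
  then show ?case
    using 0 by (intro exI[of _ "[]"]) auto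
next
  case (Suc k)
  have "\<exists>i\<in>{l..<m}. w (Suc i) < w i"
  proof (rule ccontr)
    assume "\<not> ?thesis"
    then have "w i < w (Suc i)" if "i \<in> {l..<m}" for i
      using that permutes_inj[OF Suc.prems] by (metis injD linorder_neqE_nat n_not_Suc_n)
    then have "w = id"
      by (rule increasing_permutes_id[OF Suc.prems])
    then have "inversions {l..m} w = {}"
      by (auto simp: inversions_def)
    then show False
      using Suc(2) by simp
  qed
  then obtain i where i: "i \<in> {l..<m}" "w (Suc i) < w i"
    by blast
  let ?s = "transpose i (Suc i)"
  let ?w = "w \<circ> ?s"
  have ww: "?w \<circ> ?s = w"
    by (simp add: comp_assoc)
  have "Suc (card (inversions {l..m} ?w)) = card (inversions {l..m} w)"
    using card_inversions_adjacent[of "{l..m}" i ?w] i unfolding ww by auto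
  moreover have "?w permutes {l..m}"
    using i Suc.prems by (intro permutes_compose permutes_swap_id) auto
  ultimately obtain ss where ss: "set ss \<subseteq> simple_refl ` {l..<m}"
    "length ss = card (inversions {l..m} ?w)" "foldr (\<circ>) ss id = ?w"
    using Suc(1)[of ?w] Suc(2) by auto
  have "foldr (\<circ>) (ss @ [?s]) id = w"
    using foldr_comp_append[of ss ?s] ss(3) ww by simp
  then show ?case
    using ss i \<open>Suc (card (inversions {l..m} ?w)) = card (inversions {l..m} w)\<close>
    by (intro exI[of _ "ss @ [?s]"]) (auto simp: simple_refl_def)
qed

lemma word_permutes:
  assumes "set ss \<subseteq> simple_refl ` {l..<m}"
  shows "foldr (\<circ>) ss id permutes {l..m}"
  using assms
proof (induction ss)
  case (Cons s ss)
  then obtain i where i: "s = transpose i (Suc i)" "i \<in> {l..<m}"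
    by (auto simp: simple_refl_def)
  then have "s permutes {l..m}"
    by (auto intro: permutes_swap_id)
  moreover have "foldr (\<circ>) ss id permutes {l..m}"
    using Cons.prems by (intro Cons.IH) auto
  ultimately show ?case
    by (simp only: foldr_Cons o_apply[of "(\<circ>) s"] permutes_compose)
qed (simp only: foldr_Nil id_apply permutes_id)

lemma card_inversions_word_le:
  assumes "set ss \<subseteq> simple_refl ` {l..<m}"
  shows "card (inversions {l..m} (foldr (\<circ>) ss id)) \<le> length ss"
  using assms
proof (induction ss rule: rev_induct)
  case Nil
  have "inversions {l..m} (foldr (\<circ>) [] id) = {}"
    by (auto simp: inversions_def)
  then show ?case
    by (simp only: card.empty le0)
next
  case (snoc s ss)
  let ?w = "foldr (\<circ>) ss id"
  obtain i where i: "i \<in> {l..<m}" "s = transpose i (Suc i)"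
    using snoc.prems by (auto simp: simple_refl_def)
  have eq: "foldr (\<circ>) (ss @ [s]) id = ?w \<circ> s"
    using foldr_comp_append[of ss s] by simp
  have "?w i \<noteq> ?w (Suc i)"
    using permutes_inj[OF word_permutes] snoc.prems by (metis injD le_sup_iff n_not_Suc_n set_append)
  then have "card (inversions {l..m} (?w \<circ> s)) \<le> Suc (card (inversions {l..m} ?w))"
  proof (cases "?w i < ?w (Suc i)")
    case True
    then show ?thesis
      using card_inversions_adjacent[of "{l..m}" i ?w] i by auto
  next
    case False
    have "(?w \<circ> s) \<circ> transpose i (Suc i) = ?w"
      by (simp add: i comp_assoc)
    then show ?thesis
      using card_inversions_adjacent[of "{l..m}" i "?w \<circ> s"] i False \<open>?w i \<noteq> ?w (Suc i)\<close> by auto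
  qed
  moreover have "card (inversions {l..m} ?w) \<le> length ss"
    using snoc.prems by (intro snoc.IH) auto
  moreover have "length (ss @ [s]) = Suc (length ss)"
    by simp
  ultimately show ?case
    unfolding eq by linarith
qed

lemma cox_length_eq_card_inversions:
  assumes "w permutes {1..n}"
  shows "cox_length n w = card (inversions {1..n} w)"
proof -
  have s: "simple_refls n = simple_refl ` {1..<n}"
    by (cases n) (auto simp: simple_refls_def)
  show ?thesis
    unfolding cox_length_def s
  proof (rule Least_equality)
    show "\<exists>ss. set ss \<subseteq> simple_refl ` {1..<n} \<and> length ss = card (inversions {1..n} w) \<and>
      foldr (\<circ>) ss id = w"
      by (rule reduced_word_exists[OF assms])
  qed (use card_inversions_word_le in blast)
qed

text \<open>A reflection that multiplies from the left exchanges two values, hence also the entries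
  at two positions. In terms of positions, going up means that the smaller entry stands further
  left.\<close>

lemma bruhat_graph_iff:
  "(x, y) \<in> bruhat_graph n \<longleftrightarrow>
     x permutes {1..n} \<and> (\<exists>a b. a \<in> {1..n} \<and> b \<in> {1..n} \<and> a < b \<and> x a < x b \<and> y = x \<circ> transpose a b)"
    (is "?L \<longleftrightarrow> ?R")
proof -
  have up: "cox_length n x < cox_length n (x \<circ> transpose a b)"
    if "x permutes {1..n}" "a \<in> {1..n}" "b \<in> {1..n}" "a < b" "x a < x b" for x a b
  proof -
    have "x \<circ> transpose a b permutes {1..n}"
      using that by (intro permutes_compose permutes_swap_id) auto
    then show ?thesis
      using card_inversions_transpose_less[of "{1..n}" a b x] that
      by (simp add: cox_length_eq_card_inversions)
  qed
  show ?thesis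
  proof
    assume ?L
    then obtain i j where xy: "x permutes {1..n}" "y permutes {1..n}" "1 \<le> i" "i < j" "j \<le> n"
      "y = transpose i j \<circ> x" and len: "cox_length n x < cox_length n y"
      by (auto simp: bruhat_graph_def sym_group_carrier refls_def)
    define a b where "a = min (inv' x i) (inv' x j)" and "b = max (inv' x i) (inv' x j)"
    have "bij x"
      by (rule permutes_bij[OF xy(1)])
    then have y: "y = x \<circ> transpose (inv' x i) (inv' x j)"
      unfolding xy(6) by (rule transpose_comp_eq)
    have "inv' x i \<noteq> inv' x j"
      using xy permutes_inv_eq[OF xy(1)] by (metis less_irrefl)
    then have ab: "a < b" "y = x \<circ> transpose a b"
      unfolding y a_def b_def by (auto simp: min_def max_def transpose_commute)
    have "inv' x i \<in> {1..n}" "inv' x j \<in> {1..n}"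
      using xy(3-5) by (simp_all only: permutes_in_image[OF permutes_inv[OF xy(1)]]) auto
    then have in_n: "a \<in> {1..n}" "b \<in> {1..n}"
      unfolding a_def b_def min_def max_def by presburger+
    have "x a < x b"
    proof (rule ccontr)
      assume "\<not> x a < x b"
      then have "y a < y b"
        using ab(1) inj_eq[OF permutes_inj[OF xy(1)], of a b] unfolding ab(2) by auto
      moreover have "y \<circ> transpose a b = x"
        by (simp add: ab comp_assoc)
      ultimately show False
        using up[OF xy(2) in_n ab(1)] len by auto
    qed
    then show ?R
      using xy ab in_n by blast
  next
    assume ?R
    then obtain a b where ab: "x permutes {1..n}" "a \<in> {1..n}" "b \<in> {1..n}" "a < b" "x a < x b"
      "y = x \<circ> transpose a b"
      by blast
    have y: "y permutes {1..n}"
      unfolding ab(6) using ab by (intro permutes_compose permutes_swap_id) auto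
    have eq: "y = transpose (x a) (x b) \<circ> x"
      unfolding ab(6) using transpose_comp_eq[OF permutes_bij[OF ab(1)], of "x a" "x b"]
      by (simp add: permutes_inverses[OF ab(1)])
    have "x a \<in> {1..n}" "x b \<in> {1..n}"
      using ab permutes_in_image by metis+
    then have "transpose (x a) (x b) \<in> refls n"
      using ab by (auto simp: refls_def)
    then show ?L
      using ab(1) y eq up[OF ab(1-5)] ab(6) by (auto simp: bruhat_graph_def sym_group_carrier)
  qed
qed

definition exchange :: "perm \<Rightarrow> nat \<Rightarrow> nat \<Rightarrow> perm" where
  "exchange x a b = x(a := x b, b := x a)"

lemma exchange_apply: "exchange x a b q = (if q = a then x b else if q = b then x a else x q)"
  by (auto simp: exchange_def)

lemma exchange_eq_comp: "exchange x a b = x \<circ> transpose a b"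
  by (auto simp: fun_eq_iff exchange_apply transpose_def)

lemma exchange_commute: "exchange x a b = exchange x b a"
  by (auto simp: fun_eq_iff exchange_apply)

lemma exchange_exchange [simp]: "exchange (exchange x a b) a b = x"
  by (auto simp: fun_eq_iff exchange_apply)

lemma exchange_permutes:
  assumes "x permutes S" "a \<in> S" "b \<in> S"
  shows "exchange x a b permutes S"
  unfolding exchange_eq_comp using assms by (intro permutes_compose permutes_swap_id)

lemma exchange_inj: "inj x \<Longrightarrow> inj (exchange x a b)"
  by (auto simp: exchange_eq_comp intro: inj_compose)

lemma permutes_eq_iff: "x permutes S \<Longrightarrow> x a = x b \<longleftrightarrow> a = b"
  by (metis permutes_inj injD)

lemma bruhat_edge_iff:
  "(x, y) \<in> bruhat_graph n \<longleftrightarrow>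
     x permutes {1..n} \<and>
     (\<exists>a b. a \<in> {1..n} \<and> b \<in> {1..n} \<and> a < b \<and> x a < x b \<and> y = exchange x a b)"
  unfolding bruhat_graph_iff exchange_eq_comp ..

lemma bruhat_edgeE:
  assumes "(x, y) \<in> bruhat_graph n"
  obtains a b where "x permutes {1..n}" "y permutes {1..n}" "a \<in> {1..n}" "b \<in> {1..n}" "a < b"
    "x a < x b" "y = exchange x a b"
  using assms exchange_permutes unfolding bruhat_edge_iff by metis

lemma bruhat_edgeI:
  "\<lbrakk>x permutes {1..n}; a \<in> {1..n}; b \<in> {1..n}; a < b; x a < x b\<rbrakk> \<Longrightarrow>
    (x, exchange x a b) \<in> bruhat_graph n"
  unfolding bruhat_edge_iff by blast

lemma bruhat_edge_length: "(x, y) \<in> bruhat_graph n \<Longrightarrow> cox_length n x < cox_length n y"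
  by (auto simp: bruhat_graph_def)

lemma bruhat_edge_permutes:
  assumes "(x, y) \<in> bruhat_graph n"
  shows "x permutes {1..n}" "y permutes {1..n}"
  using assms by (auto simp: bruhat_graph_def sym_group_carrier)

section \<open>The Bruhat order\<close>

lemma bruhat_le_iff:
  "bruhat_le n x y \<longleftrightarrow> x permutes {1..n} \<and> y permutes {1..n} \<and> (x, y) \<in> (bruhat_graph n)\<^sup>*"
  by (simp add: bruhat_le_def sym_group_carrier)

lemma bruhat_le_permutes:
  assumes "bruhat_le n x y"
  shows "x permutes {1..n}" "y permutes {1..n}"
  using assms by (auto simp: bruhat_le_iff)

lemma bruhat_le_refl: "x permutes {1..n} \<Longrightarrow> bruhat_le n x x"
  by (simp add: bruhat_le_iff)

lemma bruhat_le_trans: "\<lbrakk>bruhat_le n x y; bruhat_le n y z\<rbrakk> \<Longrightarrow> bruhat_le n x z"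
  by (auto simp: bruhat_le_iff)

lemma bruhat_edge_le: "(x, y) \<in> bruhat_graph n \<Longrightarrow> bruhat_le n x y"
  by (auto simp: bruhat_le_iff dest: bruhat_edge_permutes)

lemma bruhat_le_induct [consumes 1, case_names refl step]:
  assumes "bruhat_le n x y"
    and "P x"
    and "\<And>y z. \<lbrakk>bruhat_le n x y; (y, z) \<in> bruhat_graph n; P y\<rbrakk> \<Longrightarrow> P z"
  shows "P y"
proof -
  have x: "x permutes {1..n}" and xy: "(x, y) \<in> (bruhat_graph n)\<^sup>*"
    using assms(1) by (auto simp: bruhat_le_iff)
  from xy have "bruhat_le n x y \<and> P y"
  proof (induction rule: rtrancl_induct)
    case base
    then show ?case using assms(2) x by (simp add: bruhat_le_refl)
  next
    case (step y z)
    then show ?case using assms(3) bruhat_edge_le bruhat_le_trans by blast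
  qed
  then show ?thesis ..
qed

lemma bruhat_le_length:
  assumes "bruhat_le n x y"
  shows "x = y \<or> cox_length n x < cox_length n y"
  using assms by (induction rule: bruhat_le_induct) (auto dest: bruhat_edge_length)

lemma bruhat_le_antisym: "\<lbrakk>bruhat_le n x y; bruhat_le n y x\<rbrakk> \<Longrightarrow> x = y"
  using bruhat_le_length by (metis less_asym)

lemma bruhat_min_eqI: "is_bruhat_min n A m \<Longrightarrow> bruhat_min n A = m"
  unfolding bruhat_min_def
  by (rule the_equality) (auto simp: is_bruhat_min_def intro: bruhat_le_antisym)

lemma bruhat_interval_iff: "x \<in> bruhat_interval n u v \<longleftrightarrow> bruhat_le n u x \<and> bruhat_le n x v"
  by (simp add: bruhat_interval_def)

lemma first_value_mono:
  assumes "bruhat_le n x y"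
  shows "x 1 \<le> y 1"
  using assms
proof (induction rule: bruhat_le_induct)
  case (step y z)
  from \<open>(y, z) \<in> bruhat_graph n\<close> show ?case
    by (rule bruhat_edgeE) (use step in \<open>auto simp: exchange_apply\<close>)
qed simp

section \<open>The lifting property\<close>

definition swap_values :: "nat \<Rightarrow> perm \<Rightarrow> perm" where
  "swap_values m x = transpose m (Suc m) \<circ> x"

lemma swap_values_apply: "swap_values m x q = transpose m (Suc m) (x q)"
  by (simp add: swap_values_def)

lemma swap_values_invol [simp]: "swap_values m (swap_values m x) = x"
  by (auto simp: swap_values_apply fun_eq_iff)

lemma swap_values_permutes:
  assumes "x permutes {1..n}" "1 \<le> m" "m < n"
  shows "swap_values m x permutes {1..n}"
  unfolding swap_values_def using assms by (intro permutes_compose permutes_swap_id) auto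

text \<open>Swapping two values that differ by one preserves the order of every other pair of
  values. It can therefore reverse an edge only if the edge performs this very swap. The lifting
  properties below follow by moving the swap along a chain of edges.\<close>

lemma swap_values_edge:
  assumes "(x, y) \<in> bruhat_graph n" "1 \<le> m" "m < n"
  shows "swap_values m x = y \<or> (swap_values m x, swap_values m y) \<in> bruhat_graph n"
proof -
  obtain a b where ab: "x permutes {1..n}" "a \<in> {1..n}" "b \<in> {1..n}" "a < b" "x a < x b"
    "y = exchange x a b"
    using assms(1) by (rule bruhat_edgeE)
  show ?thesis
  proof (cases "x a = m \<and> x b = Suc m")
    case True
    have "swap_values m x q = y q" for q
      using True ab(6) permutes_eq_iff[OF ab(1), of q a] permutes_eq_iff[OF ab(1), of q b]
      by (auto simp: swap_values_apply exchange_apply transpose_def)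
    then show ?thesis by blast
  next
    case False
    then have "swap_values m x a < swap_values m x b"
      using ab(5) by (auto simp: swap_values_apply transpose_def)
    moreover have "swap_values m y = exchange (swap_values m x) a b"
      by (auto simp: fun_eq_iff ab(6) swap_values_apply exchange_apply)
    ultimately show ?thesis
      using bruhat_edgeI[OF swap_values_permutes[OF ab(1) assms(2,3)]] ab by metis
  qed
qed

lemma swap_values_comparable:
  assumes x: "x permutes {1..n}" and m: "1 \<le> m" "m < n"
  shows "(x, swap_values m x) \<in> bruhat_graph n \<or> (swap_values m x, x) \<in> bruhat_graph n"
    and "\<lbrakk>x a = m; x b = Suc m; a < b\<rbrakk> \<Longrightarrow> (x, swap_values m x) \<in> bruhat_graph n"
proof -
  have up: "(x, swap_values m x) \<in> bruhat_graph n"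
    if "x permutes {1..n}" "x a = m" "x b = Suc m" "a < b" for x a b
  proof -
    have "a \<in> {1..n}" "b \<in> {1..n}"
      using that m permutes_in_image[OF that(1)] by (metis atLeastAtMost_iff le_SucI Suc_leI less_imp_le)+
    moreover have "swap_values m x = exchange x a b"
      using permutes_eq_iff[OF that(1)] that
      by (force simp: fun_eq_iff swap_values_apply exchange_apply transpose_def)
    ultimately show ?thesis
      using that bruhat_edgeI by auto
  qed
  then show "\<lbrakk>x a = m; x b = Suc m; a < b\<rbrakk> \<Longrightarrow> (x, swap_values m x) \<in> bruhat_graph n"
    using x by blast
  obtain a b where ab: "x a = m" "x b = Suc m"
    using permutes_surj[OF x] by (metis surjD)
  then have "a \<noteq> b" by auto
  then consider "a < b" | "b < a" by linarith
  then show "(x, swap_values m x) \<in> bruhat_graph n \<or> (swap_values m x, x) \<in> bruhat_graph n"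
  proof cases
    case 2
    then show ?thesis
      using up[OF swap_values_permutes[OF x m], of b a] ab by (auto simp: swap_values_apply)
  qed (use up[OF x] ab in blast)
qed

lemma lifting_both_up:
  assumes "bruhat_le n x w" "1 \<le> m" "m < n" "(w, swap_values m w) \<in> bruhat_graph n"
  shows "bruhat_le n (swap_values m x) (swap_values m w)"
proof -
  have "bruhat_le n (swap_values m x) w \<or> bruhat_le n (swap_values m x) (swap_values m w)"
    using assms(1)
  proof (induction rule: bruhat_le_induct)
    case refl
    then show ?case
      using bruhat_le_refl swap_values_permutes bruhat_le_permutes assms by metis
  next
    case (step y z)
    then show ?case
      using swap_values_edge[OF step(2) assms(2,3)]
      by (metis bruhat_edge_le bruhat_le_trans swap_values_invol)
  qed
  then show ?thesis
    using bruhat_edge_le[OF assms(4)] bruhat_le_trans by blast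
qed

lemma lifting_up:
  assumes "bruhat_le n u y" "1 \<le> m" "m < n" "(u, swap_values m u) \<in> bruhat_graph n"
  shows "bruhat_le n u (swap_values m y)"
  using assms(1)
proof (induction rule: bruhat_le_induct)
  case refl
  then show ?case using assms(4) by (rule bruhat_edge_le)
next
  case (step y z)
  then show ?case
    using swap_values_edge[OF step(2) assms(2,3)]
    by (metis bruhat_edge_le bruhat_le_trans swap_values_invol)
qed

lemma lifting_both_down:
  assumes "bruhat_le n u y" "1 \<le> m" "m < n" "(swap_values m u, u) \<in> bruhat_graph n"
  shows "bruhat_le n (swap_values m u) (swap_values m y)"
  using lifting_up[of n "swap_values m u" y m] assms bruhat_edge_le bruhat_le_trans
  by (metis swap_values_invol)

text \<open>Induction on the prescribed first value: a permutation that starts with $m + 1$ is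
  obtained from one that starts with $m$ by an ascending swap of these two values. By lifting, the
  permutations above \<open>u\<close> that start with $m + 1$ correspond to those that start with
  $m$ and lie above the lower one of \<open>u\<close> and its swap, so that the minimum for $m$
  lifts to the minimum for $m + 1$.\<close>

lemma first_value_min_exists:
  assumes "u permutes {1..n}" "m \<le> n" "u 1 \<le> m" "1 \<le> n"
  shows "\<exists>z. z 1 = m \<and> bruhat_le n u z \<and> (\<forall>y. y 1 = m \<longrightarrow> bruhat_le n u y \<longrightarrow> bruhat_le n z y)"
  using assms
proof (induction m arbitrary: u)
  case 0
  then show ?case
    using permutes_in_image[of u "{1..n}" 1] by auto
next
  case (Suc m)
  show ?case
  proof (cases "u 1 = Suc m")
    case True
    then show ?thesis
      using bruhat_le_refl Suc.prems by blast
  next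
    case False
    have "1 \<le> u 1"
      using permutes_in_image[OF Suc.prems(1), of 1] Suc.prems by auto
    then have m: "1 \<le> m" "m < n" "u 1 \<le> m"
      using False Suc.prems by auto
    let ?s = "swap_values m"
    have up: "(y, ?s y) \<in> bruhat_graph n" if y: "y permutes {1..n}" "y 1 = m" for y
    proof -
      obtain b where b: "y b = Suc m"
        using permutes_surj[OF y(1)] by (metis surjD)
      then have "b \<in> {1..n}" "b \<noteq> 1"
        using m permutes_in_image[OF y(1), of b] y(2) by auto
      then have "1 < b"
        by auto
      then show ?thesis
        using swap_values_comparable(2)[OF y(1) m(1,2) y(2) b] by blast
    qed
    define u' where "u' = (if (?s u, u) \<in> bruhat_graph n then ?s u else u)"
    have u': "u' permutes {1..n}"
      using swap_values_permutes Suc.prems m by (auto simp: u'_def)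
    have "\<not> (?s u, u) \<in> bruhat_graph n" if "u 1 = m"
      using up[OF Suc.prems(1) that] bruhat_edge_length less_asym by blast
    then have "u' 1 \<le> m"
      using m by (auto simp: u'_def swap_values_apply transpose_def)
    then obtain z where z: "z 1 = m" "bruhat_le n u' z"
      and min: "\<And>y. \<lbrakk>y 1 = m; bruhat_le n u' y\<rbrakk> \<Longrightarrow> bruhat_le n z y"
      using Suc.IH[OF u'] m by auto
    have z_up: "(z, ?s z) \<in> bruhat_graph n"
      using up z bruhat_le_permutes by blast
    have "bruhat_le n u (?s z)"
      using lifting_both_up[OF z(2) m(1,2) z_up] bruhat_edge_le[OF z_up] z(2) bruhat_le_trans
      by (auto simp: u'_def split: if_splits)
    moreover have "bruhat_le n (?s z) y" if y: "y 1 = Suc m" "bruhat_le n u y" for y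
    proof -
      have yp: "y permutes {1..n}"
        using y bruhat_le_permutes by blast
      have sy1: "?s y 1 = m"
        using y by (simp add: swap_values_apply)
      have "bruhat_le n u' (?s y)"
      proof (cases "(?s u, u) \<in> bruhat_graph n")
        case True
        then show ?thesis
          using lifting_both_down[OF y(2) m(1,2)] by (simp add: u'_def)
      next
        case False
        then have "(u, ?s u) \<in> bruhat_graph n"
          using swap_values_comparable(1)[OF Suc.prems(1) m(1,2)] by blast
        then show ?thesis
          using lifting_up[OF y(2) m(1,2)] False by (simp add: u'_def)
      qed
      then have "bruhat_le n z (?s y)"
        using min[of "?s y"] sy1 by simp
      moreover have "(?s y, ?s (?s y)) \<in> bruhat_graph n"
        by (rule up[OF swap_values_permutes[OF yp m(1,2)] sy1])
      ultimately show ?thesis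
        using lifting_both_up[OF _ m(1,2)] by fastforce
    qed
    moreover have "?s z 1 = Suc m"
      using z by (simp add: swap_values_apply)
    ultimately show ?thesis by blast
  qed
qed

section \<open>Hypercubes below a permutation\<close>

text \<open>For $D = \{d_1 < \dots < d_r\}$ the entries of \<open>p\<close> at the positions $1,
  d_1, \dots, d_r$ are rotated one step to the left, so that $p(1)$ ends up at position $d_r$. For
  increasing $p(d_1) < \dots < p(d_r) < p(1)$ these permutations are the vertices of the hypercube
  below \<open>p\<close>: \<open>D\<close> is the set of the coordinates that have not been added
  yet.\<close>

definition rotate_back :: "perm \<Rightarrow> nat set \<Rightarrow> perm" where
  "rotate_back p D q =
     (if q \<in> insert 1 D then (if {d \<in> D. q < d} = {} then p 1 else p (Min {d \<in> D. q < d})) else p q)"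

lemma rotate_back_empty [simp]: "rotate_back p {} = p"
  by (auto simp: rotate_back_def fun_eq_iff)

text \<open>Rotating \<open>D\<close> and rotating $D - \{d\}$ differ only in the order of two
  entries, which stand at \<open>d\<close> and at its predecessor \<open>e\<close> among the rotated
  positions.\<close>

lemma rotate_back_remove:
  assumes D: "finite D" "d \<in> D" "\<forall>j\<in>D. 1 < j"
  defines "e \<equiv> Max {q \<in> insert 1 D. q < d}"
  shows "rotate_back p (D - {d}) = exchange (rotate_back p D) e d"
    and "rotate_back p D e = p d" and "e < d" and "e \<in> insert 1 D"
    and "rotate_back p D d = (if {j \<in> D. d < j} = {} then p 1 else p (Min {j \<in> D. d < j}))"
proof -
  have ne: "{q \<in> insert 1 D. q < d} \<noteq> {}" and fin: "finite {q \<in> insert 1 D. q < d}"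
    using D by auto
  have "e \<in> {q \<in> insert 1 D. q < d}"
    unfolding e_def by (rule Max_in[OF fin ne])
  then have e: "e \<in> insert 1 D" "e < d"
    by simp_all
  have emax: "q \<le> e" if "q \<in> insert 1 D" "q < d" for q
    unfolding e_def using that by (intro Max_ge[OF fin]) simp
  have mind: "Min {j \<in> D. e < j} = d"
  proof (rule Min_eqI)
    fix j assume j: "j \<in> {j \<in> D. e < j}"
    then have "\<not> j < d"
      using emax[of j] by auto
    then show "d \<le> j" by simp
  qed (use D e in auto)
  show "rotate_back p D e = p d"
    using mind e D(2) by (auto simp: rotate_back_def)
  show "rotate_back p D d = (if {j \<in> D. d < j} = {} then p 1 else p (Min {j \<in> D. d < j}))"
    using D(2) by (simp add: rotate_back_def)
  show "rotate_back p (D - {d}) = exchange (rotate_back p D) e d"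
  proof
    fix q
    consider "q = e" | "q = d" | "q \<noteq> d" "q \<notin> insert 1 D" | "q \<in> insert 1 D" "q < e"
      | "q \<in> insert 1 D" "d < q"
      using emax[of q] by fastforce
    then show "rotate_back p (D - {d}) q = exchange (rotate_back p D) e d q"
    proof cases
      case 1
      have "{j \<in> D - {d}. e < j} = {j \<in> D. d < j}"
        using e emax by force
      then show ?thesis
        using 1 e D by (auto simp: rotate_back_def exchange_apply)
    next
      case 2
      have "rotate_back p D e = p d"
        by fact
      then show ?thesis
        using 2 e D by (auto simp: rotate_back_def[of p "D - {d}"] exchange_apply)
    next
      case 3
      then show ?thesis
        using e D by (auto simp: rotate_back_def exchange_apply)
    next
      case 4
      then have "e \<in> D"
        using e D by auto
      then have ne: "{j \<in> D - {d}. q < j} \<noteq> {}" "finite {j \<in> D - {d}. q < j}"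
        using 4 e D by auto
      have "Min {j \<in> D. q < j} = Min (insert d {j \<in> D - {d}. q < j})"
        using 4 e D by (intro arg_cong[of _ _ Min]) auto
      also have "\<dots> = min d (Min {j \<in> D - {d}. q < j})"
        using ne by simp
      also have "Min {j \<in> D - {d}. q < j} \<le> e"
        using ne(2) \<open>e \<in> D\<close> 4 e by (intro Min_le) auto
      then have "min d (Min {j \<in> D - {d}. q < j}) = Min {j \<in> D - {d}. q < j}"
        using e by auto
      finally have "Min {j \<in> D. q < j} = Min {j \<in> D - {d}. q < j}" .
      moreover have "{j \<in> D. q < j} \<noteq> {}"
        using ne by auto
      ultimately show ?thesis
        using 4 ne e by (auto simp: rotate_back_def exchange_apply)
    next
      case 5
      then have "{j \<in> D - {d}. q < j} = {j \<in> D. q < j}"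
        by auto
      then show ?thesis
        using 5 e by (auto simp: rotate_back_def exchange_apply)
    qed
  qed
  show "e < d" "e \<in> insert 1 D"
    by (fact e)+
qed

lemma rotate_back_permutes:
  assumes "finite D" "p permutes {1..n}" "D \<subseteq> {2..n}"
  shows "rotate_back p D permutes {1..n}"
  using assms
proof (induction "card D" arbitrary: D)
  case 0
  then show ?case by simp
next
  case (Suc k)
  then obtain d where d: "d \<in> D"
    by (metis card.empty ex_in_conv nat.distinct(1))
  have D: "\<forall>j\<in>D. 1 < j"
    using Suc.prems by auto
  define e where "e = Max {q \<in> insert 1 D. q < d}"
  note r = rotate_back_remove[OF Suc.prems(1) d D, folded e_def]
  have "rotate_back p (D - {d}) permutes {1..n}"
    using Suc d by (intro Suc(1)) auto
  moreover have "e \<in> {1..n}" "d \<in> {1..n}"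
    using r(3,4) d Suc.prems(3) by auto
  ultimately have "exchange (rotate_back p (D - {d})) e d permutes {1..n}"
    by (intro exchange_permutes)
  then show ?case
    by (simp add: r(1))
qed

lemma rotate_back_edge:
  assumes D: "finite D" "D \<subseteq> {2..n}" "d \<in> D" and p: "p permutes {1..n}"
    and inc: "strict_mono_on D p" "\<forall>j\<in>D. p j < p 1"
  shows "(rotate_back p D, rotate_back p (D - {d})) \<in> bruhat_graph n"
    and "p d < rotate_back p D d"
proof -
  have D1: "\<forall>j\<in>D. 1 < j"
    using D by auto
  define e where "e = Max {q \<in> insert 1 D. q < d}"
  note r = rotate_back_remove[OF D(1,3) D1, folded e_def]
  show less: "p d < rotate_back p D d"
  proof (cases "{j \<in> D. d < j} = {}")
    case True
    then show ?thesis using r(5) inc(2) D(3) by auto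
  next
    case False
    then have "Min {j \<in> D. d < j} \<in> {j \<in> D. d < j}"
      using D by (intro Min_in) auto
    then show ?thesis
      using r(5) False inc(1) D(3) by (auto simp: strict_mono_on_def)
  qed
  have "e \<in> {1..n}" "d \<in> {1..n}"
    using r(3,4) D by auto
  then show "(rotate_back p D, rotate_back p (D - {d})) \<in> bruhat_graph n"
    using r less bruhat_edgeI[OF rotate_back_permutes[OF D(1) p D(2)], of e d] by auto
qed

text \<open>The two upper words differ at each of the positions \<open>e\<close>, \<open>d\<close>,
  \<open>f\<close>, while \<open>y\<close> differs from each of them at only two positions. This
  forces \<open>y\<close> to differ from them only at these three. The upper word \<open>exchange w
  d f\<close> has a single inversion there, and undoing it gives \<open>w\<close>.\<close>

lemma common_lower_neighbour_unique:
  assumes w: "w permutes {1..n}" and pos: "e < d" "d < f" and val: "w e < w d" "w d < w f"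
    and edges: "(y, exchange w d f) \<in> bruhat_graph n" "(y, exchange w e d) \<in> bruhat_graph n"
  shows "y = w"
proof -
  obtain a b where ab: "a < b" "y a < y b" "exchange w d f = exchange y a b"
    using edges(1) by (auto elim: bruhat_edgeE)
  obtain a' b' where ab': "a' < b'" "exchange w e d = exchange y a' b'"
    using edges(2) by (auto elim: bruhat_edgeE)
  have y: "y = exchange (exchange w d f) a b" "y = exchange (exchange w e d) a' b'"
    using ab ab' by (metis exchange_exchange)+
  have inj: "w q = w r \<longleftrightarrow> q = r" for q r
    by (rule permutes_eq_iff[OF w])
  have y_perm: "y permutes {1..n}"
    by (rule bruhat_edge_permutes(1)[OF edges(1)])
  have 1: "q = a \<or> q = b \<longleftrightarrow> y q \<noteq> exchange w d f q" for q
    using ab(1) permutes_eq_iff[OF y_perm] unfolding ab(3) by (auto simp: exchange_apply)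
  have 2: "q = a' \<or> q = b' \<longleftrightarrow> y q \<noteq> exchange w e d q" for q
    using ab'(1) permutes_eq_iff[OF y_perm] unfolding ab'(2) by (auto simp: exchange_apply)
  have 3: "q = d \<or> q = e \<or> q = f \<longleftrightarrow> exchange w d f q \<noteq> exchange w e d q" for q
    using pos by (auto simp: exchange_apply inj)
  have 4: "q = a \<or> q = b \<or> q = a' \<or> q = b'" if "q = d \<or> q = e \<or> q = f" for q
    using 1[of q] 2[of q] 3[of q] that by argo
  have 5: "(q = a \<or> q = b) = (q = a' \<or> q = b')" if "\<not> (q = d \<or> q = e \<or> q = f)" for q
    using 1[of q] 2[of q] 3[of q] that by argo
  have "a \<in> {e, d, f}"
    using 4[of d] 4[of e] 4[of f] 5[of a] pos by auto
  moreover have "b \<in> {e, d, f}"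
    using 4[of d] 4[of e] 4[of f] 5[of b] pos by auto
  ultimately
  have "a = d \<and> b = f"
    using ab(1,2) pos val unfolding y(1) by (auto simp: exchange_apply split: if_splits)
  then show ?thesis
    using y(1) by simp
qed

text \<open>The embedding sends a set of edges to the rotation of \<open>p\<close> along the missing
  positions. It is unique since a vertex with at least two missing coordinates is a common lower
  neighbour of the two vertices in which the largest and the second largest missing position is
  added; these are adjacent among the rotated positions, so that there is no choice.\<close>

lemma star_spans_hypercube:
  assumes p: "p permutes {1..n}" and J: "J \<subseteq> {2..n}"
    and inc: "strict_mono_on J p" "\<forall>j\<in>J. p j < p 1"
  shows "spans_hypercube n p ((\<lambda>j. (exchange p 1 j, p)) ` J)"
proof -
  define e where "e = (\<lambda>j. (exchange p 1 j, p))"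
  define E where "E = e ` J"
  define D where "D = (\<lambda>A. {j \<in> J. e j \<notin> A})"
  define \<theta> where "\<theta> = (\<lambda>A. if A \<subseteq> E then rotate_back p (D A) else undefined)"
  have finJ: "finite J"
    using J finite_subset by blast
  have inj: "p q = p r \<longleftrightarrow> q = r" for q r
    by (rule permutes_eq_iff[OF p])
  have inj_e: "e i = e j \<longleftrightarrow> i = j" if "i \<in> J" "j \<in> J" for i j
  proof
    assume "e i = e j"
    then have "exchange p 1 i 1 = exchange p 1 j 1"
      by (simp add: e_def)
    then show "i = j"
      by (simp add: exchange_apply inj)
  qed simp
  have sub: "finite (D A)" "D A \<subseteq> {2..n}" "D A \<subseteq> J" "strict_mono_on (D A) p"
    "\<forall>j\<in>D A. p j < p 1" for A
    using finJ J inc by (auto simp: D_def strict_mono_on_def)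
  have D_insert: "D (insert (e j) A) = D A - {j}" if "j \<in> J" for j A
    using that inj_e by (auto simp: D_def)
  have A_eq: "A = E - e ` D A" if "A \<subseteq> E" for A
    using that inj_e by (auto simp: D_def E_def)
  have D_E: "D E = {}"
    by (auto simp: D_def E_def)
  have D_single: "D (E - {e j}) = {j}" if "j \<in> J" for j
    using that inj_e by (auto simp: D_def E_def)
  have single: "rotate_back p {j} = exchange p 1 j" if "j \<in> J" for j
  proof -
    have "1 < j" using that J by auto
    then have "{q. (q = 1 \<or> q = j) \<and> q < j} = {1}" by auto
    then show ?thesis
      using rotate_back_remove(1)[of "{j}" j p] \<open>1 < j\<close> by simp (metis exchange_exchange)
  qed
  have edge: "(rotate_back p (D A), rotate_back p (D (insert \<alpha> A))) \<in> bruhat_graph n"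
    if "\<alpha> \<in> E - A" for A \<alpha>
  proof -
    from that obtain j where j: "j \<in> J" "\<alpha> = e j" "j \<in> D A"
      by (auto simp: E_def D_def)
    show ?thesis
      unfolding j(2) D_insert[OF j(1)]
      by (rule rotate_back_edge[OF sub(1,2) j(3) p sub(4,5)])
  qed
  have D_support: "D A = {q. q \<noteq> 1 \<and> rotate_back p (D A) q \<noteq> p q}" for A
  proof -
    have "rotate_back p (D A) q \<noteq> p q" if "q \<in> D A" for q
      using rotate_back_edge(2)[OF sub(1,2) that p sub(4,5)] by simp
    moreover have "rotate_back p (D A) q = p q" if "q \<notin> insert 1 (D A)" for q
      using that by (simp add: rotate_back_def)
    moreover have "1 \<notin> D A"
      using sub(2)[of A] by auto
    ultimately show ?thesis by blast
  qed
  have ok: "hypercube_embedding n E \<theta> \<and> \<theta> E = p \<and> (\<forall>\<alpha>\<in>E. (\<theta> (E - {\<alpha>}), \<theta> E) = \<alpha>)"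
  proof (intro conjI)
    have "inj_on \<theta> (Pow E)"
    proof (rule inj_onI)
      fix A B assume AB: "A \<in> Pow E" "B \<in> Pow E" "\<theta> A = \<theta> B"
      then have "D A = D B"
        using D_support[of A] D_support[of B] by (auto simp: \<theta>_def)
      then show "A = B"
        using A_eq[of A] A_eq[of B] AB(1,2) by simp
    qed
    moreover have "\<theta> \<in> Pow E \<rightarrow>\<^sub>E carrier (sym_group n)"
      using rotate_back_permutes[OF sub(1) p sub(2)]
      by (intro PiE_I) (auto simp: \<theta>_def sym_group_carrier)
    ultimately show "hypercube_embedding n E \<theta>"
      using edge by (auto simp: hypercube_embedding_def hypercube_edges_def \<theta>_def)
    show "\<theta> E = p"
      by (simp add: \<theta>_def D_E)
    show "\<forall>\<alpha>\<in>E. (\<theta> (E - {\<alpha>}), \<theta> E) = \<alpha>"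
    proof
      fix \<alpha> assume "\<alpha> \<in> E"
      then obtain j where "j \<in> J" "\<alpha> = e j"
        by (auto simp: E_def)
      then show "(\<theta> (E - {\<alpha>}), \<theta> E) = \<alpha>"
        by (auto simp: \<theta>_def D_E D_single single) (simp add: e_def)
    qed
  qed
  have unique: "\<theta>' = \<theta>"
    if \<theta>': "hypercube_embedding n E \<theta>'" "\<theta>' E = p" "\<forall>\<alpha>\<in>E. (\<theta>' (E - {\<alpha>}), \<theta>' E) = \<alpha>" for \<theta>'
  proof
    have edge': "(\<theta>' A, \<theta>' (insert \<alpha> A)) \<in> bruhat_graph n" if "A \<subseteq> E" "\<alpha> \<in> E - A" for A \<alpha>
    proof -
      have "(A, insert \<alpha> A) \<in> hypercube_edges E"
        unfolding hypercube_edges_def using that by blast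
      then show ?thesis
        using \<theta>'(1) by (auto simp: hypercube_embedding_def)
    qed
    have main: "\<theta>' A = rotate_back p (D A)" if "A \<subseteq> E" for A
      using that
    proof (induction "card (D A)" arbitrary: A rule: less_induct)
      case less
      consider "D A = {}" | j where "D A = {j}" | d1 d2 where "d1 \<in> D A" "d2 \<in> D A" "d1 \<noteq> d2"
        by blast
      then show ?case
      proof cases
        case 1
        then have "A = E" using A_eq[OF less.prems] by simp
        then show ?thesis using 1 \<theta>'(2) by simp
      next
        case (2 j)
        then have "j \<in> J" using sub(3)[of A] by auto
        then have "e j \<in> E" by (simp add: E_def)
        then have "(\<theta>' (E - {e j}), \<theta>' E) = e j"
          using \<theta>'(3) by blast
        moreover have "A = E - {e j}"
          using A_eq[OF less.prems] 2 by simp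
        ultimately show ?thesis
          using 2 single[OF \<open>j \<in> J\<close>] by (simp add: e_def)
      next
        case 3
        \<comment> \<open>The two largest elements of the complement give two adjacent transpositions.\<close>
        define f where "f = Max (D A)"
        have f: "f \<in> D A" "\<And>j. j \<in> D A \<Longrightarrow> j \<le> f"
          unfolding f_def using 3 sub(1)[of A] by (auto intro: Max_in)
        have D1: "\<forall>j\<in>D A. 1 < j"
          using sub(2)[of A] by auto
        have ne: "D A - {f} \<noteq> {}"
          using 3 by auto
        define d where "d = Max {q \<in> insert 1 (D A). q < f}"
        note rf = rotate_back_remove[OF sub(1) f(1) D1, folded d_def]
        obtain j where j: "j \<in> D A" "j \<noteq> f"
          using ne by blast
        then have "j < f"
          using f(2)[of j] by simp
        then have "j \<le> d"
          unfolding d_def using j sub(1)[of A] by (intro Max_ge) auto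
        then have "d \<noteq> 1"
          using D1 j by auto
        then have d: "d \<in> D A"
          using rf(4) by simp
        define c where "c = Max {q \<in> insert 1 (D A). q < d}"
        let ?w = "rotate_back p (D A)"
        note rd = rotate_back_remove[OF sub(1) d D1, folded c_def]
        have lower: "\<theta>' (insert (e j) A) = rotate_back p (D A - {j})" if "j \<in> D A" for j
        proof -
          have j: "j \<in> J" using that sub(3)[of A] by auto
          have "card (D (insert (e j) A)) < card (D A)"
            unfolding D_insert[OF j] using that sub(1)[of A] by (intro card_Diff1_less)
          moreover have "insert (e j) A \<subseteq> E"
            using less.prems j by (auto simp: E_def)
          ultimately show ?thesis
            using less.hyps D_insert[OF j] by metis
        qed
        have up: "(\<theta>' A, rotate_back p (D A - {j})) \<in> bruhat_graph n" if "j \<in> D A" for j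
          using edge'[OF less.prems, of "e j"] lower[OF that] that by (auto simp: D_def E_def)
        show ?thesis
        proof (rule common_lower_neighbour_unique)
          show "?w permutes {1..n}"
            by (rule rotate_back_permutes[OF sub(1) p sub(2)])
          show "(\<theta>' A, exchange ?w d f) \<in> bruhat_graph n"
            using up[OF f(1)] by (simp add: rf(1))
          show "(\<theta>' A, exchange ?w c d) \<in> bruhat_graph n"
            using up[OF d] by (simp add: rd(1))
          show "c < d" "d < f"
            using rf rd by auto
          show "?w c < ?w d" "?w d < ?w f"
            using rf(2)[of p] rd(2)[of p] rotate_back_edge(2)[OF sub(1,2) f(1) p sub(4,5)]
              rotate_back_edge(2)[OF sub(1,2) d p sub(4,5)] by auto
        qed
      qed
    qed
    fix A
    show "\<theta>' A = \<theta> A"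
      using main[of A] \<theta>'(1) by (cases "A \<subseteq> E") (auto simp: \<theta>_def hypercube_embedding_def PiE_def extensional_def)
  qed
  have "\<exists>!\<theta>. hypercube_embedding n E \<theta> \<and> \<theta> E = p \<and> (\<forall>\<alpha>\<in>E. (\<theta> (E - {\<alpha>}), \<theta> E) = \<alpha>)"
    using ok unique by (intro ex1I[of _ \<theta>]) blast+
  then show ?thesis
    unfolding spans_hypercube_def E_def e_def .
qed

text \<open>Read contrapositively: pairwise incomparable sources of edges into \<open>p\<close> come
  from positions at which \<open>p\<close> increases, and such positions span a hypercube.\<close>

lemma star_source_le:
  assumes "p permutes {1..n}" "j \<in> {2..n}" "k \<in> {2..n}" "j < k" "p k < p j" "p j < p 1"
  shows "bruhat_le n (exchange p 1 k) (exchange p 1 j)"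
proof -
  let ?x = "exchange p 1 k"
  let ?y = "exchange ?x 1 j"
  have "(?x, ?y) \<in> bruhat_graph n"
    using assms by (intro bruhat_edgeI exchange_permutes) (auto simp: exchange_apply)
  moreover have "(?y, exchange ?y j k) \<in> bruhat_graph n"
    using assms by (intro bruhat_edgeI exchange_permutes) (auto simp: exchange_apply)
  moreover have "exchange ?y j k = exchange p 1 j"
    using assms by (auto simp: exchange_apply fun_eq_iff)
  ultimately show ?thesis
    using bruhat_edge_le bruhat_le_trans by metis
qed

lemma edge_changing_first_value:
  assumes "(x, p) \<in> bruhat_graph n" "x 1 \<noteq> p 1"
  obtains j where "j \<in> {2..n}" "x = exchange p 1 j" "p j < p 1"
proof -
  obtain a b where ab: "a \<in> {1..n}" "b \<in> {1..n}" "a < b" "x a < x b" "p = exchange x a b"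
    using assms(1) by (rule bruhat_edgeE)
  have "a = 1"
    using assms(2) ab by (auto simp: exchange_apply split: if_splits)
  then show ?thesis
    using ab that[of b] by (auto simp: exchange_apply)
qed

lemma first_value_cluster:
  assumes p: "p permutes {1..n}" and E: "\<And>\<alpha>. \<alpha> \<in> E \<Longrightarrow> \<exists>x. \<alpha> = (x, p) \<and> (x, p) \<in> bruhat_graph n \<and> x 1 \<noteq> p 1"
  shows "spans_hypercube_cluster n p E"
  unfolding spans_hypercube_cluster_def
proof (intro allI impI)
  fix E' assume E': "E' \<subseteq> E" and inc: "pairwise (\<lambda>\<alpha> \<beta>. bruhat_incomparable n (fst \<alpha>) (fst \<beta>)) E'"
  define J where "J = {j \<in> {2..n}. p j < p 1 \<and> (exchange p 1 j, p) \<in> E'}"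
  have E'_eq: "E' = (\<lambda>j. (exchange p 1 j, p)) ` J"
  proof
    show "E' \<subseteq> (\<lambda>j. (exchange p 1 j, p)) ` J"
    proof
      fix \<alpha> assume \<alpha>: "\<alpha> \<in> E'"
      then obtain x where "\<alpha> = (x, p)" "(x, p) \<in> bruhat_graph n" "x 1 \<noteq> p 1"
        using E E' by blast
      then show "\<alpha> \<in> (\<lambda>j. (exchange p 1 j, p)) ` J"
        using \<alpha> by (auto simp: J_def elim!: edge_changing_first_value)
    qed
  qed (auto simp: J_def)
  have "p j < p k" if "j \<in> J" "k \<in> J" "j < k" for j k
  proof (rule ccontr)
    assume "\<not> p j < p k"
    then have "p k < p j"
      using that permutes_eq_iff[OF p, of j k] by (meson less_irrefl linorder_neqE_nat)
    then have le: "bruhat_le n (exchange p 1 k) (exchange p 1 j)"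
      using that p by (intro star_source_le) (auto simp: J_def)
    have "exchange p 1 k 1 \<noteq> exchange p 1 j 1"
      using that permutes_eq_iff[OF p, of j k] by (auto simp: exchange_apply)
    then have "(exchange p 1 k, p) \<noteq> (exchange p 1 j, p)"
      by auto
    then have "bruhat_incomparable n (exchange p 1 k) (exchange p 1 j)"
      using pairwiseD[OF inc, of "(exchange p 1 k, p)" "(exchange p 1 j, p)"] that
      by (simp add: J_def)
    then show False
      using le by (auto simp: bruhat_incomparable_def)
  qed
  then have "strict_mono_on J p"
    by (auto simp: strict_mono_on_def)
  then have "spans_hypercube n p ((\<lambda>j. (exchange p 1 j, p)) ` J)"
    by (intro star_spans_hypercube[OF p]) (auto simp: J_def)
  then show "spans_hypercube n p E'"
    using E'_eq by metis
qed

section \<open>Paths and sequences of exchanges\<close>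

fun exchanges :: "perm \<Rightarrow> (nat \<times> nat) list \<Rightarrow> perm" where
  "exchanges x [] = x"
| "exchanges x ((a, b) # es) = exchanges (exchange x a b) es"

fun upward :: "perm \<Rightarrow> (nat \<times> nat) list \<Rightarrow> bool" where
  "upward x [] \<longleftrightarrow> True"
| "upward x ((a, b) # es) \<longleftrightarrow> x a < x b \<and> upward (exchange x a b) es"

definition position_pairs :: "nat \<Rightarrow> (nat \<times> nat) set" where
  "position_pairs n = {(a, b). a \<in> {1..n} \<and> b \<in> {1..n} \<and> a < b}"

lemma exchanges_append: "exchanges x (es @ fs) = exchanges (exchanges x es) fs"
  by (induction x es rule: exchanges.induct) auto

lemma upward_append: "upward x (es @ fs) \<longleftrightarrow> upward x es \<and> upward (exchanges x es) fs"
  by (induction x es rule: exchanges.induct) auto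

lemma exchanges_permutes:
  assumes "x permutes {1..n}" "set es \<subseteq> position_pairs n"
  shows "exchanges x es permutes {1..n}"
  using assms
  by (induction x es rule: exchanges.induct) (auto simp: position_pairs_def exchange_permutes)

lemma relpow_bruhat_graph_iff:
  assumes "x permutes {1..n}"
  shows "(x, y) \<in> bruhat_graph n ^^ k \<longleftrightarrow>
    (\<exists>es. length es = k \<and> set es \<subseteq> position_pairs n \<and> upward x es \<and> y = exchanges x es)"
  using assms
proof (induction k arbitrary: x)
  case (Suc k)
  show ?case
  proof
    assume "(x, y) \<in> bruhat_graph n ^^ Suc k"
    then obtain z where z: "(x, z) \<in> bruhat_graph n" "(z, y) \<in> bruhat_graph n ^^ k"
      by (meson relpow_Suc_D2)
    from z(1) obtain a b where ab: "a \<in> {1..n}" "b \<in> {1..n}" "a < b" "x a < x b" "z = exchange x a b"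
      "z permutes {1..n}"
      by (rule bruhat_edgeE)
    obtain es where "length es = k" "set es \<subseteq> position_pairs n" "upward z es" "y = exchanges z es"
      using Suc.IH[OF ab(6)] z(2) by blast
    then show "\<exists>es. length es = Suc k \<and> set es \<subseteq> position_pairs n \<and> upward x es \<and> y = exchanges x es"
      using ab by (intro exI[of _ "(a, b) # es"]) (auto simp: position_pairs_def)
  next
    assume "\<exists>es. length es = Suc k \<and> set es \<subseteq> position_pairs n \<and> upward x es \<and> y = exchanges x es"
    then obtain a b es where es: "length es = k" "(a, b) \<in> position_pairs n"
      "set es \<subseteq> position_pairs n" "x a < x b" "upward (exchange x a b) es"
      "y = exchanges (exchange x a b) es"
      by (auto simp: length_Suc_conv)
    have "(x, exchange x a b) \<in> bruhat_graph n"
      using Suc.prems es by (intro bruhat_edgeI) (auto simp: position_pairs_def)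
    moreover have "exchange x a b permutes {1..n}"
      using Suc.prems es by (intro exchange_permutes) (auto simp: position_pairs_def)
    then have "(exchange x a b, y) \<in> bruhat_graph n ^^ k"
      using Suc.IH es by blast
    ultimately show "(x, y) \<in> bruhat_graph n ^^ Suc k"
      by (rule relpow_Suc_I2)
  qed
qed auto

lemma relpow_bruhat_le: "\<lbrakk>(x, y) \<in> bruhat_graph n ^^ k; x permutes {1..n}\<rbrakk> \<Longrightarrow> bruhat_le n x y"
proof (induction k arbitrary: y)
  case (Suc k)
  then show ?case
    using bruhat_edge_le bruhat_le_trans by (metis relpow_Suc_E)
qed (auto simp: bruhat_le_refl)

lemma bruhat_paths_Cons:
  "x # xs \<in> bruhat_paths n u v \<longleftrightarrow> x = u \<and> u permutes {1..n} \<and>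
     (if xs = [] then u = v else (u, hd xs) \<in> bruhat_graph n \<and> xs \<in> bruhat_paths n (hd xs) v)"
  by (cases xs) (auto simp: bruhat_paths_def sym_group_carrier)

lemma path_imp_relpow:
  assumes "xs \<in> bruhat_paths n u v"
  shows "(u, v) \<in> bruhat_graph n ^^ path_length xs"
  using assms
proof (induction xs arbitrary: u)
  case Nil
  then show ?case by (simp add: bruhat_paths_def)
next
  case (Cons x xs)
  show ?case
  proof (cases "xs = []")
    case True
    then show ?thesis using Cons.prems by (auto simp: bruhat_paths_Cons path_length_def)
  next
    case False
    then have "path_length (x # xs) = Suc (path_length xs)"
      by (cases xs) (auto simp: path_length_def)
    then show ?thesis
      using Cons False by (auto simp: bruhat_paths_Cons simp del: relpow.simps intro: relpow_Suc_I2)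
  qed
qed

lemma path_vertex_imp_relpow:
  assumes "xs \<in> bruhat_paths n u v" "x \<in> set xs"
  shows "\<exists>k l. k + l = path_length xs \<and> (u, x) \<in> bruhat_graph n ^^ k \<and> (x, v) \<in> bruhat_graph n ^^ l"
  using assms
proof (induction xs arbitrary: u)
  case (Cons y xs)
  show ?case
  proof (cases "x = y")
    case True
    then show ?thesis
      using path_imp_relpow[OF Cons.prems(1)] Cons.prems(1)
      by (intro exI[of _ 0] exI[of _ "path_length (y # xs)"]) (auto simp: bruhat_paths_Cons)
  next
    case False
    then have x: "x \<in> set xs" "xs \<noteq> []"
      using Cons.prems by auto
    then have "path_length (y # xs) = Suc (path_length xs)"
      by (cases xs) (auto simp: path_length_def)
    moreover have xs: "(u, hd xs) \<in> bruhat_graph n" "xs \<in> bruhat_paths n (hd xs) v"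
      using Cons.prems x by (auto simp: bruhat_paths_Cons)
    moreover obtain k l where "k + l = path_length xs" "(hd xs, x) \<in> bruhat_graph n ^^ k"
      "(x, v) \<in> bruhat_graph n ^^ l"
      using Cons.IH[OF xs(2) x(1)] by blast
    ultimately show ?thesis
      by (intro exI[of _ "Suc k"] exI[of _ l]) (auto simp del: relpow.simps intro: relpow_Suc_I2)
  qed
qed simp

lemma relpow_imp_path:
  assumes "(u, x) \<in> bruhat_graph n ^^ k" "xs \<in> bruhat_paths n x v"
  shows "\<exists>ys\<in>bruhat_paths n u v. path_length ys = k + path_length xs \<and> set xs \<subseteq> set ys"
  using assms
proof (induction k arbitrary: u)
  case 0
  then show ?case by auto
next
  case (Suc k)
  then obtain z where z: "(u, z) \<in> bruhat_graph n" "(z, x) \<in> bruhat_graph n ^^ k"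
    by (meson relpow_Suc_D2)
  obtain ys where ys: "ys \<in> bruhat_paths n z v" "path_length ys = k + path_length xs"
    "set xs \<subseteq> set ys"
    using Suc.IH[OF z(2) Suc.prems(2)] by blast
  have ne: "ys \<noteq> []" "hd ys = z"
    using ys by (auto simp: bruhat_paths_def)
  then have "path_length (u # ys) = Suc (path_length ys)"
    by (cases ys) (auto simp: path_length_def)
  then show ?case
    using ys z ne bruhat_edge_permutes[OF z(1)]
    by (intro bexI[of _ "u # ys"]) (auto simp: bruhat_paths_Cons)
qed

lemma trivial_path: "u permutes {1..n} \<Longrightarrow> [u] \<in> bruhat_paths n u u"
  by (simp add: bruhat_paths_Cons)

lemma path_exists_iff:
  assumes "u permutes {1..n}"
  shows "(\<exists>xs\<in>bruhat_paths n u v. path_length xs = k) \<longleftrightarrow> (u, v) \<in> bruhat_graph n ^^ k"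
proof
  assume uv: "(u, v) \<in> bruhat_graph n ^^ k"
  then have "v permutes {1..n}"
    using relpow_bruhat_le[OF _ assms] bruhat_le_permutes by blast
  then show "\<exists>xs\<in>bruhat_paths n u v. path_length xs = k"
    using relpow_imp_path[OF uv trivial_path] by (auto simp: path_length_def)
qed (use path_imp_relpow in blast)

lemma bruhat_dist_eq:
  assumes "u permutes {1..n}"
  shows "bruhat_dist n u v = (LEAST k. (u, v) \<in> bruhat_graph n ^^ k)"
  by (simp add: bruhat_dist_def path_exists_iff[OF assms])

lemma bruhat_dist_relpow:
  assumes "bruhat_le n u v"
  shows "(u, v) \<in> bruhat_graph n ^^ bruhat_dist n u v"
proof -
  have "\<exists>k. (u, v) \<in> bruhat_graph n ^^ k"
    using assms by (auto simp: bruhat_le_iff rtrancl_power)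
  then show ?thesis
    unfolding bruhat_dist_eq[OF bruhat_le_permutes(1)[OF assms]] by (rule LeastI_ex)
qed

section \<open>Stars of exchanges\<close>

abbreviation star :: "nat \<Rightarrow> nat list \<Rightarrow> (nat \<times> nat) list" where
  "star c qs \<equiv> map (Pair c) qs"

lemma exchanges_untouched:
  assumes "\<And>a b. (a, b) \<in> set es \<Longrightarrow> q \<noteq> a \<and> q \<noteq> b"
  shows "exchanges x es q = x q"
  using assms
proof (induction x es rule: exchanges.induct)
  case (2 x a b es)
  then have "q \<noteq> a \<and> q \<noteq> b" by auto
  moreover have "exchanges (exchange x a b) es q = exchange x a b q"
    using 2 by auto
  ultimately show ?case
    by (simp add: exchange_apply)
qed simp

lemma exchanges_image:
  assumes "\<And>a b. (a, b) \<in> set es \<Longrightarrow> a \<in> C \<longleftrightarrow> b \<in> C"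
  shows "exchanges x es ` C = x ` C"
  using assms
proof (induction x es rule: exchanges.induct)
  case (2 x a b es)
  have "exchange x a b ` C = x ` C"
  proof (cases "a \<in> C")
    case True
    then have "b \<in> C" using 2 by auto
    then show ?thesis
      unfolding exchange_eq_comp image_comp[symmetric] using True by (simp add: transpose_image_eq)
  next
    case False
    then have "b \<notin> C" using 2 by auto
    then show ?thesis
      unfolding exchange_eq_comp image_comp[symmetric] using False by (simp add: transpose_image_eq)
  qed
  then show ?case using 2 by simp
qed simp

text \<open>Each exchange leaves the entry carried at \<open>c\<close> behind and replaces it by a
  larger one, so the values along the star increase and are shifted by one place.\<close>

lemma star_values:
  assumes "distinct (c # qs)" "upward u (star c qs)"
  defines "p \<equiv> exchanges u (star c qs)"
  shows "map p qs = butlast (map u (c # qs))" and "p c = last (map u (c # qs))"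
    and "sorted_wrt (<) (map u (c # qs))"
proof -
  have "map p qs = butlast (map u (c # qs)) \<and> p c = last (map u (c # qs)) \<and>
    sorted_wrt (<) (map u (c # qs))"
    using assms(1,2) unfolding p_def
  proof (induction qs arbitrary: u)
    case (Cons q qs)
    let ?u = "exchange u c q"
    have eq: "?u c = u q" "map ?u qs = map u qs"
      using Cons.prems by (auto simp: exchange_apply)
    have "exchanges ?u (star c qs) q = ?u q"
      using Cons.prems by (intro exchanges_untouched) auto
    then have q: "exchanges ?u (star c qs) q = u c"
      using Cons.prems by (simp add: exchange_apply)
    show ?case
      using Cons.IH[of ?u] Cons.prems q eq by (auto simp: image_iff)
  qed simp
  then show "map p qs = butlast (map u (c # qs))" "p c = last (map u (c # qs))"
    "sorted_wrt (<) (map u (c # qs))"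
    by auto
qed

text \<open>A set \<open>C\<close> of maximal size among those that contain \<open>c\<close> and
  satisfy the inequality is closed under the edges, because an edge that leaves it would allow to
  add a vertex. Thus the component of \<open>c\<close> has at most one vertex more than edges, as
  for a spanning tree.\<close>

lemma edge_component:
  fixes es :: "('a \<times> 'a) list"
  shows "\<exists>C. finite C \<and> c \<in> C \<and> (\<forall>(a, b)\<in>set es. a \<in> C \<longleftrightarrow> b \<in> C) \<and>
    card C \<le> Suc (length (filter (\<lambda>(a, b). a \<in> C \<and> b \<in> C) es))"
proof -
  let ?in = "\<lambda>C. filter (\<lambda>(a, b). a \<in> C \<and> b \<in> C) es"
  let ?good = "\<lambda>C. finite C \<and> c \<in> C \<and> card C \<le> Suc (length (?in C))"
  have "?good {c}" by simp
  moreover have "\<forall>C. ?good C \<longrightarrow> card C < Suc (Suc (length es))"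
    by (meson le_imp_less_Suc le_trans length_filter_le Suc_le_mono)
  ultimately obtain C where C: "?good C" and max: "\<And>D. ?good D \<Longrightarrow> card D \<le> card C"
    using ex_has_greatest_nat[of ?good "{c}" card "Suc (Suc (length es))"] by metis
  have step: False if e: "(a, b) \<in> set es" "x \<in> C" "y \<notin> C" "{a, b} = {x, y}" for a b x y
  proof -
    have "length (?in C) < length (?in (insert y C))"
    proof -
      have "length (filter (\<lambda>(a, b). a \<in> C \<and> b \<in> C) (?in (insert y C))) < length (?in (insert y C))"
        using e by (intro length_filter_less[of "(a, b)"]) (auto simp: doubleton_eq_iff)
      moreover have "filter (\<lambda>(a, b). a \<in> C \<and> b \<in> C) (?in (insert y C)) = ?in C"
        by (auto intro: filter_cong)
      ultimately show ?thesis by simp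
    qed
    then have "?good (insert y C)"
      using C e by auto
    then show False
      using max[of "insert y C"] C e by auto
  qed
  have "\<forall>(a, b)\<in>set es. a \<in> C \<longleftrightarrow> b \<in> C"
    using step by (fastforce simp: insert_commute)
  then show ?thesis using C by blast
qed

lemma upward_card_inversions:
  assumes "finite P" "\<forall>(a, b)\<in>set es. a \<in> P \<and> b \<in> P \<and> a < b" "upward x es"
  shows "card (inversions P x) + length es \<le> card (inversions P (exchanges x es))"
  using assms(2,3)
proof (induction x es rule: exchanges.induct)
  case (2 x a b es)
  then have "card (inversions P x) < card (inversions P (exchange x a b))"
    unfolding exchange_eq_comp by (intro card_inversions_transpose_less assms(1)) auto
  then show ?case using 2 by auto
qed simp

lemma sorted_map_less:
  fixes f :: "nat \<Rightarrow> nat"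
  assumes "sorted_wrt (<) xs" "sorted_wrt (<) (map f xs)" "a \<in> set xs" "b \<in> set xs" "a < b"
  shows "f a < f b"
  using assms by (induction xs) force+

lemma sorted_map_le_last:
  fixes f :: "nat \<Rightarrow> nat"
  assumes "sorted_wrt (<) (map f xs)" "a \<in> set xs"
  shows "f a \<le> last (map f xs)"
  using assms
proof (induction xs)
  case (Cons x xs)
  have "f x \<le> last (map f (x # xs))"
  proof (cases "xs = []")
    case False
    then have "last (map f xs) \<in> set (map f xs)"
      by (intro last_in_set) simp
    then show ?thesis
      using Cons.prems False by auto
  qed simp
  then show ?case
    using Cons by (cases "xs = []") auto
qed simp

lemma star_in_closed_set:
  assumes "map p qs = butlast (map u (c # qs))" "c \<in> C" "p ` C = u ` C" "inj p"
  shows "set qs \<subseteq> C"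
  using assms(1,2)
proof (induction qs arbitrary: c)
  case (Cons q qs)
  then have "p q = u c" by simp
  then have "p q \<in> p ` C" using Cons.prems assms(3) by auto
  then have "q \<in> C" using assms(4) by (auto dest: injD)
  then show ?case using Cons.IH[of q] Cons.prems by auto
qed simp

text \<open>The end of a star is \<open>u\<close> followed by a cycle on the positions \<open>c #
  qs\<close>, so the exchanges of any path from \<open>u\<close> to it connect all these positions.
  Connecting $r + 1$ positions takes at least $r$ exchanges, and exactly $r$ only if none of them
  involves another position.\<close>

lemma star_geodesic_component:
  assumes u: "u permutes {1..n}" and qs: "distinct (c # qs)" "set (c # qs) \<subseteq> {1..n}"
    and up: "upward u (star c qs)"
    and es: "set es \<subseteq> position_pairs n" "exchanges u es = exchanges u (star c qs)"
  shows "length qs \<le> length es"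
    and "length es = length qs \<Longrightarrow> (a, b) \<in> set es \<Longrightarrow> a \<in> set (c # qs) \<and> b \<in> set (c # qs)"
proof -
  obtain C where C: "finite C" "c \<in> C" "\<forall>(a, b)\<in>set es. a \<in> C \<longleftrightarrow> b \<in> C"
    "card C \<le> Suc (length (filter (\<lambda>(a, b). a \<in> C \<and> b \<in> C) es))"
    using edge_component[of c es] by blast
  let ?p = "exchanges u es"
  have "inj ?p"
    using exchanges_permutes[OF u es(1)] permutes_inj by blast
  moreover have "?p ` C = u ` C"
    using C(3) by (intro exchanges_image) auto
  moreover have "map ?p qs = butlast (map u (c # qs))"
    unfolding es(2) by (rule star_values[OF qs(1) up])
  ultimately have sub: "set (c # qs) \<subseteq> C"
    using star_in_closed_set[of ?p qs u c C] C(2) by simp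
  have card: "card (set (c # qs)) = Suc (length qs)"
    using qs(1) by (simp only: distinct_card length_Cons)
  have le: "Suc (length qs) \<le> card C"
    using card_mono[OF C(1) sub] card by simp
  also note C(4)
  finally show "length qs \<le> length es"
    using length_filter_le[of "\<lambda>(a, b). a \<in> C \<and> b \<in> C" es] by linarith
  assume len: "length es = length qs" and ab: "(a, b) \<in> set es"
  have "card C \<le> Suc (length qs)"
    using C(4) length_filter_le[of "\<lambda>(a, b). a \<in> C \<and> b \<in> C" es] len by linarith
  then have "C = set (c # qs)"
    using card_seteq[OF C(1) sub] card by simp
  moreover have "length (filter (\<lambda>(a, b). a \<in> C \<and> b \<in> C) es) = length es"
    using le C(4) len length_filter_le[of "\<lambda>(a, b). a \<in> C \<and> b \<in> C" es] by simp
  then have "a \<in> C \<and> b \<in> C"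
    using ab by (metis (mono_tags, lifting) case_prod_conv filter_id_conv length_filter_less less_irrefl)
  ultimately show "a \<in> set (c # qs) \<and> b \<in> set (c # qs)"
    by simp
qed

lemma star_dist_lower:
  assumes u: "u permutes {1..n}" and qs: "distinct (c # qs)" "set (c # qs) \<subseteq> {1..n}"
    and up: "upward u (star c qs)" and k: "(u, exchanges u (star c qs)) \<in> bruhat_graph n ^^ k"
  shows "length qs \<le> k"
  using k star_geodesic_component(1)[OF u qs up] unfolding relpow_bruhat_graph_iff[OF u] by metis

lemma star_position_pairs:
  assumes "sorted_wrt (<) (c # qs)" "set (c # qs) \<subseteq> {1..n}"
  shows "set (star c qs) \<subseteq> position_pairs n"
  using assms by (auto simp: position_pairs_def)

lemma star_dist:
  assumes u: "u permutes {1..n}" and qs: "sorted_wrt (<) (c # qs)" "set (c # qs) \<subseteq> {1..n}"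
    and up: "upward u (star c qs)"
  shows "bruhat_dist n u (exchanges u (star c qs)) = length qs"
  unfolding bruhat_dist_eq[OF u]
proof (rule Least_equality)
  show "(u, exchanges u (star c qs)) \<in> bruhat_graph n ^^ length qs"
    unfolding relpow_bruhat_graph_iff[OF u]
    using star_position_pairs[OF qs] up by (intro exI[of _ "star c qs"]) auto
qed (use star_dist_lower[OF u _ qs(2) up] qs(1) strict_sorted_iff in blast)

text \<open>On a shortest path all exchanges take place within the positions of the star, so each of
  them creates an inversion there. The end of the star has only \<open>length qs\<close> such
  inversions. A vertex that already has the largest of the entries at the leftmost position
  \<open>c\<close> has as many, and hence no exchange can follow.\<close>

lemma star_geodesic_vertex:
  assumes u: "u permutes {1..n}" and qs: "sorted_wrt (<) (c # qs)" "set (c # qs) \<subseteq> {1..n}"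
    and up: "upward u (star c qs)"
    and k: "(u, x) \<in> bruhat_graph n ^^ k" and l: "(x, exchanges u (star c qs)) \<in> bruhat_graph n ^^ l"
    and len: "k + l = length qs" and xc: "x c = exchanges u (star c qs) c"
  shows "x = exchanges u (star c qs)"
proof -
  let ?p = "exchanges u (star c qs)" and ?P = "set (c # qs)"
  have d: "distinct (c # qs)"
    using qs(1) strict_sorted_iff by blast
  note vals = star_values[OF d up]
  obtain es where es: "length es = k" "set es \<subseteq> position_pairs n" "upward u es" "x = exchanges u es"
    using k unfolding relpow_bruhat_graph_iff[OF u] by blast
  have x: "x permutes {1..n}"
    unfolding es(4) by (rule exchanges_permutes[OF u es(2)])
  obtain fs where fs: "length fs = l" "set fs \<subseteq> position_pairs n" "upward x fs" "?p = exchanges x fs"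
    using l unfolding relpow_bruhat_graph_iff[OF x] by blast
  have all: "exchanges u (es @ fs) = ?p"
    using fs(4) es(4) by (simp add: exchanges_append)
  have in_P: "a \<in> ?P \<and> b \<in> ?P" if "(a, b) \<in> set (es @ fs)" for a b
    using star_geodesic_component(2)[OF u d qs(2) up _ all _ that] es(1,2) fs(1,2) len by auto
  have "card (inversions ?P x) + length fs \<le> card (inversions ?P (exchanges x fs))"
  proof (rule upward_card_inversions[OF _ _ fs(3)])
    show "\<forall>(a, b)\<in>set fs. a \<in> ?P \<and> b \<in> ?P \<and> a < b"
      using in_P fs(2) by (fastforce simp: position_pairs_def)
  qed simp
  moreover have "card (inversions ?P ?p) \<le> length qs"
  proof -
    have "inversions ?P ?p \<subseteq> {c} \<times> set qs"
    proof (rule subrelI)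
      fix a b assume ab: "(a, b) \<in> inversions ?P ?p"
      then have ab': "a \<in> ?P" "b \<in> ?P" "a < b" "?p b < ?p a"
        by (auto simp: inversions_def)
      have "sorted_wrt (<) (map ?p qs)"
        unfolding vals(1) using vals(3) by (metis sorted_wrt_take butlast_conv_take)
      then have "?p a < ?p b" if "a \<in> set qs" "b \<in> set qs"
        using sorted_map_less[of qs ?p a b] that ab'(3) qs(1) by simp
      then show "(a, b) \<in> {c} \<times> set qs"
        using ab' qs(1) by auto
    qed
    then have "card (inversions ?P ?p) \<le> card ({c} \<times> set qs)"
      by (intro card_mono) auto
    then show ?thesis
      using d by (simp add: distinct_card card_cartesian_product)
  qed
  moreover have "length qs \<le> card (inversions ?P x)"
  proof -
    have img: "x ` ?P = u ` ?P"
      unfolding es(4) using in_P by (intro exchanges_image) auto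
    have max: "u r \<le> last (map u (c # qs))" if "r \<in> ?P" for r
      by (rule sorted_map_le_last[OF vals(3) that])
    have "{c} \<times> set qs \<subseteq> inversions ?P x"
    proof (rule subrelI)
      fix a q assume "(a, q) \<in> {c} \<times> set qs"
      then have q: "a = c" "q \<in> set qs" by auto
      then have "x q \<in> u ` ?P"
        using img by auto
      then have "x q \<le> x c"
        using max xc vals(2) by auto
      moreover have "x q \<noteq> x c"
        using q d permutes_eq_iff[OF x] by auto
      ultimately show "(a, q) \<in> inversions ?P x"
        using q qs(1) by (auto simp: inversions_def)
    qed
    then have "card ({c} \<times> set qs) \<le> card (inversions ?P x)"
      by (intro card_mono finite_inversions) auto
    then show ?thesis
      using d by (simp add: distinct_card card_cartesian_product)
  qed
  ultimately have "l = 0"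
    using fs by simp
  then show ?thesis
    using fs by simp
qed

text \<open>Every path can be replaced by one of the same length that first moves the entry at
  position 1, using increasing positions, and then never again. To find it, the first step is taken
  to be an exchange with position 1 and the smallest possible partner, if there is such a step at
  all. If the rest of the path, in normal form, does not fit, then two consecutive steps can be
  replaced by two others within a reflection subgroup of type $A_1 \times A_1$ or $A_2$ so that the
  first exchange involves position 1 and a smaller partner, against this choice.\<close>

lemma star_normal_form:
  assumes "x permutes {1..n}" "(x, p) \<in> bruhat_graph n ^^ d"
  shows "\<exists>qs k. sorted_wrt (<) (1 # qs) \<and> set qs \<subseteq> {2..n} \<and> upward x (star 1 qs) \<and>
    (exchanges x (star 1 qs), p) \<in> bruhat_graph n ^^ k \<and> length qs + k = d \<and>
    exchanges x (star 1 qs) 1 = p 1"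
  using assms
proof (induction d arbitrary: x)
  case 0
  then show ?case
    by (intro exI[of _ "[]"] exI[of _ 0]) auto
next
  case (Suc d)
  define S where "S = {q \<in> {2..n}. x 1 < x q \<and> (exchange x 1 q, p) \<in> bruhat_graph n ^^ d}"
  have fin: "finite S"
    by (simp add: S_def)
  have perm: "exchange x a b permutes {1..n}" if "a \<in> {1..n}" "b \<in> {1..n}" for a b
    using that Suc.prems(1) by (intro exchange_permutes)
  have one: "1 \<in> {1..n}" if "q \<in> {2..n}" for q
    using that by auto
  have inS: "q \<in> S"
    if "q \<in> {2..n}" "x 1 < x q" "a \<in> {1..n}" "b \<in> {1..n}" "a < b"
      "exchange x 1 q a < exchange x 1 q b"
      "(exchange (exchange x 1 q) a b, p) \<in> bruhat_graph n ^^ k" "d = Suc k" for q a b k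
  proof -
    have "(exchange x 1 q, exchange (exchange x 1 q) a b) \<in> bruhat_graph n"
      using that by (intro bruhat_edgeI perm) auto
    then show ?thesis
      using that by (auto simp: S_def simp del: relpow.simps intro: relpow_Suc_I2)
  qed
  \<comment> \<open>What follows the first exchange of a star is a path of the expected length.\<close>
  have tail: "(exchange y 1 q, p) \<in> bruhat_graph n ^^ (length qs + k)"
    if "y permutes {1..n}" "set (q # qs) \<subseteq> {2..n}" "upward y (star 1 (q # qs))"
      "(exchanges y (star 1 (q # qs)), p) \<in> bruhat_graph n ^^ k" for y q qs k
  proof -
    have "exchange y 1 q permutes {1..n}"
      using that by (intro exchange_permutes) auto
    moreover have "set (star 1 qs) \<subseteq> position_pairs n"
      using that(2) by (fastforce simp: position_pairs_def)
    ultimately have "(exchange y 1 q, exchanges (exchange y 1 q) (star 1 qs)) \<in> bruhat_graph n ^^ length qs"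
      using that by (subst relpow_bruhat_graph_iff) (auto intro!: exI[of _ "star 1 qs"])
    then show ?thesis
      using that by (auto simp: relpow_add)
  qed
  show ?case
  proof (cases "S = {}")
    case False
    define q where "q = Min S"
    have q: "q \<in> S" and min: "\<And>r. r \<in> S \<Longrightarrow> q \<le> r"
      using fin False by (auto simp: q_def)
    then have q': "q \<in> {2..n}" "x 1 < x q" "(exchange x 1 q, p) \<in> bruhat_graph n ^^ d"
      by (auto simp: S_def)
    then have perm_q: "exchange x 1 q permutes {1..n}"
      by (intro perm) auto
    obtain qs k where IH: "sorted_wrt (<) (1 # qs)" "set qs \<subseteq> {2..n}"
      "upward (exchange x 1 q) (star 1 qs)"
      "(exchanges (exchange x 1 q) (star 1 qs), p) \<in> bruhat_graph n ^^ k" "length qs + k = d"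
      "exchanges (exchange x 1 q) (star 1 qs) 1 = p 1"
      using Suc.IH[OF perm_q q'(3)] by blast
    have "q < r" if "r \<in> set qs" for r
    proof -
      obtain q2 rs where qs: "qs = q2 # rs"
        using \<open>r \<in> set qs\<close> by (cases qs) auto
      have "q < q2"
      proof (rule ccontr)
        assume "\<not> q < q2"
        moreover have up: "x q < exchange x 1 q q2"
          using IH(3) q'(1) by (simp add: qs exchange_apply)
        then have "q2 \<noteq> q"
          using q' by (auto simp: exchange_apply)
        ultimately have q2: "q2 < q" "q2 \<in> {2..n}"
          using IH(2) qs by auto
        then have up': "x q < x q2"
          using up by (auto simp: exchange_apply)
        have "exchange (exchange x 1 q) 1 q2 = exchange (exchange x 1 q2) q2 q"
          using q2 q'(1) by (auto simp: exchange_apply fun_eq_iff)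
        moreover have "(exchange (exchange x 1 q) 1 q2, p) \<in> bruhat_graph n ^^ (length rs + k)"
          using IH(2-4) unfolding qs by (intro tail[OF perm_q])
        ultimately have "q2 \<in> S"
          using q2 q'(1,2) up' IH(5) qs
          by (intro inS[of q2 q2 q "length rs + k"]) (auto simp: exchange_apply)
        then show False
          using min q2 by fastforce
      qed
      moreover have "q2 \<le> r"
        using IH(1) that qs by auto
      ultimately show ?thesis by simp
    qed
    then show ?thesis
      using IH q'
      by (intro exI[of _ "q # qs"] exI[of _ k]) auto
  next
    case True
    obtain y where y: "(x, y) \<in> bruhat_graph n" "(y, p) \<in> bruhat_graph n ^^ d"
      using Suc.prems(2) by (meson relpow_Suc_D2)
    from y(1) obtain a b where ab: "a \<in> {1..n}" "b \<in> {1..n}" "a < b" "x a < x b"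
      "y = exchange x a b" "y permutes {1..n}"
      by (rule bruhat_edgeE)
    have a: "a \<noteq> 1"
    proof
      assume "a = 1"
      then have "b \<in> S"
        using ab y by (auto simp: S_def)
      then show False using True by simp
    qed
    obtain qs k where IH: "sorted_wrt (<) (1 # qs)" "set qs \<subseteq> {2..n}" "upward y (star 1 qs)"
      "(exchanges y (star 1 qs), p) \<in> bruhat_graph n ^^ k" "length qs + k = d"
      "exchanges y (star 1 qs) 1 = p 1"
      using Suc.IH[OF ab(6) y(2)] by blast
    show ?thesis
    proof (cases qs)
      case Nil
      then have "x 1 = p 1"
        using IH(6) ab a by (auto simp: exchange_apply)
      then show ?thesis
        using Suc.prems(2) by (intro exI[of _ "[]"] exI[of _ "Suc d"]) auto
    next
      case (Cons q rs)
      have path: "(exchange y 1 q, p) \<in> bruhat_graph n ^^ (length rs + k)"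
        using IH(2-4) unfolding Cons by (intro tail[OF ab(6)])
      have q: "q \<in> {2..n}" "d = Suc (length rs + k)" "x 1 < y q"
        using IH(2,3,5) a ab unfolding Cons by (auto simp: exchange_apply split: if_splits)
      have a1: "1 < a" "1 \<in> {1..n}"
        using a ab by auto
      have flip: False
        if "exchange y 1 q = exchange (exchange x 1 r) s t" "r \<in> {2..n}" "x 1 < x r"
          "s \<in> {1..n}" "t \<in> {1..n}" "s < t" "exchange x 1 r s < exchange x 1 r t" for r s t
        using inS[OF that(2-7) _ q(2)] path that(1) True by auto
      \<comment> \<open>Whatever the position \<open>q\<close>, the exchange with position 1 can be moved to the front.\<close>
      consider "q \<noteq> a" "q \<noteq> b" | "q = b" | "q = a" "x a < x 1" | "q = a" "x 1 < x a"
        using permutes_eq_iff[OF Suc.prems(1), of a 1] a by (meson linorder_neqE_nat)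
      then show ?thesis
      proof cases
        case 1
        then have "exchange y 1 q = exchange (exchange x 1 q) a b"
          using a1 ab(3,5) q by (auto simp: exchange_apply fun_eq_iff)
        then show ?thesis
          using flip[of q a b] 1 a1 ab q by (auto simp: exchange_apply)
      next
        case 2
        then have "exchange y 1 q = exchange (exchange x 1 a) a b"
          using a1 ab(3,5) q by (auto simp: exchange_apply fun_eq_iff)
        then show ?thesis
          using flip[of a a b] 2 a1 ab q by (auto simp: exchange_apply)
      next
        case 3
        then have "exchange y 1 q = exchange (exchange x 1 b) a b"
          using a1 ab(3,5) q by (auto simp: exchange_apply fun_eq_iff)
        then show ?thesis
          using flip[of b a b] 3 a1 ab q by (auto simp: exchange_apply)
      next
        case 4
        then have "exchange y 1 q = exchange (exchange x 1 a) 1 b"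
          using a1 ab(3,5) q by (auto simp: exchange_apply fun_eq_iff)
        then show ?thesis
          using flip[of a 1 b] 4 a1 ab q by (auto simp: exchange_apply)
      qed
    qed
  qed
qed

section \<open>Fibrations of Bruhat intervals\<close>

definition fiber :: "nat \<Rightarrow> (perm \<Rightarrow> nat) \<Rightarrow> perm \<Rightarrow> perm \<Rightarrow> perm set" where
  "fiber n f u v = {x \<in> bruhat_interval n u v. f x = f v}"

text \<open>The shortcuts with respect to a decomposition depend on it only through the interval
  that it cuts out at the top, which for the standard ones is a fiber of \<open>f\<close>. A vertex
  on a path is expressed by splitting the path at it.\<close>

definition fiber_shortcuts :: "nat \<Rightarrow> (perm \<Rightarrow> nat) \<Rightarrow> perm \<Rightarrow> perm \<Rightarrow> perm set" where
  "fiber_shortcuts n f u v =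
     {p \<in> fiber n f u v. \<forall>x k l. x \<in> fiber n f u v \<longrightarrow> (u, x) \<in> bruhat_graph n ^^ k \<longrightarrow>
        (x, p) \<in> bruhat_graph n ^^ l \<longrightarrow> k + l = bruhat_dist n u p \<longrightarrow> x = p}"

definition shortcut_mset :: "nat \<Rightarrow> (perm \<Rightarrow> nat) \<Rightarrow> perm \<Rightarrow> perm \<Rightarrow> (nat \<times> perm) multiset" where
  "shortcut_mset n f u v = image_mset (\<lambda>p. (bruhat_dist n u p, p)) (mset_set (fiber_shortcuts n f u v))"

text \<open>Composition of two steps, each with several outcomes of various lengths: lengths add
  up.\<close>

definition graded_bind ::
    "(nat \<times> perm) multiset \<Rightarrow> (perm \<Rightarrow> (nat \<times> perm) multiset) \<Rightarrow> (nat \<times> perm) multiset" where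
  "graded_bind M k = (\<Sum>(d, p)\<in>#M. image_mset (map_prod ((+) d) id) (k p))"

lemma finite_fiber: "finite (fiber n f u v)"
proof (rule finite_subset)
  show "fiber n f u v \<subseteq> {p. p permutes {1..n}}"
    by (auto simp: fiber_def bruhat_interval_iff dest: bruhat_le_permutes)
qed (simp add: finite_permutations)

lemma finite_fiber_shortcuts: "finite (fiber_shortcuts n f u v)"
  by (rule finite_subset[OF _ finite_fiber[of n f u v]]) (auto simp: fiber_shortcuts_def)

lemma fiber_shortcutsD:
  "p \<in> fiber_shortcuts n f u v \<Longrightarrow> bruhat_le n u p \<and> bruhat_le n p v \<and> f p = f v"
  by (simp add: fiber_shortcuts_def fiber_def bruhat_interval_iff)

text \<open>What makes the minimum of a top fiber an amazing hypercube decomposition. The function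
  \<open>f\<close> stands for the coset of a maximal parabolic subgroup. The conditions are required
  of all intervals at once, which covers the passage from \<open>u\<close> to an element
  \<open>x\<close> of the interval in the definition of amazing decompositions.\<close>

locale bruhat_fibration =
  fixes n :: nat and f :: "perm \<Rightarrow> nat"
  assumes top_fiber_upward: "\<lbrakk>bruhat_le n x y; bruhat_le n y v; f x = f v\<rbrakk> \<Longrightarrow> f y = f v"
    and fiber_min_exists: "bruhat_le n u v \<Longrightarrow> \<exists>z. is_bruhat_min n (fiber n f u v) z"
    and diamond: "\<lbrakk>a1 \<noteq> a2; (x, a1) \<in> bruhat_graph n; (x, a2) \<in> bruhat_graph n;
      f a1 = f y; f a2 = f y\<rbrakk> \<Longrightarrow> f x = f y"
    and cluster: "\<lbrakk>p permutes {1..n};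
      \<And>\<alpha>. \<alpha> \<in> E \<Longrightarrow> \<exists>x. \<alpha> = (x, p) \<and> (x, p) \<in> bruhat_graph n \<and> f x \<noteq> f p\<rbrakk> \<Longrightarrow>
      spans_hypercube_cluster n p E"
begin

lemma interval_above_min:
  assumes "is_bruhat_min n (fiber n f u v) z"
  shows "bruhat_interval n z v = fiber n f u v"
proof (intro equalityI subsetI)
  have z: "bruhat_le n u z" "f z = f v"
    using assms by (auto simp: is_bruhat_min_def fiber_def bruhat_interval_iff)
  fix x assume "x \<in> bruhat_interval n z v"
  then show "x \<in> fiber n f u v"
    using z top_fiber_upward[of z x v] bruhat_le_trans[of n u z x]
    by (auto simp: fiber_def bruhat_interval_iff)
next
  fix x assume "x \<in> fiber n f u v"
  then show "x \<in> bruhat_interval n z v"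
    using assms by (auto simp: is_bruhat_min_def fiber_def bruhat_interval_iff)
qed

lemma above_min_inter:
  assumes "is_bruhat_min n (fiber n f u v) z" "x \<in> bruhat_interval n u v"
  shows "bruhat_interval n z v \<inter> bruhat_interval n x v = fiber n f x v"
  unfolding interval_above_min[OF assms(1)] using assms(2)
  by (auto simp: fiber_def bruhat_interval_iff intro: bruhat_le_trans)

lemma min_vee:
  assumes "is_bruhat_min n (fiber n f u v) z" "x \<in> bruhat_interval n u v"
  shows "is_bruhat_min n (fiber n f x v) (bruhat_vee n v z x)"
proof -
  obtain m where "is_bruhat_min n (fiber n f x v) m"
    using fiber_min_exists assms(2) by (auto simp: bruhat_interval_iff)
  then show ?thesis
    unfolding bruhat_vee_def above_min_inter[OF assms] by (simp add: bruhat_min_eqI)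
qed

lemma min_hypercube_decomp:
  assumes "is_bruhat_min n (fiber n f u v) z"
  shows "hypercube_decomp n u v z"
proof -
  note I = interval_above_min[OF assms]
  have "spans_hypercube_cluster n p
      {(x, p) | x. x \<in> bruhat_interval n u v - fiber n f u v \<and> (x, p) \<in> bruhat_graph n}"
    if "p \<in> fiber n f u v" for p
    using that by (intro cluster) (auto simp: fiber_def bruhat_interval_iff dest: bruhat_le_permutes)
  moreover have "x \<in> fiber n f u v"
    if "x \<in> bruhat_interval n u v" "a1 \<in> fiber n f u v" "a2 \<in> fiber n f u v" "y \<in> fiber n f u v"
      "a1 \<noteq> a2" "(x, a1) \<in> bruhat_graph n" "(x, a2) \<in> bruhat_graph n" for x a1 a2 y
    using diamond[of a1 a2 x v] that by (auto simp: fiber_def)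
  moreover have "z \<in> bruhat_interval n u v"
    using assms by (auto simp: is_bruhat_min_def fiber_def)
  ultimately show ?thesis
    unfolding hypercube_decomp_def I by blast
qed

lemma min_amazing:
  assumes "is_bruhat_min n (fiber n f u v) z"
  shows "amazing_decomp n u v z"
  unfolding amazing_decomp_def
proof (intro conjI ballI)
  show "hypercube_decomp n u v z"
    by (rule min_hypercube_decomp[OF assms])
  fix x assume x: "x \<in> bruhat_interval n u v"
  note m = min_vee[OF assms x]
  show "\<exists>m. is_bruhat_min n (bruhat_interval n z v \<inter> bruhat_interval n x v) m"
    using m unfolding above_min_inter[OF assms x] by blast
  show "hypercube_decomp n x v (bruhat_vee n v z x)"
    by (rule min_hypercube_decomp[OF m])
qed

lemma shortcuts_min:
  assumes "is_bruhat_min n (fiber n f u v) z"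
  shows "shortcuts n u v z = fiber_shortcuts n f u v"
proof -
  have "(\<forall>xs\<in>bruhat_paths n u p. path_length xs = bruhat_dist n u p \<longrightarrow>
          set xs \<inter> fiber n f u v = {p}) \<longleftrightarrow>
     (\<forall>x k l. x \<in> fiber n f u v \<longrightarrow> (u, x) \<in> bruhat_graph n ^^ k \<longrightarrow>
        (x, p) \<in> bruhat_graph n ^^ l \<longrightarrow> k + l = bruhat_dist n u p \<longrightarrow> x = p)" (is "?L \<longleftrightarrow> ?R")
    if p: "p \<in> fiber n f u v" for p
  proof
    assume L: ?L
    show ?R
    proof (intro allI impI)
      fix x k l
      assume x: "x \<in> fiber n f u v" "(u, x) \<in> bruhat_graph n ^^ k" "(x, p) \<in> bruhat_graph n ^^ l"
        "k + l = bruhat_dist n u p"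
      have "x permutes {1..n}"
        using x(1) bruhat_le_permutes by (auto simp: fiber_def bruhat_interval_iff)
      then obtain xs where xs: "xs \<in> bruhat_paths n x p" "path_length xs = l"
        using path_exists_iff x(3) by blast
      then obtain ys where "ys \<in> bruhat_paths n u p" "path_length ys = k + l" "set xs \<subseteq> set ys"
        using relpow_imp_path[OF x(2) xs(1)] by auto
      moreover have "x \<in> set xs"
        using xs(1) by (auto simp: bruhat_paths_def)
      ultimately show "x = p"
        using L x by auto
    qed
  next
    assume R: ?R
    show ?L
    proof (intro ballI impI equalityI subsetI)
      fix xs x
      assume xs: "xs \<in> bruhat_paths n u p" "path_length xs = bruhat_dist n u p"
        "x \<in> set xs \<inter> fiber n f u v"
      then show "x \<in> {p}"
        using R path_vertex_imp_relpow[OF xs(1), of x] by auto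
    next
      fix xs x
      assume "xs \<in> bruhat_paths n u p" "x \<in> {p}"
      then show "x \<in> set xs \<inter> fiber n f u v"
        using p by (auto simp: bruhat_paths_def)
    qed
  qed
  then show ?thesis
    unfolding shortcuts_def fiber_shortcuts_def interval_above_min[OF assms] by blast
qed

end

lemma image_mset_set_Sigma:
  assumes "finite A" "\<And>a. a \<in> A \<Longrightarrow> finite (B a)"
  shows "image_mset h (mset_set (SIGMA a:A. B a)) =
    (\<Sum>a\<in>#mset_set A. image_mset (\<lambda>b. h (a, b)) (mset_set (B a)))"
  using assms
proof (induction A rule: finite_induct)
  case (insert a A)
  have eq: "(SIGMA x:insert a A. B x) = Pair a ` B a \<union> (SIGMA x:A. B x)"
    by auto
  have "mset_set (Pair a ` B a \<union> (SIGMA x:A. B x)) = mset_set (Pair a ` B a) + mset_set (SIGMA x:A. B x)"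
    using insert by (intro mset_set_Union) auto
  also have "mset_set (Pair a ` B a) = image_mset (Pair a) (mset_set (B a))"
    by (rule image_mset_mset_set[symmetric]) (auto intro: inj_onI)
  finally show ?case
    using insert eq by (simp add: multiset.map_comp comp_def)
qed simp

lemma double_shortcuts_eq_bind:
  assumes "bruhat_fibration n f" "bruhat_fibration n g"
    and z: "is_bruhat_min n (fiber n f u v) z" and z': "is_bruhat_min n (fiber n g u v) z'"
  shows "double_shortcuts n u v z z' = graded_bind (shortcut_mset n f u v) (\<lambda>p. shortcut_mset n g p v)"
proof -
  have sc: "shortcuts n u v z = fiber_shortcuts n f u v"
    using assms(1) z by (rule bruhat_fibration.shortcuts_min)
  have "shortcuts n p v (bruhat_vee n v z' p) = fiber_shortcuts n g p v"
    if "p \<in> fiber_shortcuts n f u v" for p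
    using bruhat_fibration.shortcuts_min[OF assms(2) bruhat_fibration.min_vee[OF assms(2) z']] that
    by (auto simp: fiber_shortcuts_def fiber_def)
  then have eq: "(SIGMA p:shortcuts n u v z. shortcuts n p v (bruhat_vee n v z' p)) =
      (SIGMA p:fiber_shortcuts n f u v. fiber_shortcuts n g p v)"
    unfolding sc by auto
  show ?thesis
    unfolding double_shortcuts_def eq
    by (subst image_mset_set_Sigma)
      (simp_all add: finite_fiber_shortcuts graded_bind_def shortcut_mset_def multiset.map_comp comp_def)
qed

section \<open>Symmetries of the Bruhat graph\<close>

locale bruhat_involution =
  fixes n :: nat and \<phi> :: "perm \<Rightarrow> perm"
  assumes maps: "x permutes {1..n} \<Longrightarrow> \<phi> x permutes {1..n}"
    and invol: "x permutes {1..n} \<Longrightarrow> \<phi> (\<phi> x) = x"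
    and edge: "(x, y) \<in> bruhat_graph n \<Longrightarrow> (\<phi> x, \<phi> y) \<in> bruhat_graph n"
begin

lemma eq_iff: "\<lbrakk>x permutes {1..n}; y permutes {1..n}\<rbrakk> \<Longrightarrow> \<phi> x = \<phi> y \<longleftrightarrow> x = y"
  by (metis invol)

lemma le:
  assumes "bruhat_le n x y"
  shows "bruhat_le n (\<phi> x) (\<phi> y)"
  using assms
proof (induction rule: bruhat_le_induct)
  case refl
  then show ?case
    by (intro bruhat_le_refl maps bruhat_le_permutes(1)[OF assms])
next
  case (step y z)
  then show ?case
    using edge bruhat_edge_le bruhat_le_trans by blast
qed

lemma le_iff:
  assumes "x permutes {1..n}" "y permutes {1..n}"
  shows "bruhat_le n (\<phi> x) (\<phi> y) \<longleftrightarrow> bruhat_le n x y"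
  using le[of x y] le[of "\<phi> x" "\<phi> y"] invol assms by auto

lemma relpow: "(x, y) \<in> bruhat_graph n ^^ k \<Longrightarrow> (\<phi> x, \<phi> y) \<in> bruhat_graph n ^^ k"
proof (induction k arbitrary: y)
  case (Suc k)
  then show ?case
    using edge by (meson relpow_Suc_E relpow_Suc_I)
qed simp

lemma relpow_iff:
  assumes "x permutes {1..n}" "y permutes {1..n}"
  shows "(\<phi> x, \<phi> y) \<in> bruhat_graph n ^^ k \<longleftrightarrow> (x, y) \<in> bruhat_graph n ^^ k"
  using relpow[of x y] relpow[of "\<phi> x" "\<phi> y"] invol assms by auto

lemma dist:
  assumes "x permutes {1..n}" "y permutes {1..n}"
  shows "bruhat_dist n (\<phi> x) (\<phi> y) = bruhat_dist n x y"
  unfolding bruhat_dist_eq[OF assms(1)] bruhat_dist_eq[OF maps[OF assms(1)]] relpow_iff[OF assms] ..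

lemma fiber_iff:
  assumes "u permutes {1..n}" "v permutes {1..n}" "x permutes {1..n}"
  shows "x \<in> fiber n (\<lambda>x. f (\<phi> x)) u v \<longleftrightarrow> \<phi> x \<in> fiber n f (\<phi> u) (\<phi> v)"
  using assms by (simp add: fiber_def bruhat_interval_iff le_iff)

lemma fiber_permutes: "x \<in> fiber n f u v \<Longrightarrow> x permutes {1..n}"
  by (auto simp: fiber_def bruhat_interval_iff dest: bruhat_le_permutes)

lemma fiber_min_iff:
  assumes "u permutes {1..n}" "v permutes {1..n}" "z permutes {1..n}"
  shows "is_bruhat_min n (fiber n (\<lambda>x. f (\<phi> x)) u v) z \<longleftrightarrow> is_bruhat_min n (fiber n f (\<phi> u) (\<phi> v)) (\<phi> z)"
proof -
  have "(\<forall>a\<in>fiber n (\<lambda>x. f (\<phi> x)) u v. bruhat_le n z a) \<longleftrightarrow>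
    (\<forall>a\<in>fiber n f (\<phi> u) (\<phi> v). bruhat_le n (\<phi> z) a)" (is "?L \<longleftrightarrow> ?R")
  proof
    assume ?L
    show ?R
    proof
      fix a assume a: "a \<in> fiber n f (\<phi> u) (\<phi> v)"
      then have p: "a permutes {1..n}"
        by (rule fiber_permutes)
      then have "\<phi> a \<in> fiber n (\<lambda>x. f (\<phi> x)) u v"
        using a fiber_iff[OF assms(1,2) maps[OF p]] by (simp add: invol)
      then have "bruhat_le n z (\<phi> a)"
        using \<open>?L\<close> by blast
      then show "bruhat_le n (\<phi> z) a"
        using le[of z "\<phi> a"] invol[OF p] by simp
    qed
  next
    assume ?R
    then show ?L
      using fiber_iff[OF assms(1,2)] le_iff[OF assms(3)] fiber_permutes by metis
  qed
  then show ?thesis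
    unfolding is_bruhat_min_def using fiber_iff[OF assms] by blast
qed

lemma fiber_shortcuts_iff:
  assumes u: "u permutes {1..n}" and v: "v permutes {1..n}" and p: "p permutes {1..n}"
  shows "p \<in> fiber_shortcuts n (\<lambda>x. f (\<phi> x)) u v \<longleftrightarrow> \<phi> p \<in> fiber_shortcuts n f (\<phi> u) (\<phi> v)"
proof -
  let ?P = "\<lambda>f u v p x. \<forall>k l. x \<in> fiber n f u v \<longrightarrow> (u, x) \<in> bruhat_graph n ^^ k \<longrightarrow>
        (x, p) \<in> bruhat_graph n ^^ l \<longrightarrow> k + l = bruhat_dist n u p \<longrightarrow> x = p"
  have *: "?P (\<lambda>x. f (\<phi> x)) u v p x \<longleftrightarrow> ?P f (\<phi> u) (\<phi> v) (\<phi> p) (\<phi> x)" if "x permutes {1..n}" for x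
    using that u v p by (simp add: fiber_iff relpow_iff dist eq_iff)
  have "(\<forall>x. ?P (\<lambda>x. f (\<phi> x)) u v p x) \<longleftrightarrow> (\<forall>x. ?P f (\<phi> u) (\<phi> v) (\<phi> p) x)"
  proof
    assume L: "\<forall>x. ?P (\<lambda>x. f (\<phi> x)) u v p x"
    show "\<forall>x. ?P f (\<phi> u) (\<phi> v) (\<phi> p) x"
    proof
      fix x
      show "?P f (\<phi> u) (\<phi> v) (\<phi> p) x"
      proof (cases "x permutes {1..n}")
        case True
        have "?P f (\<phi> u) (\<phi> v) (\<phi> p) (\<phi> (\<phi> x))"
          using L *[OF maps[OF True]] by blast
        then show ?thesis
          using invol[OF True] by simp
      qed (use fiber_permutes in blast)
    qed
  next
    assume R: "\<forall>x. ?P f (\<phi> u) (\<phi> v) (\<phi> p) x"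
    show "\<forall>x. ?P (\<lambda>x. f (\<phi> x)) u v p x"
    proof
      fix x
      show "?P (\<lambda>x. f (\<phi> x)) u v p x"
      proof (cases "x permutes {1..n}")
        case True
        show ?thesis
          using R *[OF True] by blast
      qed (use fiber_permutes in blast)
    qed
  qed
  then show ?thesis
    unfolding fiber_shortcuts_def using fiber_iff[OF u v p] by blast
qed

lemma shortcut_mset_image:
  assumes u: "u permutes {1..n}" and v: "v permutes {1..n}"
  shows "shortcut_mset n (\<lambda>x. f (\<phi> x)) u v =
    image_mset (map_prod id \<phi>) (shortcut_mset n f (\<phi> u) (\<phi> v))"
proof -
  have perm: "p permutes {1..n}" if "p \<in> fiber_shortcuts n f u v" for p f u v
    using fiber_shortcutsD[OF that] bruhat_le_permutes by blast
  have S: "fiber_shortcuts n (\<lambda>x. f (\<phi> x)) u v = \<phi> ` fiber_shortcuts n f (\<phi> u) (\<phi> v)"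
  proof (intro equalityI subsetI)
    fix p assume p: "p \<in> fiber_shortcuts n (\<lambda>x. f (\<phi> x)) u v"
    then have "\<phi> p \<in> fiber_shortcuts n f (\<phi> u) (\<phi> v)"
      using fiber_shortcuts_iff[OF u v perm[OF p], of f] by simp
    then show "p \<in> \<phi> ` fiber_shortcuts n f (\<phi> u) (\<phi> v)"
      using invol[OF perm[OF p]] by (metis image_eqI)
  next
    fix p assume "p \<in> \<phi> ` fiber_shortcuts n f (\<phi> u) (\<phi> v)"
    then obtain q where q: "p = \<phi> q" "q \<in> fiber_shortcuts n f (\<phi> u) (\<phi> v)"
      by blast
    then show "p \<in> fiber_shortcuts n (\<lambda>x. f (\<phi> x)) u v"
      using fiber_shortcuts_iff[OF u v maps[OF perm[OF q(2)]], of f] invol[OF perm[OF q(2)]] by simp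
  qed
  have inj: "inj_on \<phi> (fiber_shortcuts n f (\<phi> u) (\<phi> v))"
    using perm eq_iff by (auto intro!: inj_onI)
  have d: "bruhat_dist n u (\<phi> q) = bruhat_dist n (\<phi> u) q" if "q \<in> fiber_shortcuts n f (\<phi> u) (\<phi> v)" for q
    using dist[OF u maps[OF perm[OF that]]] invol[OF perm[OF that]] by simp
  show ?thesis
    unfolding shortcut_mset_def S image_mset_mset_set[OF inj, symmetric] multiset.map_comp
    by (rule image_mset_cong) (simp add: d finite_fiber_shortcuts)
qed

end

lemma graded_bind_image:
  "graded_bind (image_mset (map_prod id h) M) k = (\<Sum>(d, p)\<in>#M. image_mset (map_prod ((+) d) id) (k (h p)))"
  by (simp add: graded_bind_def multiset.map_comp comp_def case_prod_unfold)

lemma image_graded_bind: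
  "image_mset (map_prod id h) (graded_bind M k) = graded_bind M (\<lambda>p. image_mset (map_prod id h) (k p))"
  by (induction M) (auto simp: graded_bind_def multiset.map_comp comp_def case_prod_unfold map_prod_def)

lemma (in bruhat_involution) graded_bind_shortcuts:
  assumes u: "u permutes {1..n}" and v: "v permutes {1..n}"
  shows "graded_bind (shortcut_mset n (\<lambda>x. f (\<phi> x)) u v) (\<lambda>p. shortcut_mset n (\<lambda>x. g (\<phi> x)) p v) =
    image_mset (map_prod id \<phi>)
      (graded_bind (shortcut_mset n f (\<phi> u) (\<phi> v)) (\<lambda>p. shortcut_mset n g p (\<phi> v)))"
proof -
  have "shortcut_mset n (\<lambda>x. g (\<phi> x)) (\<phi> p) v = image_mset (map_prod id \<phi>) (shortcut_mset n g p (\<phi> v))"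
    if "(d, p) \<in># shortcut_mset n f (\<phi> u) (\<phi> v)" for d p
  proof -
    have "p \<in> fiber_shortcuts n f (\<phi> u) (\<phi> v)"
      using that by (auto simp: shortcut_mset_def finite_fiber_shortcuts)
    then have p: "p permutes {1..n}"
      using fiber_shortcutsD bruhat_le_permutes by blast
    show ?thesis
      using shortcut_mset_image[OF maps[OF p] v, of g] by (simp add: invol[OF p])
  qed
  then show ?thesis
    unfolding shortcut_mset_image[OF u v] graded_bind_image image_graded_bind
    by (auto simp: graded_bind_def intro!: arg_cong[of _ _ sum_mset] image_mset_cong)
qed

context bruhat_involution
begin

text \<open>An embedding for \<open>E\<close> is transported along \<open>\<phi>\<close>. As
  \<open>\<phi>\<close> is an involution, the preimage of a set of edges is its image once more, and
  the same transport leads back.\<close>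

lemma spans_hypercube_embedding_image:
  assumes E: "E \<subseteq> {p. p permutes {1..n}} \<times> {p. p permutes {1..n}}"
    and \<theta>: "hypercube_embedding n E \<theta>" "\<theta> E = p" "\<forall>\<alpha>\<in>E. (\<theta> (E - {\<alpha>}), \<theta> E) = \<alpha>"
  defines "\<Phi> \<equiv> map_prod \<phi> \<phi>"
  defines "\<theta>' \<equiv> \<lambda>B. if B \<subseteq> \<Phi> ` E then \<phi> (\<theta> (\<Phi> ` B)) else undefined"
  shows "hypercube_embedding n (\<Phi> ` E) \<theta>'" and "\<theta>' (\<Phi> ` E) = \<phi> p"
    and "\<forall>\<alpha>\<in>\<Phi> ` E. (\<theta>' (\<Phi> ` E - {\<alpha>}), \<theta>' (\<Phi> ` E)) = \<alpha>"
proof -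
  have inv1: "\<Phi> (\<Phi> \<alpha>) = \<alpha>" if "\<alpha> \<in> E" for \<alpha>
    using that E invol by (auto simp: \<Phi>_def)
  have inv2: "\<Phi> (\<Phi> \<alpha>) = \<alpha>" if "\<alpha> \<in> \<Phi> ` E" for \<alpha>
    using that inv1 by auto
  have back_image: "\<Phi> ` B \<subseteq> E" if "B \<subseteq> \<Phi> ` E" for B
    using that inv1 by auto
  have twice: "\<Phi> ` \<Phi> ` B = B" if "B \<subseteq> \<Phi> ` E" for B
    using that inv2 by (force simp: image_iff)
  have twiceE: "\<Phi> ` \<Phi> ` E = E"
    using inv1 by (force simp: image_iff)
  have ok: "\<theta> A permutes {1..n}" if "A \<subseteq> E" for A
    using \<theta>(1) that by (auto simp: hypercube_embedding_def sym_group_carrier)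
  have inj: "\<theta> A = \<theta> B \<longleftrightarrow> A = B" if "A \<subseteq> E" "B \<subseteq> E" for A B
    using \<theta>(1) that by (auto simp: hypercube_embedding_def inj_on_def)
  have ed: "(\<theta> A, \<theta> (insert \<alpha> A)) \<in> bruhat_graph n" if "A \<subseteq> E" "\<alpha> \<in> E - A" for A \<alpha>
  proof -
    have "(A, insert \<alpha> A) \<in> hypercube_edges E"
      unfolding hypercube_edges_def using that by blast
    then show ?thesis
      using \<theta>(1) by (auto simp: hypercube_embedding_def)
  qed
  show "hypercube_embedding n (\<Phi> ` E) \<theta>'"
    unfolding hypercube_embedding_def
  proof (intro conjI)
    show "\<theta>' \<in> Pow (\<Phi> ` E) \<rightarrow>\<^sub>E carrier (sym_group n)"
      using maps[OF ok[OF back_image]] by (intro PiE_I) (auto simp: \<theta>'_def sym_group_carrier)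
    show "inj_on \<theta>' (Pow (\<Phi> ` E))"
    proof (rule inj_onI)
      fix A B assume AB: "A \<in> Pow (\<Phi> ` E)" "B \<in> Pow (\<Phi> ` E)" "\<theta>' A = \<theta>' B"
      then have "\<phi> (\<theta> (\<Phi> ` A)) = \<phi> (\<theta> (\<Phi> ` B))"
        by (simp add: \<theta>'_def)
      then have "\<Phi> ` A = \<Phi> ` B"
        using eq_iff[OF ok[OF back_image] ok[OF back_image]] inj[OF back_image back_image] AB by simp
      then show "A = B"
        using twice AB by (metis PowD)
    qed
    show "\<forall>(A, B)\<in>hypercube_edges (\<Phi> ` E). (\<theta>' A, \<theta>' B) \<in> bruhat_graph n"
    proof clarify
      fix A B assume "(A, B) \<in> hypercube_edges (\<Phi> ` E)"
      then obtain \<alpha> where \<alpha>: "B = insert \<alpha> A" "A \<subseteq> \<Phi> ` E" "\<alpha> \<in> \<Phi> ` E" "\<alpha> \<notin> A"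
        by (auto simp: hypercube_edges_def)
      have "\<Phi> \<alpha> \<notin> \<Phi> ` A"
        using \<alpha> inv2 by (metis image_iff subsetD)
      moreover have "\<Phi> \<alpha> \<in> E"
        using \<alpha>(3) inv1 by auto
      ultimately have "(\<theta> (\<Phi> ` A), \<theta> (insert (\<Phi> \<alpha>) (\<Phi> ` A))) \<in> bruhat_graph n"
        using ed[OF back_image[OF \<alpha>(2)]] by blast
      then have "(\<phi> (\<theta> (\<Phi> ` A)), \<phi> (\<theta> (\<Phi> ` B))) \<in> bruhat_graph n"
        unfolding \<alpha>(1) image_insert by (rule edge)
      then show "(\<theta>' A, \<theta>' B) \<in> bruhat_graph n"
        using \<alpha> by (simp add: \<theta>'_def)
    qed
  qed
  show top: "\<theta>' (\<Phi> ` E) = \<phi> p"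
    using \<theta>(2) twiceE by (simp add: \<theta>'_def)
  show "\<forall>\<alpha>\<in>\<Phi> ` E. (\<theta>' (\<Phi> ` E - {\<alpha>}), \<theta>' (\<Phi> ` E)) = \<alpha>"
  proof
    fix \<alpha> assume a: "\<alpha> \<in> \<Phi> ` E"
    then obtain \<beta> where \<beta>: "\<beta> \<in> E" "\<alpha> = \<Phi> \<beta>" by blast
    have "\<Phi> ` (\<Phi> ` E - {\<alpha>}) = E - {\<beta>}"
    proof -
      have "inj_on \<Phi> (\<Phi> ` E)"
        by (rule inj_on_inverseI[of _ \<Phi>]) (rule inv2)
      then have "\<Phi> ` (\<Phi> ` E - {\<alpha>}) = \<Phi> ` \<Phi> ` E - \<Phi> ` {\<alpha>}"
        using a by (intro inj_on_image_set_diff[of _ "\<Phi> ` E"]) auto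
      also have "\<dots> = E - {\<beta>}"
        unfolding twiceE using \<beta> inv1[of \<beta>] by simp
      finally show ?thesis .
    qed
    moreover have "\<Phi> ` E - {\<alpha>} \<subseteq> \<Phi> ` E" by blast
    ultimately have eq: "\<theta>' (\<Phi> ` E - {\<alpha>}) = \<phi> (\<theta> (E - {\<beta>}))"
      by (simp only: \<theta>'_def if_True)
    have \<beta>': "(\<theta> (E - {\<beta>}), p) = \<beta>"
      using \<theta>(3) \<beta>(1) unfolding \<theta>(2) by (rule bspec)
    show "(\<theta>' (\<Phi> ` E - {\<alpha>}), \<theta>' (\<Phi> ` E)) = \<alpha>"
      unfolding top eq using arg_cong[OF \<beta>', of \<Phi>] \<beta>(2) by (simp only: \<Phi>_def map_prod_simp)
  qed
qed

lemma spans_hypercube_image: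
  assumes E: "E \<subseteq> {p. p permutes {1..n}} \<times> {p. p permutes {1..n}}" and p: "p permutes {1..n}"
    and span: "spans_hypercube n p E"
  shows "spans_hypercube n (\<phi> p) (map_prod \<phi> \<phi> ` E)"
proof -
  let ?\<Phi> = "map_prod \<phi> \<phi>"
  let ?ok = "\<lambda>p E \<theta>. hypercube_embedding n E \<theta> \<and> \<theta> E = p \<and> (\<forall>\<alpha>\<in>E. (\<theta> (E - {\<alpha>}), \<theta> E) = \<alpha>)"
  let ?T = "\<lambda>E \<theta> B. if B \<subseteq> ?\<Phi> ` E then \<phi> (\<theta> (?\<Phi> ` B)) else undefined"
  have E': "?\<Phi> ` E \<subseteq> {p. p permutes {1..n}} \<times> {p. p permutes {1..n}}"
    using E maps by auto
  have inv1: "?\<Phi> (?\<Phi> \<alpha>) = \<alpha>" if "\<alpha> \<in> {p. p permutes {1..n}} \<times> {p. p permutes {1..n}}" for \<alpha>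
    using that invol by auto
  have twice: "?\<Phi> ` ?\<Phi> ` B = B" if "B \<subseteq> {p. p permutes {1..n}} \<times> {p. p permutes {1..n}}" for B
  proof -
    have "?\<Phi> ` ?\<Phi> ` B = (\<lambda>\<alpha>. \<alpha>) ` B"
      unfolding image_image by (rule image_cong) (use that inv1 in auto)
    then show ?thesis by simp
  qed
  obtain \<theta> where \<theta>: "?ok p E \<theta>" and unique: "\<And>\<theta>'. ?ok p E \<theta>' \<Longrightarrow> \<theta>' = \<theta>"
    using span unfolding spans_hypercube_def by (elim ex1E) blast
  have "?ok (\<phi> p) (?\<Phi> ` E) (?T E \<theta>)"
    using spans_hypercube_embedding_image[OF E, of \<theta> p] \<theta> by blast
  moreover have "\<theta>' = ?T E \<theta>" if ok: "?ok (\<phi> p) (?\<Phi> ` E) \<theta>'" for \<theta>'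
  proof -
    have "?ok (\<phi> (\<phi> p)) (?\<Phi> ` ?\<Phi> ` E) (?T (?\<Phi> ` E) \<theta>')"
      using spans_hypercube_embedding_image[OF E', of \<theta>' "\<phi> p"] ok by blast
    then have eq: "?T (?\<Phi> ` E) \<theta>' = \<theta>"
      using unique unfolding twice[OF E] invol[OF p] by blast
    show ?thesis
    proof
      fix B
      show "\<theta>' B = ?T E \<theta> B"
      proof (cases "B \<subseteq> ?\<Phi> ` E")
        case True
        then have sub: "?\<Phi> ` B \<subseteq> E"
          using image_mono[OF True, of ?\<Phi>] twice[OF E] by simp
        have BB: "?\<Phi> ` ?\<Phi> ` B = B"
          using True E' by (intro twice) blast
        have "\<theta>' B permutes {1..n}"
          using ok True by (auto simp: hypercube_embedding_def sym_group_carrier)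
        moreover have "\<theta> (?\<Phi> ` B) = \<phi> (\<theta>' B)"
          unfolding eq[symmetric] twice[OF E] BB using sub by simp
        ultimately show ?thesis
          using True invol by simp
      next
        case False
        then show ?thesis
          using ok by (auto simp: hypercube_embedding_def PiE_def extensional_def)
      qed
    qed
  qed
  ultimately show ?thesis
    unfolding spans_hypercube_def by (intro ex1I[of _ "?T E \<theta>"]) blast+
qed

lemma fibration_comp:
  assumes "bruhat_fibration n f"
  shows "bruhat_fibration n (\<lambda>x. f (\<phi> x))"
proof -
  interpret bruhat_fibration n f by fact
  show ?thesis
  proof
    show "f (\<phi> y) = f (\<phi> v)" if "bruhat_le n x y" "bruhat_le n y v" "f (\<phi> x) = f (\<phi> v)" for x y v
      using top_fiber_upward[OF le le] that by blast
    show "\<exists>z. is_bruhat_min n (fiber n (\<lambda>x. f (\<phi> x)) u v) z" if uv: "bruhat_le n u v" for u v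
    proof -
      note perm = bruhat_le_permutes[OF uv]
      obtain z where z: "is_bruhat_min n (fiber n f (\<phi> u) (\<phi> v)) z"
        using fiber_min_exists[OF le[OF uv]] by blast
      then have zp: "z permutes {1..n}"
        using fiber_permutes[of z f "\<phi> u" "\<phi> v"] by (simp add: is_bruhat_min_def)
      have "is_bruhat_min n (fiber n (\<lambda>x. f (\<phi> x)) u v) (\<phi> z)"
        using fiber_min_iff[OF perm maps[OF zp], of f] z by (simp only: invol[OF zp])
      then show ?thesis by blast
    qed
    show "f (\<phi> x) = f (\<phi> y)"
      if "a1 \<noteq> a2" "(x, a1) \<in> bruhat_graph n" "(x, a2) \<in> bruhat_graph n"
        "f (\<phi> a1) = f (\<phi> y)" "f (\<phi> a2) = f (\<phi> y)" for a1 a2 x y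
    proof (rule diamond)
      show "\<phi> a1 \<noteq> \<phi> a2"
        using that(1-3) eq_iff bruhat_edge_permutes by blast
    qed (use that edge in blast)+
    show "spans_hypercube_cluster n p E"
      if p: "p permutes {1..n}"
        and E: "\<And>\<alpha>. \<alpha> \<in> E \<Longrightarrow> \<exists>x. \<alpha> = (x, p) \<and> (x, p) \<in> bruhat_graph n \<and> f (\<phi> x) \<noteq> f (\<phi> p)" for p E
      unfolding spans_hypercube_cluster_def
    proof (intro allI impI)
      let ?\<Phi> = "map_prod \<phi> \<phi>"
      fix E' assume E': "E' \<subseteq> E" and inc: "pairwise (\<lambda>\<alpha> \<beta>. bruhat_incomparable n (fst \<alpha>) (fst \<beta>)) E'"
      have perm: "E' \<subseteq> {p. p permutes {1..n}} \<times> {p. p permutes {1..n}}"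
      proof
        fix \<alpha> assume "\<alpha> \<in> E'"
        then have "\<alpha> \<in> E"
          using E' by blast
        then obtain x where x: "\<alpha> = (x, p)" "(x, p) \<in> bruhat_graph n"
          using E[of \<alpha>] by blast
        then show "\<alpha> \<in> {p. p permutes {1..n}} \<times> {p. p permutes {1..n}}"
          using bruhat_edge_permutes[OF x(2)] by simp
      qed
      have "spans_hypercube_cluster n (\<phi> p) (?\<Phi> ` E)"
      proof (rule cluster[OF maps[OF p]])
        fix \<alpha> assume "\<alpha> \<in> ?\<Phi> ` E"
        then obtain \<beta> where \<beta>: "\<alpha> = ?\<Phi> \<beta>" "\<beta> \<in> E"
          by (rule imageE)
        then obtain x where "\<beta> = (x, p)" "(x, p) \<in> bruhat_graph n" "f (\<phi> x) \<noteq> f (\<phi> p)"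
          using E[of \<beta>] by blast
        then show "\<exists>x. \<alpha> = (x, \<phi> p) \<and> (x, \<phi> p) \<in> bruhat_graph n \<and> f x \<noteq> f (\<phi> p)"
          using edge[of x p] \<beta>(1) by simp
      qed
      moreover have "?\<Phi> ` E' \<subseteq> ?\<Phi> ` E"
        using E' by blast
      moreover have "pairwise (\<lambda>\<alpha> \<beta>. bruhat_incomparable n (fst \<alpha>) (fst \<beta>)) (?\<Phi> ` E')"
      proof (rule pairwiseI)
        fix \<alpha> \<beta> assume ab: "\<alpha> \<in> ?\<Phi> ` E'" "\<beta> \<in> ?\<Phi> ` E'" "\<alpha> \<noteq> \<beta>"
        from ab(1) obtain \<alpha>' where 1: "\<alpha> = ?\<Phi> \<alpha>'" "\<alpha>' \<in> E'"
          by (rule imageE)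
        from ab(2) obtain \<beta>' where 2: "\<beta> = ?\<Phi> \<beta>'" "\<beta>' \<in> E'"
          by (rule imageE)
        note * = 1(2) 2(2) 1(1) 2(1)
        have "bruhat_incomparable n (fst \<alpha>') (fst \<beta>')"
          using * ab(3) pairwiseD[OF inc] by blast
        moreover have "fst \<alpha>' permutes {1..n}" "fst \<beta>' permutes {1..n}"
          using * perm by auto
        ultimately show "bruhat_incomparable n (fst \<alpha>) (fst \<beta>)"
          using * le_iff by (simp add: bruhat_incomparable_def)
      qed
      ultimately have "spans_hypercube n (\<phi> p) (?\<Phi> ` E')"
        by (auto simp: spans_hypercube_cluster_def)
      then have "spans_hypercube n (\<phi> (\<phi> p)) (?\<Phi> ` ?\<Phi> ` E')"
        using perm maps by (intro spans_hypercube_image[OF _ maps[OF p]]) auto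
      moreover have "?\<Phi> ` ?\<Phi> ` E' = (\<lambda>\<alpha>. \<alpha>) ` E'"
        unfolding image_image by (rule image_cong) (use perm invol in auto)
      ultimately show "spans_hypercube n p E'"
        by (simp add: invol[OF p])
    qed
  qed
qed

end

section \<open>The four fibrations\<close>

lemma first_value_fibration:
  assumes n: "1 \<le> n"
  shows "bruhat_fibration n (\<lambda>x. x 1)"
proof
  show "y 1 = v 1" if "bruhat_le n x y" "bruhat_le n y v" "x 1 = v 1" for x y v
    using first_value_mono[OF that(1)] first_value_mono[OF that(2)] that(3) by simp
  show "\<exists>z. is_bruhat_min n (fiber n (\<lambda>x. x 1) u v) z" if uv: "bruhat_le n u v" for u v
  proof -
    have "v 1 \<le> n"
      using permutes_in_image[OF bruhat_le_permutes(2)[OF uv], of 1] n by simp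
    then obtain z where "z 1 = v 1" "bruhat_le n u z"
      "\<And>y. \<lbrakk>y 1 = v 1; bruhat_le n u y\<rbrakk> \<Longrightarrow> bruhat_le n z y"
      using first_value_min_exists[OF bruhat_le_permutes(1)[OF uv] _ first_value_mono[OF uv] n] by blast
    then have "is_bruhat_min n (fiber n (\<lambda>x. x 1) u v) z"
      using uv by (auto simp: is_bruhat_min_def fiber_def bruhat_interval_iff)
    then show ?thesis by blast
  qed
  show "x 1 = y 1"
    if e: "a1 \<noteq> a2" "(x, a1) \<in> bruhat_graph n" "(x, a2) \<in> bruhat_graph n" "a1 1 = y 1" "a2 1 = y 1"
    for a1 a2 x y
  proof (rule ccontr)
    assume "x 1 \<noteq> y 1"
    then have "x 1 \<noteq> a1 1" "x 1 \<noteq> a2 1"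
      using e(4,5) by simp_all
    then obtain j k where "x = exchange a1 1 j" "x = exchange a2 1 k"
      using edge_changing_first_value[OF e(2)] edge_changing_first_value[OF e(3)] by metis
    then have a: "a1 = exchange x 1 j" "a2 = exchange x 1 k"
      by (metis exchange_exchange)+
    then have "x j = x k"
      using e(4,5) by (simp add: exchange_apply)
    then have "j = k"
      using permutes_eq_iff[OF bruhat_edge_permutes(1)[OF e(2)]] by simp
    then show False
      using a e(1) by simp
  qed
qed (rule first_value_cluster)

definition reversal :: "nat \<Rightarrow> nat \<Rightarrow> nat" where
  "reversal n i = (if i \<in> {1..n} then n + 1 - i else i)"

text \<open>Conjugation by the longest element.\<close>

definition reverse_complement :: "nat \<Rightarrow> perm \<Rightarrow> perm" where
  "reverse_complement n x = reversal n \<circ> x \<circ> reversal n"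

lemma reversal_reversal [simp]: "reversal n (reversal n i) = i"
  by (auto simp: reversal_def)

lemma reversal_in_iff [simp]: "reversal n i \<in> {1..n} \<longleftrightarrow> i \<in> {1..n}"
  by (auto simp: reversal_def)

lemma reversal_eq_iff [simp]: "reversal n i = reversal n j \<longleftrightarrow> i = j"
  by (metis reversal_reversal)

lemma reversal_less_iff: "\<lbrakk>i \<in> {1..n}; j \<in> {1..n}\<rbrakk> \<Longrightarrow> reversal n i < reversal n j \<longleftrightarrow> j < i"
  by (auto simp: reversal_def)

lemma reversal_permutes: "reversal n permutes {1..n}"
  unfolding permutes_def
proof (intro conjI allI impI)
  show "reversal n i = i" if "i \<notin> {1..n}" for i
    using that by (simp only: reversal_def if_False)
  show "\<exists>!i. reversal n i = j" for j
    by (metis reversal_reversal)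
qed

lemma inv_reversal: "inv' (reversal n) = reversal n"
  by (rule inv_equality) simp_all

lemma inv_exchange:
  assumes "x permutes S"
  shows "inv' (exchange x a b) = exchange (inv' x) (x a) (x b)"
proof -
  have "bij x" "bij (inv' x)"
    by (rule permutes_bij[OF assms], rule permutes_bij[OF permutes_inv[OF assms]])
  have "inv' (exchange x a b) = transpose a b \<circ> inv' x"
    unfolding exchange_eq_comp using \<open>bij x\<close> by (simp only: o_inv_distrib bij_transpose inv_transpose_eq)
  also have "\<dots> = inv' x \<circ> transpose (inv' (inv' x) a) (inv' (inv' x) b)"
    by (rule transpose_comp_eq[OF \<open>bij (inv' x)\<close>])
  finally show ?thesis
    using \<open>bij x\<close> by (simp only: inv_inv_eq exchange_eq_comp)
qed

lemma inverse_involution: "bruhat_involution n inv'"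
proof
  show "inv' x permutes {1..n}" if "x permutes {1..n}" for x
    using that by (rule permutes_inv)
  show "inv' (inv' x) = x" if "x permutes {1..n}" for x
    using that by (intro inv_inv_eq permutes_bij)
  show "(inv' x, inv' y) \<in> bruhat_graph n" if "(x, y) \<in> bruhat_graph n" for x y
  proof -
    obtain a b where ab: "x permutes {1..n}" "a \<in> {1..n}" "b \<in> {1..n}" "a < b" "x a < x b"
      "y = exchange x a b"
      using \<open>(x, y) \<in> bruhat_graph n\<close> by (rule bruhat_edgeE)
    have "x a \<in> {1..n}" "x b \<in> {1..n}"
      using ab(2,3) by (simp_all only: permutes_in_image[OF ab(1)])
    moreover have "inv' x (x a) < inv' x (x b)"
      using ab(4) by (simp add: permutes_inverses(2)[OF ab(1)])
    ultimately show ?thesis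
      unfolding ab(6) inv_exchange[OF ab(1)] using ab(5) by (intro bruhat_edgeI permutes_inv ab(1))
  qed
qed

lemma reverse_complement_apply: "reverse_complement n x i = reversal n (x (reversal n i))"
  by (simp add: reverse_complement_def)

lemma reverse_complement_exchange:
  "reverse_complement n (exchange x a b) =
    exchange (reverse_complement n x) (reversal n b) (reversal n a)"
proof
  fix q
  have "reversal n q = a \<longleftrightarrow> q = reversal n a" for a
    by (metis reversal_reversal)
  then show "reverse_complement n (exchange x a b) q =
    exchange (reverse_complement n x) (reversal n b) (reversal n a) q"
    by (auto simp: reverse_complement_apply exchange_apply)
qed

lemma reverse_complement_involution: "bruhat_involution n (reverse_complement n)"
proof
  show perm: "reverse_complement n x permutes {1..n}" if "x permutes {1..n}" for x
    unfolding reverse_complement_def using that by (intro permutes_compose reversal_permutes)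
  show "reverse_complement n (reverse_complement n x) = x" for x
    by (simp add: fun_eq_iff reverse_complement_apply)
  show "(reverse_complement n x, reverse_complement n y) \<in> bruhat_graph n"
    if "(x, y) \<in> bruhat_graph n" for x y
  proof -
    obtain a b where ab: "x permutes {1..n}" "a \<in> {1..n}" "b \<in> {1..n}" "a < b" "x a < x b"
      "y = exchange x a b"
      using \<open>(x, y) \<in> bruhat_graph n\<close> by (rule bruhat_edgeE)
    have "x a \<in> {1..n}" "x b \<in> {1..n}"
      using ab(2,3) by (simp_all only: permutes_in_image[OF ab(1)])
    then show ?thesis
      unfolding ab(6) reverse_complement_exchange using ab
      by (intro bruhat_edgeI perm) (simp_all only: reverse_complement_apply reversal_reversal reversal_in_iff reversal_less_iff)
  qed
qed

text \<open>On permutation matrices this is the reflection in the antidiagonal.\<close>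

definition antitranspose :: "nat \<Rightarrow> perm \<Rightarrow> perm" where
  "antitranspose n x = reverse_complement n (inv' x)"

lemma antitranspose_involution: "bruhat_involution n (antitranspose n)"
proof -
  interpret I: bruhat_involution n inv'
    by (rule inverse_involution)
  interpret R: bruhat_involution n "reverse_complement n"
    by (rule reverse_complement_involution)
  show ?thesis
  proof
    show "antitranspose n x permutes {1..n}" if "x permutes {1..n}" for x
      unfolding antitranspose_def by (intro R.maps I.maps that)
    show "(antitranspose n x, antitranspose n y) \<in> bruhat_graph n"
      if "(x, y) \<in> bruhat_graph n" for x y
      unfolding antitranspose_def by (intro R.edge I.edge that)
    show "antitranspose n (antitranspose n x) = x"
      if x: "x permutes {1..n}" for x
    proof -
      have bij: "bij (inv' x)" "bij (reversal n)"
        by (rule permutes_bij[OF permutes_inv[OF x]], rule permutes_bij[OF reversal_permutes])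
      have "inv' (reverse_complement n (inv' x)) = reverse_complement n (inv' (inv' x))"
        unfolding reverse_complement_def using bij
        by (simp only: o_inv_distrib bij_comp inv_reversal o_assoc)
      then show ?thesis
        unfolding antitranspose_def by (simp only: I.invol[OF x] R.invol[OF x])
    qed
  qed
qed

section \<open>Shortcuts are ends of stars\<close>

lemma fiber_shortcuts_first_hit:
  assumes "p \<in> fiber_shortcuts n f u v" "x \<in> fiber n f u v" "(u, x) \<in> bruhat_graph n ^^ k"
    "(x, p) \<in> bruhat_graph n ^^ l" "k + l = bruhat_dist n u p"
  shows "x = p"
  using assms unfolding fiber_shortcuts_def by simp

lemma fiber_shortcuts_trivial:
  assumes "bruhat_le n u v" "f u = f v"
  shows "fiber_shortcuts n f u v = {u}"
proof -
  have u: "u permutes {1..n}" "u \<in> fiber n f u v"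
    using assms bruhat_le_permutes bruhat_le_refl by (auto simp: fiber_def bruhat_interval_iff)
  have "bruhat_dist n u u = 0"
    unfolding bruhat_dist_eq[OF u(1)] by (rule Least_eq_0) simp
  then have "u \<in> fiber_shortcuts n f u v"
    using u by (auto simp: fiber_shortcuts_def)
  moreover have "p = u" if p: "p \<in> fiber_shortcuts n f u v" for p
  proof -
    have "(u, p) \<in> bruhat_graph n ^^ bruhat_dist n u p"
      using fiber_shortcutsD[OF p] by (intro bruhat_dist_relpow) simp
    moreover have "(u, u) \<in> bruhat_graph n ^^ 0"
      by simp
    ultimately show ?thesis
      using fiber_shortcuts_first_hit[OF p u(2)] by force
  qed
  ultimately show ?thesis by blast
qed

text \<open>Used with \<open>c = 1\<close> if the fiber prescribes the first entry, and with the
  final position of the largest value as \<open>c\<close> if it prescribes that position. In both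
  cases elements of the fiber have the same entry at \<open>c\<close> as the end of the star, so
  \<open>star_geodesic_vertex\<close> applies.\<close>

lemma star_fiber_shortcut:
  assumes u: "u permutes {1..n}" and qs: "sorted_wrt (<) (c # qs)" "set (c # qs) \<subseteq> {1..n}"
    and up: "upward u (star c qs)"
    and v: "bruhat_le n (exchanges u (star c qs)) v" "f (exchanges u (star c qs)) = f v"
    and f: "\<And>x. \<lbrakk>x permutes {1..n}; f x = f v\<rbrakk> \<Longrightarrow> x c = exchanges u (star c qs) c"
  shows "exchanges u (star c qs) \<in> fiber_shortcuts n f u v"
proof -
  let ?p = "exchanges u (star c qs)"
  have "(u, ?p) \<in> bruhat_graph n ^^ length qs"
    unfolding relpow_bruhat_graph_iff[OF u]
    using star_position_pairs[OF qs] up by (intro exI[of _ "star c qs"]) auto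
  then have "bruhat_le n u ?p"
    by (rule relpow_bruhat_le) (rule u)
  then have "?p \<in> fiber n f u v"
    using v by (simp add: fiber_def bruhat_interval_iff)
  moreover have "x = ?p"
    if "x \<in> fiber n f u v" "(u, x) \<in> bruhat_graph n ^^ k" "(x, ?p) \<in> bruhat_graph n ^^ l"
      "k + l = bruhat_dist n u ?p" for x k l
  proof (rule star_geodesic_vertex[OF u qs up that(2,3)])
    show "k + l = length qs"
      using that(4) by (simp add: star_dist[OF u qs up])
    show "x c = ?p c"
      using that(1) by (intro f) (auto simp: fiber_def bruhat_interval_iff dest: bruhat_le_permutes)
  qed
  ultimately show ?thesis
    by (auto simp: fiber_shortcuts_def)
qed

text \<open>A shortcut is joined to \<open>u\<close> by a shortest path in normal form. Once such a
  path stops moving the entry at position 1 it has reached the fiber, so it is a star.\<close>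

lemma first_value_shortcuts_iff:
  assumes u: "u permutes {1..n}" and n: "1 \<le> n"
  shows "p \<in> fiber_shortcuts n (\<lambda>x. x 1) u v \<longleftrightarrow> bruhat_le n p v \<and> p 1 = v 1 \<and>
    (\<exists>qs. sorted_wrt (<) (1 # qs) \<and> set qs \<subseteq> {2..n} \<and> upward u (star 1 qs) \<and> p = exchanges u (star 1 qs))"
    (is "?L \<longleftrightarrow> ?R")
proof
  assume ?R
  then obtain qs where qs: "sorted_wrt (<) (1 # qs)" "set qs \<subseteq> {2..n}" "upward u (star 1 qs)"
    "p = exchanges u (star 1 qs)" and v: "bruhat_le n p v" "p 1 = v 1"
    by blast
  have sub: "set (1 # qs) \<subseteq> {1..n}"
    using qs(2) n by auto
  show ?L
    unfolding qs(4)
    by (rule star_fiber_shortcut[OF u qs(1) sub qs(3)]) (use v in \<open>auto simp: qs(4)\<close>)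
next
  assume L: ?L
  have le: "bruhat_le n u p" "bruhat_le n p v" "p 1 = v 1"
    using fiber_shortcutsD[OF L] by auto
  obtain qs k where qs: "sorted_wrt (<) (1 # qs)" "set qs \<subseteq> {2..n}" "upward u (star 1 qs)"
    "(exchanges u (star 1 qs), p) \<in> bruhat_graph n ^^ k" "length qs + k = bruhat_dist n u p"
    "exchanges u (star 1 qs) 1 = p 1"
    using star_normal_form[OF u bruhat_dist_relpow[OF le(1)]] by blast
  let ?y = "exchanges u (star 1 qs)"
  have pairs: "set (star 1 qs) \<subseteq> position_pairs n"
    using qs(1,2) n by (intro star_position_pairs) auto
  have uy: "(u, ?y) \<in> bruhat_graph n ^^ length qs"
    unfolding relpow_bruhat_graph_iff[OF u] using pairs qs(3) by (intro exI[of _ "star 1 qs"]) auto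
  have "bruhat_le n u ?y"
    by (rule relpow_bruhat_le[OF uy u])
  moreover have "bruhat_le n ?y p"
    by (rule relpow_bruhat_le[OF qs(4) exchanges_permutes[OF u pairs]])
  then have "bruhat_le n ?y v"
    using le(2) by (rule bruhat_le_trans)
  ultimately have "?y \<in> fiber n (\<lambda>x. x 1) u v"
    using le(3) qs(6) by (simp add: fiber_def bruhat_interval_iff)
  then have "?y = p"
    by (rule fiber_shortcuts_first_hit[OF L _ uy qs(4,5)])
  then show ?R
    using le(2,3) qs(1-3) by metis
qed

lemma upward_starI:
  assumes "distinct (c # qs)" "sorted_wrt (<) (map u (c # qs))"
  shows "upward u (star c qs)"
  using assms
proof (induction qs arbitrary: u)
  case (Cons q qs)
  have eq: "map (exchange u c q) (c # qs) = map u (q # qs)"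
    using Cons.prems by (auto simp: exchange_apply)
  have "sorted_wrt (<) (map (exchange u c q) (c # qs))"
    unfolding eq using Cons.prems by simp
  then show ?case
    using Cons by simp
qed simp

lemma exchange_disjoint_commute:
  "{a, b} \<inter> {c, d} = {} \<Longrightarrow> exchange (exchange w a b) c d = exchange (exchange w c d) a b"
  by (auto simp: fun_eq_iff exchange_apply)

lemma exchanges_exchange_disjoint:
  assumes "\<And>r s. (r, s) \<in> set es \<Longrightarrow> {a, b} \<inter> {r, s} = {}"
  shows "exchanges (exchange w a b) es = exchange (exchanges w es) a b"
  using assms
proof (induction w es rule: exchanges.induct)
  case (2 w r s es)
  have "exchange (exchange w a b) r s = exchange (exchange w r s) a b"
    using 2(2)[of r s] by (intro exchange_disjoint_commute) simp
  then show ?case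
    using 2 by simp
qed simp

lemma antitranspose_exchange:
  assumes "y permutes {1..n}"
  shows "antitranspose n (exchange y a b) =
    exchange (antitranspose n y) (reversal n (y a)) (reversal n (y b))"
  unfolding antitranspose_def inv_exchange[OF assms] reverse_complement_exchange
  by (rule exchange_commute)

lemma antitranspose_apply:
  assumes "y permutes {1..n}"
  shows "antitranspose n y (reversal n (y a)) = reversal n a"
  unfolding antitranspose_def reverse_complement_apply
  by (simp add: permutes_inverses[OF assms])

text \<open>Cycling \<open>Q @ [J]\<close> amounts to exchanging its last two entries and then
  cycling \<open>Q\<close>.\<close>

lemma star_snoc_exchange:
  assumes "distinct (Q @ [J])" "Q \<noteq> []"
  shows "exchanges (exchange w J (last Q)) (star (hd Q) (tl Q)) = exchanges w (star (hd Q) (tl (Q @ [J])))"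
proof (cases "tl Q = []")
  case True
  then obtain i where "Q = [i]"
    using assms(2) by (cases Q) auto
  then show ?thesis
    by (simp add: exchange_commute)
next
  case False
  define i R q where "i = hd Q" and "R = butlast (tl Q)" and "q = last (tl Q)"
  have Q: "Q = i # R @ [q]"
    using assms(2) False by (cases Q) (auto simp: i_def R_def q_def)
  let ?w = "exchanges w (star i R)"
  have "exchanges (exchange w J q) (star i R) = exchange ?w J q"
    using assms(1) unfolding Q by (intro exchanges_exchange_disjoint) auto
  moreover have "exchange (exchange ?w J q) i q = exchange (exchange ?w i q) i J"
    using assms(1) unfolding Q by (auto simp: fun_eq_iff exchange_apply)
  ultimately show ?thesis
    unfolding Q by (simp add: exchanges_append)
qed

text \<open>The reflection interchanges positions and values, up to reversal. A star, which changes
  the entry at one position, becomes a sequence of exchanges that move one value through the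
  positions in \<open>Q\<close> from right to left, and \<open>star_snoc_exchange\<close> rewrites
  it as a star at the leftmost of them.\<close>

lemma antitranspose_star:
  fixes y :: perm
  assumes "y permutes {1..n}" "distinct (c # qs)" "set (c # qs) \<subseteq> {1..n}"
  defines "Q \<equiv> map (\<lambda>q. reversal n (y q)) (rev (c # qs))"
  shows "antitranspose n (exchanges y (star c qs)) =
    exchanges (antitranspose n y) (star (hd Q) (tl Q))"
  using assms(1-3) unfolding Q_def
proof (induction qs arbitrary: y)
  case (Cons q qs)
  let ?y = "exchange y c q"
  let ?Q = "map (\<lambda>q. reversal n (y q)) (rev qs) @ [reversal n (y q)]"
  have y: "?y permutes {1..n}"
    using Cons.prems by (intro exchange_permutes) auto
  have eq: "map (\<lambda>q. reversal n (?y q)) (rev (c # qs)) = ?Q"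
    using Cons.prems(2) by (auto simp: exchange_apply)
  have "antitranspose n (exchanges ?y (star c qs)) =
      exchanges (antitranspose n ?y) (star (hd ?Q) (tl ?Q))"
    using Cons.prems unfolding eq[symmetric] by (intro Cons.IH[OF y]) auto
  also have "antitranspose n ?y =
      exchange (antitranspose n y) (reversal n (y c)) (last ?Q)"
    by (simp add: antitranspose_exchange[OF Cons.prems(1)])
  also have "exchanges \<dots> (star (hd ?Q) (tl ?Q)) =
      exchanges (antitranspose n y) (star (hd ?Q) (tl (?Q @ [reversal n (y c)])))"
  proof (rule star_snoc_exchange)
    have "inj (\<lambda>q. reversal n (y q))"
      using permutes_eq_iff[OF Cons.prems(1)] by (auto intro!: injI)
    then have "distinct (map (\<lambda>q. reversal n (y q)) (rev (c # q # qs)))"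
      using Cons.prems(2) unfolding distinct_map distinct_rev by (blast intro: inj_on_subset)
    then show "distinct (?Q @ [reversal n (y c)])"
      by simp
  qed simp
  finally show ?case
    by (cases "rev qs") auto
qed simp

text \<open>Up to reversal, this is the position of the largest value \<open>n\<close>.\<close>

abbreviation top_position :: "nat \<Rightarrow> perm \<Rightarrow> nat" where
  "top_position n \<equiv> \<lambda>x. antitranspose n x 1"

lemma top_position_eq_iff:
  assumes "x permutes {1..n}" "v permutes {1..n}" "v i = n" "1 \<le> n"
  shows "top_position n x = top_position n v \<longleftrightarrow> x i = n"
proof -
  have one: "reversal n 1 = n"
    using assms(4) by (simp add: reversal_def)
  have "top_position n x = top_position n v \<longleftrightarrow> inv' x n = inv' v n"
    by (simp only: antitranspose_def reverse_complement_apply one reversal_eq_iff)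
  also have "inv' v n = i"
    using permutes_inverses(2)[OF assms(2), of i] assms(3) by simp
  also have "inv' x n = i \<longleftrightarrow> x i = n"
    using permutes_inv_eq[OF assms(1)] by metis
  finally show ?thesis .
qed

text \<open>Moving the largest value from position \<open>j\<close> to its final position
  \<open>i\<close> step by step has the same effect as a star at \<open>i\<close> whose last
  exchange brings it there at once. In this form the shortcuts can be compared with those for the
  first value.\<close>

lemma top_position_shortcuts_iff:
  assumes u: "u permutes {1..n}" and v: "v permutes {1..n}" and ij: "i \<in> {1..n}" "j \<in> {1..n}" "i < j"
    and top: "u j = n" "v i = n"
  shows "p \<in> fiber_shortcuts n (top_position n) u v \<longleftrightarrow> bruhat_le n p v \<and>
    (\<exists>qs. sorted_wrt (<) (i # qs @ [j]) \<and> upward u (star i (qs @ [j])) \<and>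
       p = exchanges u (star i (qs @ [j])))"
    (is "?L \<longleftrightarrow> ?R")
proof
  have n: "1 \<le> n"
    using ij by auto
  interpret bruhat_involution n "antitranspose n"
    by (rule antitranspose_involution)
  let ?\<psi> = "antitranspose n"
  {
    assume ?R
    then obtain qs where qs: "sorted_wrt (<) (i # qs @ [j])" "upward u (star i (qs @ [j]))"
      "p = exchanges u (star i (qs @ [j]))" and pv: "bruhat_le n p v"
      by blast
    have sub: "set (i # qs @ [j]) \<subseteq> {1..n}"
      using qs(1) ij by (fastforce simp: sorted_wrt_append)
    have "distinct (i # qs @ [j])"
      using qs(1) strict_sorted_iff by blast
    then have pi: "p i = n"
      using star_values(2)[OF _ qs(2)] top qs(3) by simp
    have p: "p permutes {1..n}"
      using pv by (rule bruhat_le_permutes)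
    show ?L
      unfolding qs(3)
    proof (rule star_fiber_shortcut[OF u qs(1) sub qs(2)])
      show "bruhat_le n (exchanges u (star i (qs @ [j]))) v"
        using pv by (simp only: qs(3))
      show "top_position n (exchanges u (star i (qs @ [j]))) = top_position n v"
        using top_position_eq_iff[OF p v top(2) n] pi by (simp only: qs(3))
      show "x i = exchanges u (star i (qs @ [j])) i"
        if "x permutes {1..n}" "top_position n x = top_position n v" for x
        using iffD1[OF top_position_eq_iff[OF that(1) v top(2) n] that(2)] pi by (simp only: qs(3))
    qed
  }
  {
    assume L: ?L
    have pv: "bruhat_le n p v" "top_position n p = top_position n v"
      using fiber_shortcutsD[OF L] by auto
    have p: "p permutes {1..n}"
      using pv(1) by (rule bruhat_le_permutes)
    have pi: "p i = n"
      using top_position_eq_iff[OF p v top(2) n] pv(2) by blast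
    have "?\<psi> p \<in> fiber_shortcuts n (\<lambda>x. x 1) (?\<psi> u) (?\<psi> v)"
      using fiber_shortcuts_iff[OF u v p, of "\<lambda>x. x 1"] L by blast
    then obtain qs where qs: "sorted_wrt (<) (1 # qs)" "set qs \<subseteq> {2..n}" "upward (?\<psi> u) (star 1 qs)"
      "?\<psi> p = exchanges (?\<psi> u) (star 1 qs)"
      unfolding first_value_shortcuts_iff[OF maps[OF u] n] by blast
    have d: "distinct (1 # qs)"
      using qs(1) strict_sorted_iff by blast
    have sub: "set (1 # qs) \<subseteq> {1..n}"
      using qs(2) n by auto
    define Q where "Q = map (\<lambda>q. reversal n (?\<psi> u q)) (rev (1 # qs))"
    have "p = ?\<psi> (exchanges (?\<psi> u) (star 1 qs))"
      using invol[OF p] qs(4) by simp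
    also have "\<dots> = exchanges (?\<psi> (?\<psi> u)) (star (hd Q) (tl Q))"
      unfolding Q_def by (rule antitranspose_star[OF maps[OF u] d sub])
    finally have pQ: "p = exchanges u (star (hd Q) (tl Q))"
      by (simp only: invol[OF u])
    have Q_ne: "Q = hd Q # tl Q"
      by (simp add: Q_def)
    have rev_sorted: "sorted_wrt (<) (map (reversal n) (rev xs))"
      if "sorted_wrt (<) xs" "set xs \<subseteq> {1..n}" for xs
      using that by (induction xs) (auto simp: sorted_wrt_append reversal_def)
    have "sorted_wrt (<) (map (?\<psi> u) (1 # qs))"
      by (rule star_values(3)[OF d qs(3)])
    moreover have "set (map (?\<psi> u) (1 # qs)) \<subseteq> {1..n}"
      using sub permutes_in_image[OF maps[OF u]] by (auto simp del: atLeastAtMost_iff)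
    ultimately have "sorted_wrt (<) (map (reversal n) (rev (map (?\<psi> u) (1 # qs))))"
      by (rule rev_sorted)
    then have Q_sorted: "sorted_wrt (<) Q"
      by (simp add: Q_def rev_map comp_def)
    have uQ: "map u Q = map (reversal n) (rev (1 # qs))"
      using antitranspose_apply[OF maps[OF u]] invol[OF u]
      by (simp add: Q_def)
    then have uQ_sorted: "sorted_wrt (<) (map u Q)"
      using rev_sorted[OF qs(1) sub] by simp
    have Q_d: "distinct (hd Q # tl Q)"
      using Q_sorted Q_ne strict_sorted_iff by metis
    have up: "upward u (star (hd Q) (tl Q))"
      using uQ_sorted Q_ne by (intro upward_starI[OF Q_d]) simp
    have last_uQ: "last (map u Q) = n"
      unfolding uQ using n by (simp add: reversal_def)
    have "p (hd Q) = n"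
      using star_values(2)[OF Q_d up] last_uQ Q_ne pQ by simp
    then have hd: "hd Q = i"
      using pi permutes_eq_iff[OF p] by metis
    have "u (last Q) = n"
      using last_uQ Q_ne by (metis last_map list.discI)
    then have lst: "last Q = j"
      using top(1) permutes_eq_iff[OF u] by metis
    have "tl Q \<noteq> []"
      using hd lst ij(3) Q_ne by (metis last.simps less_irrefl)
    then have "tl Q = butlast (tl Q) @ [j]"
      using lst Q_ne by (metis append_butlast_last_id last_tl)
    then show ?R
      using pv(1) Q_sorted up pQ Q_ne unfolding hd
      by (intro conjI exI[of _ "butlast (tl Q)"]) auto
  }
qed

section \<open>Chains of exchanges and the Yang--Baxter equation\<close>

text \<open>All subsequences of a list of exchanges that go up in every step, recorded by length and
  end. Shortcuts will be listed in this way, so that identities between double shortcuts become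
  identities between lists of exchanges.\<close>

fun up_chains :: "(nat \<times> nat) list \<Rightarrow> perm \<Rightarrow> (nat \<times> perm) multiset" where
  "up_chains [] x = {#(0, x)#}"
| "up_chains ((a, b) # es) x = up_chains es x +
     (if x a < x b then image_mset (map_prod Suc id) (up_chains es (exchange x a b)) else {#})"

lemma graded_bind_add: "graded_bind (M + N) k = graded_bind M k + graded_bind N k"
  by (simp add: graded_bind_def)

lemma graded_bind_empty [simp]: "graded_bind {#} k = {#}"
  by (simp add: graded_bind_def)

lemma graded_bind_return: "graded_bind {#(0, x)#} k = k x"
proof -
  have "map_prod ((+) (0::nat)) id = (id :: nat \<times> perm \<Rightarrow> nat \<times> perm)"
    by (auto simp: fun_eq_iff)
  then show ?thesis
    by (simp add: graded_bind_def)
qed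

lemma graded_bind_Suc:
  "graded_bind (image_mset (map_prod Suc id) M) k = image_mset (map_prod Suc id) (graded_bind M k)"
  by (induction M) (auto simp: graded_bind_def multiset.map_comp intro!: image_mset_cong)

lemma chains_append: "up_chains (es @ fs) x = graded_bind (up_chains es x) (up_chains fs)"
  by (induction es x rule: up_chains.induct)
    (simp_all add: graded_bind_add graded_bind_return graded_bind_Suc)

lemma chains_eq:
  "up_chains es x = image_mset (\<lambda>fs. (length fs, exchanges x fs)) (filter_mset (upward x) (mset (subseqs es)))"
proof (induction es x rule: up_chains.induct)
  case (2 a b es x)
  have "filter_mset (upward x) (image_mset ((#) (a, b)) (mset (subseqs es))) =
    (if x a < x b then image_mset ((#) (a, b)) (filter_mset (upward (exchange x a b)) (mset (subseqs es))) else {#})"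
    by (auto simp: filter_mset_image_mset)
  then show ?case
    using 2 by (simp add: Let_def multiset.map_comp comp_def)
qed simp

text \<open>Injectivity matters: the Yang--Baxter equation fails for words with repeated
  entries.\<close>

definition chain_equiv :: "(nat \<times> nat) list \<Rightarrow> (nat \<times> nat) list \<Rightarrow> bool" (infix \<open>\<approx>\<close> 50) where
  "es \<approx> fs \<longleftrightarrow> (\<forall>x. inj x \<longrightarrow> up_chains es x = up_chains fs x)"

lemma chain_equiv_refl: "es \<approx> es"
  by (simp add: chain_equiv_def)

lemma chain_equiv_trans [trans]: "es \<approx> fs \<Longrightarrow> fs \<approx> gs \<Longrightarrow> es \<approx> gs"
  by (simp add: chain_equiv_def)

lemma chain_equiv_append_right: "es \<approx> fs \<Longrightarrow> es @ gs \<approx> fs @ gs"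
  by (simp add: chain_equiv_def chains_append)

lemma chain_equiv_append_left: "es \<approx> fs \<Longrightarrow> gs @ es \<approx> gs @ fs"
proof (induction gs)
  case (Cons e gs)
  obtain a b where "e = (a, b)" by fastforce
  then show ?case
    using Cons by (auto simp: chain_equiv_def exchange_inj)
qed simp

lemma chain_equiv_context:
  assumes "es \<approx> fs"
  shows "gs @ es @ hs \<approx> gs @ fs @ hs"
  by (intro chain_equiv_append_left chain_equiv_append_right assms)

text \<open>A statement about three entries, which holds for each of their six relative orders. The
  two lists are the two reflection orders of a symmetric group on three letters.\<close>

lemma yang_baxter:
  assumes abc: "a \<noteq> b" "a \<noteq> c" "b \<noteq> c"
  shows "[(a, b), (a, c), (b, c)] \<approx> [(b, c), (a, c), (a, b)]"
  unfolding chain_equiv_def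
proof (intro allI impI)
  fix x :: perm assume x: "inj x"
  define w where "w = (\<lambda>p q r. x(a := p, b := q, c := r))"
  have w_apply: "w p q r a = p" "w p q r b = q" "w p q r c = r" for p q r
    using abc by (auto simp: w_def)
  have w_exchange: "exchange (w p q r) a b = w q p r" "exchange (w p q r) a c = w r q p"
    "exchange (w p q r) b c = w p r q" for p q r
    using abc by (auto simp: w_def exchange_def fun_eq_iff)
  have x_eq: "x = w (x a) (x b) (x c)"
    by (simp add: w_def)
  have "x a \<noteq> x b" "x a \<noteq> x c" "x b \<noteq> x c"
    using x abc by (auto dest: injD)
  then have "up_chains [(a, b), (a, c), (b, c)] (w (x a) (x b) (x c)) =
    up_chains [(b, c), (a, c), (a, b)] (w (x a) (x b) (x c))"
    by (auto simp: w_apply w_exchange)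
  then show "up_chains [(a, b), (a, c), (b, c)] x = up_chains [(b, c), (a, c), (a, b)] x"
    using x_eq by simp
qed

lemma chain_equiv_swap:
  assumes "{a, b} \<inter> {c, d} = {}"
  shows "[(a, b), (c, d)] \<approx> [(c, d), (a, b)]"
proof -
  have "a \<noteq> c" "a \<noteq> d" "b \<noteq> c" "b \<noteq> d"
    using assms by auto
  then show ?thesis
    using exchange_disjoint_commute[OF assms]
    by (auto simp: chain_equiv_def exchange_apply)
qed

lemma chain_equiv_move:
  assumes "\<And>c d. (c, d) \<in> set es \<Longrightarrow> {a, b} \<inter> {c, d} = {}"
  shows "(a, b) # es \<approx> es @ [(a, b)]"
  using assms
proof (induction es)
  case Nil
  then show ?case by (simp add: chain_equiv_refl)
next
  case (Cons e es)
  obtain c d where e: "e = (c, d)" by fastforce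
  have "{a, b} \<inter> {c, d} = {}"
    using Cons.prems[of c d] e by simp
  then have "(a, b) # (c, d) # es \<approx> (c, d) # (a, b) # es"
    using chain_equiv_append_right[OF chain_equiv_swap, of a b c d es] by simp
  also have "(c, d) # (a, b) # es \<approx> (c, d) # es @ [(a, b)]"
    using chain_equiv_append_left[OF Cons.IH, of "[(c, d)]"] Cons.prems by simp
  finally show ?case
    using e by simp
qed

lemma chain_equiv_commute:
  assumes "\<And>a b c d. \<lbrakk>(a, b) \<in> set es; (c, d) \<in> set fs\<rbrakk> \<Longrightarrow> {a, b} \<inter> {c, d} = {}"
  shows "es @ fs \<approx> fs @ es"
  using assms
proof (induction es)
  case Nil
  then show ?case by (simp add: chain_equiv_refl)
next
  case (Cons e es)
  obtain a b where e: "e = (a, b)" by fastforce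
  have "e # es @ fs \<approx> e # fs @ es"
    using chain_equiv_append_left[OF Cons.IH, of "[e]"] Cons.prems by simp
  also have "e # fs @ es \<approx> (fs @ [e]) @ es"
    using chain_equiv_append_right[OF chain_equiv_move, of fs a b es] Cons.prems e by simp
  finally show ?case by simp
qed

abbreviation costar :: "nat \<Rightarrow> nat list \<Rightarrow> (nat \<times> nat) list" where
  "costar e ks \<equiv> map (\<lambda>k. (k, e)) (rev ks)"

text \<open>Each \<open>k\<close> is carried across the pair $(c, e)$ by one application of the
  Yang--Baxter equation; the other exchanges that have to be passed are disjoint.\<close>

lemma costar_star_equiv:
  assumes "distinct (c # e # ks)"
  shows "costar e ks @ [(c, e)] @ star c ks \<approx> star c ks @ [(c, e)] @ costar e ks"
  using assms
proof (induction ks)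
  case Nil
  then show ?case by (simp add: chain_equiv_refl)
next
  case (Cons k ks)
  have d: "distinct (c # e # ks)" "k \<noteq> c" "k \<noteq> e" "k \<notin> set ks"
    using Cons.prems by auto
  have "costar e (k # ks) @ [(c, e)] @ star c (k # ks) = costar e ks @ [(k, e), (c, e), (c, k)] @ star c ks"
    by simp
  also have "\<dots> \<approx> costar e ks @ [(c, k), (c, e), (k, e)] @ star c ks"
    using d yang_baxter[of c k e] by (intro chain_equiv_context) (auto simp: chain_equiv_def)
  also have "\<dots> = (costar e ks @ [(c, k)]) @ [(c, e)] @ ([(k, e)] @ star c ks)"
    by simp
  also have "\<dots> \<approx> ([(c, k)] @ costar e ks) @ [(c, e)] @ ([(k, e)] @ star c ks)"
    using d by (intro chain_equiv_append_right chain_equiv_commute) auto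
  also have "\<dots> \<approx> ([(c, k)] @ costar e ks) @ [(c, e)] @ (star c ks @ [(k, e)])"
    using d by (intro chain_equiv_append_left chain_equiv_commute) auto
  also have "\<dots> = [(c, k)] @ (costar e ks @ [(c, e)] @ star c ks) @ [(k, e)]"
    by simp
  also have "\<dots> \<approx> [(c, k)] @ (star c ks @ [(c, e)] @ costar e ks) @ [(k, e)]"
    by (intro chain_equiv_context Cons.IH d)
  also have "\<dots> = star c (k # ks) @ [(c, e)] @ costar e (k # ks)"
    by simp
  finally show ?case .
qed

text \<open>The star at \<open>c\<close> and the star at \<open>i\<close> scan the same positions.
  They can be interchanged if the exchange between the two centres is moved from the beginning to
  the end.\<close>

lemma star_star_equiv:
  assumes "distinct (c # i # ls)"
  shows "[(c, i)] @ star c ls @ star i ls \<approx> star i ls @ star c ls @ [(c, i)]"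
  using assms
proof (induction ls)
  case Nil
  then show ?case by (simp add: chain_equiv_refl)
next
  case (Cons q ls)
  have d: "distinct (c # i # ls)" "q \<noteq> c" "q \<noteq> i" "q \<notin> set ls"
    using Cons.prems by auto
  have "[(c, i)] @ star c (q # ls) @ star i (q # ls) =
      [(c, i), (c, q)] @ (star c ls @ [(i, q)]) @ star i ls"
    by simp
  also have "\<dots> \<approx> [(c, i), (c, q)] @ ([(i, q)] @ star c ls) @ star i ls"
    using d by (intro chain_equiv_context chain_equiv_commute) auto
  also have "\<dots> = [(c, i), (c, q), (i, q)] @ star c ls @ star i ls"
    by simp
  also have "\<dots> \<approx> [(i, q), (c, q), (c, i)] @ star c ls @ star i ls"
    using d by (intro chain_equiv_append_right yang_baxter) auto
  also have "\<dots> = [(i, q), (c, q)] @ ([(c, i)] @ star c ls @ star i ls)"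
    by simp
  also have "\<dots> \<approx> [(i, q), (c, q)] @ (star i ls @ star c ls @ [(c, i)])"
    by (intro chain_equiv_append_left Cons.IH d)
  also have "\<dots> = [(i, q)] @ ([(c, q)] @ star i ls) @ (star c ls @ [(c, i)])"
    by simp
  also have "\<dots> \<approx> [(i, q)] @ (star i ls @ [(c, q)]) @ (star c ls @ [(c, i)])"
    using d by (intro chain_equiv_context chain_equiv_commute) auto
  also have "\<dots> = star i (q # ls) @ star c (q # ls) @ [(c, i)]"
    by simp
  finally show ?case .
qed

section \<open>Shortcuts as chains\<close>

lemma subseqs_map: "subseqs (map f xs) = map (map f) (subseqs xs)"
  by (induction xs) (auto simp: Let_def)

lemma subseqs_sorted:
  "\<lbrakk>ys \<in> set (subseqs xs); sorted_wrt (<) xs\<rbrakk> \<Longrightarrow> sorted_wrt (<) ys \<and> set ys \<subseteq> set xs"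
  by (induction xs arbitrary: ys) (auto simp: Let_def, fastforce+)

lemma in_subseqs_sorted_iff:
  fixes xs :: "nat list"
  assumes "sorted_wrt (<) xs"
  shows "ys \<in> set (subseqs xs) \<longleftrightarrow> sorted_wrt (<) ys \<and> set ys \<subseteq> set xs"
proof
  assume ys: "sorted_wrt (<) ys \<and> set ys \<subseteq> set xs"
  then have "set ys \<in> set ` set (subseqs xs)"
    by (simp add: subseqs_powset)
  then obtain zs where zs: "zs \<in> set (subseqs xs)" "set zs = set ys"
    by auto
  then have "sorted_wrt (<) zs"
    using subseqs_sorted assms by blast
  then have "zs = ys"
    using ys zs(2) by (intro sorted_distinct_set_unique) (auto simp: strict_sorted_iff)
  then show "ys \<in> set (subseqs xs)"
    using zs(1) by simp
qed (use subseqs_sorted assms in blast)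

text \<open>For sorted \<open>ls\<close>, the sorted lists with entries from \<open>ls\<close> are
  its subsequences.\<close>

definition star_ends :: "nat \<Rightarrow> nat list \<Rightarrow> perm \<Rightarrow> perm set" where
  "star_ends c ls u = {exchanges u (star c qs) | qs. sorted_wrt (<) qs \<and> set qs \<subseteq> set ls \<and> upward u (star c qs)}"

lemma star_moves:
  assumes "distinct (c # qs)" "inj u" "q \<in> set qs"
  shows "exchanges u (star c qs) q \<noteq> u q"
  using assms
proof (induction qs arbitrary: u)
  case (Cons r qs)
  let ?u = "exchange u c r"
  have u: "inj ?u"
    by (rule exchange_inj[OF Cons.prems(2)])
  show ?case
  proof (cases "q = r")
    case True
    have "exchanges ?u (star c qs) r = ?u r"
      using Cons.prems(1) by (intro exchanges_untouched) auto
    moreover have "u c \<noteq> u r"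
      using Cons.prems by (auto dest: injD)
    ultimately show ?thesis
      using True Cons.prems(1) by (simp add: exchange_apply)
  next
    case False
    then have "q \<in> set qs" "q \<noteq> c"
      using Cons.prems by auto
    then have "exchanges ?u (star c qs) q \<noteq> ?u q"
      using Cons.IH[OF _ u] Cons.prems by simp
    moreover have "?u q = u q"
      using False \<open>q \<noteq> c\<close> by (simp add: exchange_apply)
    ultimately show ?thesis by simp
  qed
qed simp

text \<open>Each position of a star is moved exactly once, so the end determines the star.\<close>

lemma star_support:
  assumes "distinct (c # qs)" "inj u"
  shows "set qs = {q. q \<noteq> c \<and> exchanges u (star c qs) q \<noteq> u q}"
  using star_moves[OF assms] exchanges_untouched[of "star c qs" _ u] assms(1) by fastforce

text \<open>A chain within a star is determined by its end and is a shortest path to it.\<close>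

lemma chains_star:
  assumes u: "u permutes {1..n}" and ls: "sorted_wrt (<) (c # ls)" "set (c # ls) \<subseteq> {1..n}"
  shows "up_chains (star c ls) u = image_mset (\<lambda>p. (bruhat_dist n u p, p)) (mset_set (star_ends c ls u))"
    and "finite (star_ends c ls u)"
proof -
  let ?A = "{qs \<in> set (subseqs ls). upward u (star c qs)}"
  let ?G = "\<lambda>qs. exchanges u (star c qs)"
  have A: "sorted_wrt (<) (c # qs) \<and> set (c # qs) \<subseteq> {1..n} \<and> upward u (star c qs)" if "qs \<in> ?A" for qs
    using that subseqs_sorted[of qs ls] ls by auto
  have "inj_on ?G ?A"
  proof (rule inj_onI)
    fix qs rs assume *: "qs \<in> ?A" "rs \<in> ?A" "?G qs = ?G rs"
    have s: "sorted_wrt (<) (c # qs)" "sorted_wrt (<) (c # rs)"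
      using A *(1,2) by blast+
    then have d: "distinct (c # qs)" "distinct (c # rs)"
      using strict_sorted_iff by blast+
    have "set qs = set rs"
      using star_support[OF d(1) permutes_inj[OF u]] star_support[OF d(2) permutes_inj[OF u]] *(3)
      by simp
    then show "qs = rs"
      using s by (intro sorted_distinct_set_unique) (auto simp: strict_sorted_iff)
  qed
  then have "image_mset ?G (mset_set ?A) = mset_set (?G ` ?A)"
    by (rule image_mset_mset_set)
  also have ends: "?G ` ?A = star_ends c ls u"
  proof -
    have "sorted_wrt (<) ls"
      using ls by simp
    then show ?thesis
      unfolding star_ends_def in_subseqs_sorted_iff[OF \<open>sorted_wrt (<) ls\<close>] by blast
  qed
  finally have G: "image_mset ?G (mset_set ?A) = mset_set (star_ends c ls u)" .
  have d: "distinct (subseqs ls)"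
    using distinct_set_subseqs[of ls] ls(1) by (simp add: distinct_map strict_sorted_iff)
  have "up_chains (star c ls) u = image_mset (\<lambda>qs. (length qs, ?G qs)) (filter_mset (\<lambda>qs. upward u (star c qs)) (mset (subseqs ls)))"
    by (simp add: chains_eq subseqs_map filter_mset_image_mset multiset.map_comp comp_def)
  also have "mset (subseqs ls) = mset_set (set (subseqs ls))"
    using d by (simp add: mset_set_set)
  also have "filter_mset (\<lambda>qs. upward u (star c qs)) \<dots> = mset_set ?A"
    by (simp add: filter_mset_mset_set)
  also have "image_mset (\<lambda>qs. (length qs, ?G qs)) (mset_set ?A) =
      image_mset (\<lambda>qs. (bruhat_dist n u (?G qs), ?G qs)) (mset_set ?A)"
    using A star_dist[OF u] by (intro image_mset_cong) simp
  also have "\<dots> = image_mset (\<lambda>p. (bruhat_dist n u p, p)) (image_mset ?G (mset_set ?A))"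
    by (simp add: multiset.map_comp comp_def)
  finally show "up_chains (star c ls) u = image_mset (\<lambda>p. (bruhat_dist n u p, p)) (mset_set (star_ends c ls u))"
    by (simp only: G)
  show "finite (star_ends c ls u)"
    unfolding ends[symmetric] by simp
qed

lemma star_ends_first_value:
  assumes u: "u permutes {1..n}" and n: "1 \<le> n"
  shows "{p \<in> star_ends 1 [2..<Suc n] u. bruhat_le n p v \<and> p 1 = v 1} = fiber_shortcuts n (\<lambda>x. x 1) u v"
proof (rule Set.set_eqI)
  fix p
  have "sorted_wrt (<) (1 # qs) \<and> set qs \<subseteq> {2..n} \<longleftrightarrow> sorted_wrt (<) qs \<and> set qs \<subseteq> set [2..<Suc n]" for qs
    by fastforce
  then show "p \<in> {p \<in> star_ends 1 [2..<Suc n] u. bruhat_le n p v \<and> p 1 = v 1} \<longleftrightarrow>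
      p \<in> fiber_shortcuts n (\<lambda>x. x 1) u v"
    unfolding first_value_shortcuts_iff[OF u n] star_ends_def by blast
qed

lemma first_value_shortcut_mset:
  assumes u: "u permutes {1..n}" and n: "1 \<le> n"
  shows "shortcut_mset n (\<lambda>x. x 1) u v =
    filter_mset (\<lambda>(d, p). bruhat_le n p v \<and> p 1 = v 1) (up_chains (star 1 [2..<Suc n]) u)"
proof -
  have ls: "sorted_wrt (<) (1 # [2..<Suc n])" "set (1 # [2..<Suc n]) \<subseteq> {1..n}"
    using n by (auto simp: sorted_wrt_upt simp del: upt_Suc)
  show ?thesis
    unfolding chains_star(1)[OF u ls] filter_mset_image_mset shortcut_mset_def star_ends_first_value[OF u n, symmetric]
    using chains_star(2)[OF u ls] by (simp add: filter_mset_mset_set del: upt_Suc)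
qed

lemma chains_le:
  assumes "(d, p) \<in># up_chains es x" "x permutes {1..n}" "set es \<subseteq> position_pairs n"
  shows "bruhat_le n x p"
  using assms
proof (induction es x arbitrary: d rule: up_chains.induct)
  case (1 x)
  then show ?case by (simp add: bruhat_le_refl)
next
  case (2 a b es x)
  have ab: "a \<in> {1..n}" "b \<in> {1..n}" "a < b"
    using 2(5) by (auto simp: position_pairs_def)
  consider "(d, p) \<in># up_chains es x" | d' where "x a < x b" "(d', p) \<in># up_chains es (exchange x a b)"
    using 2(3) by (auto split: if_splits)
  then show ?case
  proof cases
    case 1
    then show ?thesis using 2 by auto
  next
    case (2 d')
    then have "bruhat_le n x (exchange x a b)"
      using "2.prems"(2) ab by (intro bruhat_edge_le bruhat_edgeI)
    moreover have "bruhat_le n (exchange x a b) p"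
      using "2.IH"(2)[OF 2] exchange_permutes[OF "2.prems"(2) ab(1,2)] "2.prems"(3) by simp
    ultimately show ?thesis
      by (rule bruhat_le_trans)
  qed
qed

lemma chains_untouched:
  assumes "(d, p) \<in># up_chains es x" "\<And>a b. (a, b) \<in> set es \<Longrightarrow> q \<noteq> a \<and> q \<noteq> b"
  shows "p q = x q"
  using assms
proof (induction es x arbitrary: d rule: up_chains.induct)
  case (2 a b es x)
  have eq: "exchange x a b q = x q"
    using 2(4)[of a b] by (simp add: exchange_apply)
  have es: "q \<noteq> r \<and> q \<noteq> s" if "(r, s) \<in> set es" for r s
    by (rule "2.prems"(2)) (use that in simp)
  consider "(d, p) \<in># up_chains es x" | d' where "x a < x b" "(d', p) \<in># up_chains es (exchange x a b)"
    using 2(3) by (auto split: if_splits)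
  then show ?case
    using "2.IH"(1)[OF _ es] "2.IH"(2)[OF _ _ es] eq by cases simp_all
qed simp

lemma chains_reverse_complement:
  assumes "x permutes {1..n}" "set es \<subseteq> {1..n} \<times> {1..n}"
  shows "image_mset (map_prod id (reverse_complement n)) (up_chains es (reverse_complement n x)) =
    up_chains (map (\<lambda>(a, b). (reversal n b, reversal n a)) es) x"
  using assms
proof (induction es arbitrary: x)
  case Nil
  have "reverse_complement n (reverse_complement n x) = x"
    by (simp add: fun_eq_iff reverse_complement_apply)
  then show ?case by simp
next
  case (Cons e es)
  obtain a b where e: "e = (a, b)" by fastforce
  let ?y = "exchange x (reversal n b) (reversal n a)"
  have ab: "reversal n a \<in> {1..n}" "reversal n b \<in> {1..n}"
    using Cons.prems(2) e by (simp_all only: reversal_in_iff) auto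
  then have y: "?y permutes {1..n}"
    using Cons.prems(1) by (intro exchange_permutes)
  have eq: "exchange (reverse_complement n x) a b = reverse_complement n ?y"
    by (simp add: reverse_complement_exchange)
  have "x (reversal n a) \<in> {1..n}" "x (reversal n b) \<in> {1..n}"
    using ab permutes_in_image[OF Cons.prems(1)] by blast+
  then have less: "reverse_complement n x a < reverse_complement n x b \<longleftrightarrow> x (reversal n b) < x (reversal n a)"
    unfolding reverse_complement_apply by (rule reversal_less_iff)
  have comm: "image_mset (map_prod id (reverse_complement n)) (image_mset (map_prod Suc id) M) =
    image_mset (map_prod Suc id) (image_mset (map_prod id (reverse_complement n)) M)" for M
    by (simp add: multiset.map_comp comp_def map_prod_def case_prod_unfold)
  have es: "set es \<subseteq> {1..n} \<times> {1..n}"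
    using Cons.prems(2) by simp
  show ?case
    by (simp only: e up_chains.simps list.map prod.case less eq image_mset_union image_mset_empty comm
        if_distrib[of "image_mset _"] Cons.IH[OF Cons.prems(1) es] Cons.IH[OF y es])
qed

lemma star_reversal:
  assumes "1 \<le> n"
  shows "map (\<lambda>(a, b). (reversal n b, reversal n a)) (star 1 [2..<Suc n]) = costar n [1..<n]"
  using assms by (intro nth_equalityI) (auto simp: reversal_def rev_nth simp del: upt_Suc)

lemma star_position_pairs_upt:
  "set (star 1 [2..<Suc n]) \<subseteq> position_pairs n" "set (costar n [1..<n]) \<subseteq> position_pairs n"
  by (auto simp: position_pairs_def)

abbreviation last_value :: "nat \<Rightarrow> perm \<Rightarrow> nat" where
  "last_value n \<equiv> \<lambda>x. reverse_complement n x 1"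

lemma last_value_eq_iff:
  assumes "1 \<le> n"
  shows "last_value n x = last_value n v \<longleftrightarrow> x n = v n"
proof -
  have "reversal n 1 = n"
    using assms by (simp add: reversal_def)
  then show ?thesis
    by (simp only: reverse_complement_apply reversal_eq_iff)
qed

lemma last_value_shortcut_mset:
  assumes u: "u permutes {1..n}" and v: "v permutes {1..n}" and n: "1 \<le> n"
  shows "shortcut_mset n (last_value n) u v =
    filter_mset (\<lambda>(d, p). bruhat_le n p v \<and> p n = v n) (up_chains (costar n [1..<n]) u)"
proof -
  interpret bruhat_involution n "reverse_complement n"
    by (rule reverse_complement_involution)
  let ?\<rho> = "reverse_complement n"
  have "(bruhat_le n p (?\<rho> v) \<and> p 1 = ?\<rho> v 1) \<longleftrightarrow> (bruhat_le n (?\<rho> p) v \<and> ?\<rho> p n = v n)"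
    if "(d, p) \<in># up_chains (star 1 [2..<Suc n]) (?\<rho> u)" for d p
  proof -
    have p: "p permutes {1..n}"
      using chains_le[OF that maps[OF u] star_position_pairs_upt(1)] bruhat_le_permutes by blast
    have "p 1 = ?\<rho> v 1 \<longleftrightarrow> last_value n (?\<rho> p) = last_value n v"
      by (simp only: invol[OF p])
    then show ?thesis
      using le_iff[OF p maps[OF v]] last_value_eq_iff[OF n] by (simp only: invol[OF v] le_iff[OF p maps[OF v], symmetric])
  qed
  then have "filter_mset (\<lambda>(d, p). bruhat_le n p (?\<rho> v) \<and> p 1 = ?\<rho> v 1) (up_chains (star 1 [2..<Suc n]) (?\<rho> u)) =
    filter_mset (\<lambda>(d, p). bruhat_le n (?\<rho> p) v \<and> ?\<rho> p n = v n) (up_chains (star 1 [2..<Suc n]) (?\<rho> u))"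
    by (intro filter_mset_cong) auto
  then have "shortcut_mset n (last_value n) u v = image_mset (map_prod id ?\<rho>)
      (filter_mset (\<lambda>(d, p). bruhat_le n (?\<rho> p) v \<and> ?\<rho> p n = v n) (up_chains (star 1 [2..<Suc n]) (?\<rho> u)))"
    using shortcut_mset_image[OF u v, of "\<lambda>x. x 1"] first_value_shortcut_mset[OF maps[OF u] n] by simp
  also have "\<dots> = filter_mset (\<lambda>(d, p). bruhat_le n p v \<and> p n = v n)
      (image_mset (map_prod id ?\<rho>) (up_chains (star 1 [2..<Suc n]) (?\<rho> u)))"
    by (simp add: filter_mset_image_mset case_prod_unfold)
  also have "image_mset (map_prod id ?\<rho>) (up_chains (star 1 [2..<Suc n]) (?\<rho> u)) = up_chains (costar n [1..<n]) u"
    unfolding star_reversal[OF n, symmetric] using n by (intro chains_reverse_complement u) auto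
  finally show ?thesis .
qed

lemma top_position_shortcut_mset:
  assumes u: "u permutes {1..n}" and v: "v permutes {1..n}" and ij: "i \<in> {1..n}" "j \<in> {1..n}" "i < j"
    and top: "u j = n" "v i = n"
  shows "shortcut_mset n (top_position n) u v =
    image_mset (map_prod Suc (\<lambda>y. exchange y i j))
      (filter_mset (\<lambda>(d, y). bruhat_le n (exchange y i j) v) (up_chains (star i [Suc i..<j]) u))"
proof -
  have ls: "sorted_wrt (<) (i # [Suc i..<j])" "set (i # [Suc i..<j]) \<subseteq> {1..n}"
    using ij by (auto simp: sorted_wrt_upt)
  let ?S = "star_ends i [Suc i..<j] u" and ?h = "\<lambda>y. exchange y i j"
  have snoc: "exchanges u (star i (qs @ [j])) = ?h (exchanges u (star i qs))"
    "sorted_wrt (<) (i # qs @ [j])" "upward u (star i (qs @ [j]))"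
    if qs: "sorted_wrt (<) qs" "set qs \<subseteq> set [Suc i..<j]" "upward u (star i qs)" for qs
  proof -
    let ?y = "exchanges u (star i qs)"
    show "exchanges u (star i (qs @ [j])) = ?h ?y"
      by (simp add: exchanges_append)
    show "sorted_wrt (<) (i # qs @ [j])"
      using qs ij(3) by (fastforce simp: sorted_wrt_append)
    have "?y j = u j"
      using qs(2) ij(3) by (intro exchanges_untouched) auto
    moreover have y: "?y permutes {1..n}"
      using qs(2) ij by (intro exchanges_permutes u) (fastforce simp: position_pairs_def)
    moreover have "?y i \<le> n"
      using permutes_in_image[OF y, of i] ij(1) by simp
    moreover have "?y i \<noteq> ?y j"
      using permutes_eq_iff[OF y] ij(3) by simp
    ultimately have "?y i < ?y j"
      using top by simp
    then show "upward u (star i (qs @ [j]))"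
      using qs(3) by (simp add: upward_append)
  qed
  have S_iff: "fiber_shortcuts n (top_position n) u v = ?h ` {y \<in> ?S. bruhat_le n (?h y) v}"
  proof (intro equalityI subsetI)
    fix p assume "p \<in> fiber_shortcuts n (top_position n) u v"
    then obtain qs where qs: "bruhat_le n p v" "sorted_wrt (<) (i # qs @ [j])" "upward u (star i (qs @ [j]))"
      "p = exchanges u (star i (qs @ [j]))"
      using top_position_shortcuts_iff[OF u v ij top] by blast
    have "sorted_wrt (<) qs" "set qs \<subseteq> set [Suc i..<j]" "upward u (star i qs)"
      using qs(2,3) by (fastforce simp: sorted_wrt_append upward_append)+
    then have "exchanges u (star i qs) \<in> ?S" "p = ?h (exchanges u (star i qs))"
      using qs(4) snoc(1) by (auto simp: star_ends_def)
    then show "p \<in> ?h ` {y \<in> ?S. bruhat_le n (?h y) v}"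
      using qs(1) by blast
  next
    fix p assume "p \<in> ?h ` {y \<in> ?S. bruhat_le n (?h y) v}"
    then obtain qs where qs: "p = ?h (exchanges u (star i qs))" "sorted_wrt (<) qs"
      "set qs \<subseteq> set [Suc i..<j]" "upward u (star i qs)" "bruhat_le n p v"
      by (auto simp: star_ends_def)
    then show "p \<in> fiber_shortcuts n (top_position n) u v"
      unfolding top_position_shortcuts_iff[OF u v ij top] using snoc[OF qs(2-4)] by metis
  qed
  have dist: "bruhat_dist n u (?h y) = Suc (bruhat_dist n u y)" if "y \<in> ?S" for y
  proof -
    from that obtain qs where qs: "y = exchanges u (star i qs)" "sorted_wrt (<) qs"
      "set qs \<subseteq> set [Suc i..<j]" "upward u (star i qs)"
      unfolding star_ends_def by blast
    have "set (i # qs @ [j]) \<subseteq> {1..n}" "set (i # qs) \<subseteq> {1..n}"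
      using qs(3) ij by fastforce+
    moreover have "sorted_wrt (<) (i # qs)"
      using snoc(2)[OF qs(2-4)] by (simp add: sorted_wrt_append)
    ultimately show ?thesis
      using star_dist[OF u snoc(2)[OF qs(2-4)] _ snoc(3)[OF qs(2-4)]] star_dist[OF u _ _ qs(4)]
      unfolding snoc(1)[OF qs(2-4)] qs(1) by simp
  qed
  have fin: "finite ?S"
    by (rule chains_star(2)[OF u ls])
  have inj: "inj_on ?h {y \<in> ?S. bruhat_le n (?h y) v}"
    by (rule inj_on_inverseI[of _ ?h]) simp
  show ?thesis
    unfolding chains_star(1)[OF u ls] filter_mset_image_mset shortcut_mset_def S_iff
      image_mset_mset_set[OF inj, symmetric]
    using fin dist by (auto simp: filter_mset_mset_set multiset.map_comp intro!: image_mset_cong)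
qed

section \<open>Double shortcuts commute\<close>

lemma graded_bind_cong:
  "(\<And>d p. (d, p) \<in># M \<Longrightarrow> k p = k' p) \<Longrightarrow> graded_bind M k = graded_bind M k'"
  unfolding graded_bind_def by (intro arg_cong[of _ _ sum_mset] image_mset_cong) auto

lemma filter_graded_bind:
  "filter_mset (\<lambda>(d, p). P p) (graded_bind M k) = graded_bind M (\<lambda>p. filter_mset (\<lambda>(d, p). P p) (k p))"
  by (induction M) (auto simp: graded_bind_def filter_mset_image_mset case_prod_unfold)

lemma graded_bind_filter:
  "graded_bind (filter_mset (\<lambda>(d, p). P p) M) k = graded_bind M (\<lambda>p. if P p then k p else {#})"
  by (induction M) (auto simp: graded_bind_def)

lemma graded_bind_map_Suc:
  "graded_bind (image_mset (map_prod Suc h) M) k = image_mset (map_prod Suc id) (graded_bind M (\<lambda>p. k (h p)))"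
  by (induction M) (auto simp: graded_bind_def multiset.map_comp intro!: image_mset_cong)

lemma map_Suc_graded_bind:
  "graded_bind M (\<lambda>p. image_mset (map_prod Suc h) (k p)) = image_mset (map_prod Suc h) (graded_bind M k)"
  by (induction M) (auto simp: graded_bind_def multiset.map_comp intro!: image_mset_cong)

lemma graded_bind_return_right: "graded_bind M (\<lambda>p. {#(0, p)#}) = M"
  by (induction M) (auto simp: graded_bind_def)

lemma filter_mset_none: "(\<And>x. x \<in># M \<Longrightarrow> \<not> P x) \<Longrightarrow> filter_mset P M = {#}"
  by (induction M) auto

lemma upt_split_at: "\<lbrakk>a \<le> b; b < c\<rbrakk> \<Longrightarrow> [a..<c] = [a..<b] @ b # [Suc b..<c]"
  using upt_add_eq_append[of a b "c - b"] upt_conv_Cons[of b c] by simp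

lemma chains_permutes:
  assumes "(d, p) \<in># up_chains es x" "x permutes {1..n}" "set es \<subseteq> position_pairs n"
  shows "p permutes {1..n}"
  using chains_le[OF assms] by (rule bruhat_le_permutes)

lemma filter_chains_snoc:
  assumes "\<And>d y. \<lbrakk>(d, y) \<in># up_chains es p; y a < y b\<rbrakk> \<Longrightarrow> \<not> P (exchange y a b)"
  shows "filter_mset (\<lambda>(d, y). P y) (up_chains (es @ [(a, b)]) p) = filter_mset (\<lambda>(d, y). P y) (up_chains es p)"
proof -
  have "filter_mset (\<lambda>(d, y). P y) (up_chains (es @ [(a, b)]) p) =
      graded_bind (up_chains es p) (\<lambda>y. filter_mset (\<lambda>(d, y). P y) (up_chains [(a, b)] y))"
    by (simp add: chains_append filter_graded_bind)
  also have "\<dots> = graded_bind (up_chains es p) (\<lambda>y. filter_mset (\<lambda>(d, y). P y) {#(0, y)#})"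
    using assms by (intro graded_bind_cong) auto
  also have "\<dots> = filter_mset (\<lambda>(d, y). P y) (graded_bind (up_chains es p) (\<lambda>y. {#(0, y)#}))"
    by (simp only: filter_graded_bind)
  finally show ?thesis
    by (simp only: graded_bind_return_right)
qed

text \<open>The condition on the intermediate element \<open>p\<close> can be moved to the final
  element \<open>b\<close>: the entry at \<open>a\<close> cannot change any more within the fiber.
  For the same reason the exchange $(1, n)$, which moves the entry at \<open>a\<close>, may be
  dropped from the second list. What remains is a single list of exchanges.\<close>

lemma bind_two_stars:
  assumes u: "u permutes {1..n}" and pairs: "set es \<subseteq> position_pairs n" "set E \<subseteq> position_pairs n"
    and convex: "\<And>p b. \<lbrakk>bruhat_le n p b; bruhat_le n b v; p a = v a\<rbrakk> \<Longrightarrow> b a = v a"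
    and E: "\<And>r s. (r, s) \<in> set E \<Longrightarrow> a \<noteq> r \<and> a \<noteq> s" and a: "a \<in> {1, n}"
    and n: "1 < n"
  shows "graded_bind (filter_mset (\<lambda>(d, p). bruhat_le n p v \<and> p a = v a) (up_chains es u))
      (\<lambda>p. filter_mset (\<lambda>(d, b). bruhat_le n b v \<and> b c = v c) (up_chains (E @ [(1, n)]) p)) =
    filter_mset (\<lambda>(d, b). bruhat_le n b v \<and> b a = v a \<and> b c = v c) (up_chains (es @ E) u)"
proof -
  have "(if bruhat_le n p v \<and> p a = v a
        then filter_mset (\<lambda>(d, b). bruhat_le n b v \<and> b c = v c) (up_chains (E @ [(1, n)]) p) else {#}) =
      filter_mset (\<lambda>(d, b). bruhat_le n b v \<and> b a = v a \<and> b c = v c) (up_chains E p)"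
    if p: "(d, p) \<in># up_chains es u" for d p
  proof -
    have perm: "p permutes {1..n}"
      by (rule chains_permutes[OF p u pairs(1)])
    have fixed: "b a = p a" if "(d, b) \<in># up_chains E p" for d b
      using that E by (rule chains_untouched)
    have le: "bruhat_le n p b" if "(d, b) \<in># up_chains E p" for d b
      using that perm pairs(2) by (rule chains_le)
    show ?thesis
    proof (cases "bruhat_le n p v \<and> p a = v a")
      case True
      have pairs': "set (E @ [(1, n)]) \<subseteq> position_pairs n"
        using pairs(2) n by (auto simp: position_pairs_def)
      have "filter_mset (\<lambda>(d, b). bruhat_le n b v \<and> b c = v c) (up_chains (E @ [(1, n)]) p) =
          filter_mset (\<lambda>(d, b). bruhat_le n b v \<and> b a = v a \<and> b c = v c) (up_chains (E @ [(1, n)]) p)"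
        using convex[OF chains_le[OF _ perm pairs']] True by (intro filter_mset_cong) auto
      also have "\<dots> = filter_mset (\<lambda>(d, b). bruhat_le n b v \<and> b a = v a \<and> b c = v c) (up_chains E p)"
      proof (rule filter_chains_snoc)
        fix d y assume y: "(d, y) \<in># up_chains E p" "y 1 < y n"
        then have "exchange y 1 n a \<noteq> y a"
          using a by (auto simp: exchange_apply)
        then show "\<not> (bruhat_le n (exchange y 1 n) v \<and> exchange y 1 n a = v a \<and> exchange y 1 n c = v c)"
          using fixed[OF y(1)] True by simp
      qed
      finally show ?thesis
        using True by simp
    next
      case False
      have "\<not> (bruhat_le n b v \<and> b a = v a \<and> b c = v c)" if "(d, b) \<in># up_chains E p" for d b
        using False fixed[OF that] bruhat_le_trans[OF le[OF that]] by auto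
      then have "filter_mset (\<lambda>(d, b). bruhat_le n b v \<and> b a = v a \<and> b c = v c) (up_chains E p) = {#}"
        by (intro filter_mset_none) auto
      then show ?thesis
        by (simp only: if_not_P[OF False])
    qed
  qed
  then show ?thesis
    unfolding graded_bind_filter chains_append filter_graded_bind by (rule graded_bind_cong)
qed

text \<open>Both multisets count chains to the same ends, and the two lists of exchanges are those
  of \<open>costar_star_equiv\<close>.\<close>

lemma first_last_commute:
  assumes u: "u permutes {1..n}" and v: "v permutes {1..n}" and n: "1 < n"
  shows "graded_bind (shortcut_mset n (\<lambda>x. x 1) u v) (\<lambda>p. shortcut_mset n (last_value n) p v) =
    graded_bind (shortcut_mset n (last_value n) u v) (\<lambda>p. shortcut_mset n (\<lambda>x. x 1) p v)"
proof -
  have n1: "1 \<le> n"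
    using n by simp
  interpret F: bruhat_fibration n "\<lambda>x. x 1"
    by (rule first_value_fibration[OF n1])
  interpret R: bruhat_involution n "reverse_complement n"
    by (rule reverse_complement_involution)
  interpret L: bruhat_fibration n "last_value n"
    by (rule R.fibration_comp[OF F.bruhat_fibration_axioms])
  have split: "star 1 [2..<Suc n] = star 1 [2..<n] @ [(1, n)]" "costar n [1..<n] = costar n [2..<n] @ [(1, n)]"
    using n upt_conv_Cons[of 1 n] by (auto simp: numeral_2_eq_2)
  note pairs = star_position_pairs_upt[of n]
  have pairs': "set (star 1 [2..<n]) \<subseteq> position_pairs n" "set (costar n [2..<n]) \<subseteq> position_pairs n"
    by (auto simp: position_pairs_def)
  have perm: "p permutes {1..n}" if "p \<in> fiber_shortcuts n f u v" for p f
    using fiber_shortcutsD[OF that] bruhat_le_permutes by blast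
  have fl: "graded_bind (shortcut_mset n (\<lambda>x. x 1) u v) (\<lambda>p. shortcut_mset n (last_value n) p v) =
    filter_mset (\<lambda>(d, b). bruhat_le n b v \<and> b 1 = v 1 \<and> b n = v n)
      (up_chains (star 1 [2..<Suc n] @ costar n [2..<n]) u)"
  proof -
    have "graded_bind (shortcut_mset n (\<lambda>x. x 1) u v) (\<lambda>p. shortcut_mset n (last_value n) p v) =
      graded_bind (shortcut_mset n (\<lambda>x. x 1) u v) (\<lambda>p. filter_mset (\<lambda>(d, p). bruhat_le n p v \<and> p n = v n) (up_chains (costar n [1..<n]) p))"
      using perm by (intro graded_bind_cong last_value_shortcut_mset v n1)
        (auto simp: shortcut_mset_def finite_fiber_shortcuts)
    also have "\<dots> = filter_mset (\<lambda>(d, b). bruhat_le n b v \<and> b 1 = v 1 \<and> b n = v n)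
        (up_chains (star 1 [2..<Suc n] @ costar n [2..<n]) u)"
      unfolding first_value_shortcut_mset[OF u n1] split(2)
    proof (rule bind_two_stars[OF u pairs(1) pairs'(2)])
      show "b 1 = v 1" if "bruhat_le n p b" "bruhat_le n b v" "p 1 = v 1" for p b
        using that by (rule F.top_fiber_upward)
    qed (use n in auto)
    finally show ?thesis .
  qed
  have lf: "graded_bind (shortcut_mset n (last_value n) u v) (\<lambda>p. shortcut_mset n (\<lambda>x. x 1) p v) =
    filter_mset (\<lambda>(d, b). bruhat_le n b v \<and> b n = v n \<and> b 1 = v 1)
      (up_chains (costar n [1..<n] @ star 1 [2..<n]) u)"
  proof -
    have "graded_bind (shortcut_mset n (last_value n) u v) (\<lambda>p. shortcut_mset n (\<lambda>x. x 1) p v) =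
      graded_bind (shortcut_mset n (last_value n) u v) (\<lambda>p. filter_mset (\<lambda>(d, p). bruhat_le n p v \<and> p 1 = v 1) (up_chains (star 1 [2..<Suc n]) p))"
      using perm by (intro graded_bind_cong first_value_shortcut_mset n1)
        (auto simp: shortcut_mset_def finite_fiber_shortcuts)
    also have "\<dots> = filter_mset (\<lambda>(d, b). bruhat_le n b v \<and> b n = v n \<and> b 1 = v 1)
        (up_chains (costar n [1..<n] @ star 1 [2..<n]) u)"
      unfolding last_value_shortcut_mset[OF u v n1] split(1)
    proof (rule bind_two_stars[OF u pairs(2) pairs'(1)])
      show "b n = v n" if "bruhat_le n p b" "bruhat_le n b v" "p n = v n" for p b
        using L.top_fiber_upward[OF that(1,2)] that(3) by (simp only: last_value_eq_iff[OF n1])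
    qed (use n in auto)
    finally show ?thesis .
  qed
  have "distinct (1 # n # [2..<n])"
    using n by auto
  then have "up_chains (costar n [1..<n] @ star 1 [2..<n]) u = up_chains (star 1 [2..<Suc n] @ costar n [2..<n]) u"
    using costar_star_equiv[of 1 n "[2..<n]"] permutes_inj[OF u] unfolding split chain_equiv_def by simp
  then show ?thesis
    unfolding fl lf by (simp add: conj_commute)
qed

text \<open>An exchange can be moved from the beginning of a list to its end at the price of
  relabelling two positions.\<close>

lemma chains_exchange:
  "up_chains es (exchange y i j) =
    image_mset (map_prod id (\<lambda>z. exchange z i j))
      (up_chains (map (map_prod (transpose i j) (transpose i j)) es) y)"
proof (induction es arbitrary: y)
  case (Cons e es)
  obtain a b where e: "e = (a, b)" by fastforce
  let ?t = "transpose i j"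
  have eq: "exchange (exchange y i j) a b = exchange (exchange y (?t a) (?t b)) i j"
    by (auto simp: fun_eq_iff exchange_apply transpose_def)
  have val: "exchange y i j q = y (?t q)" for q
    by (auto simp: exchange_apply transpose_def)
  have comm: "image_mset (map_prod Suc id) (image_mset (map_prod id (\<lambda>z. exchange z i j)) M) =
    image_mset (map_prod id (\<lambda>z. exchange z i j)) (image_mset (map_prod Suc id) M)" for M
    by (simp add: multiset.map_comp comp_def map_prod_def case_prod_unfold)
  show ?case
    by (simp only: e up_chains.simps list.map map_prod_simp val[of a] val[of b] eq Cons.IH comm image_mset_union
        image_mset_empty if_distrib[of "image_mset _"])
qed simp

text \<open>Exchanging position 1 with the position of the largest value brings that value to the front, where
  it stays. Chains that use this exchange therefore end outside the fiber.\<close>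

lemma filter_star_skip_top:
  assumes p: "p permutes {1..n}" and j: "j \<in> {2..n}" "p j = n" and v: "v permutes {1..n}" "v 1 \<noteq> n"
  shows "filter_mset (\<lambda>(d, b). bruhat_le n b v \<and> b 1 = v 1) (up_chains (star 1 [2..<Suc n]) p) =
    filter_mset (\<lambda>(d, b). bruhat_le n b v \<and> b 1 = v 1) (up_chains (star 1 ([2..<j] @ [Suc j..<Suc n])) p)"
proof -
  let ?X = "star 1 [2..<j]" and ?Y = "star 1 [Suc j..<Suc n]"
  let ?P = "\<lambda>b. bruhat_le n b v \<and> b 1 = v 1"
  have "[2..<Suc n] = [2..<j] @ j # [Suc j..<Suc n]"
    using j(1) by (intro upt_split_at) auto
  then have L: "star 1 [2..<Suc n] = ?X @ (1, j) # ?Y"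
    by (simp only: map_append list.map)
  have pairs: "set ?X \<subseteq> position_pairs n" "set ?Y \<subseteq> position_pairs n"
    using j(1) by (auto simp: position_pairs_def)
  have "filter_mset (\<lambda>(d, b). ?P b) (up_chains ((1, j) # ?Y) y) = filter_mset (\<lambda>(d, b). ?P b) (up_chains ?Y y)"
    if y: "(d, y) \<in># up_chains ?X p" for d y
  proof -
    have yp: "y permutes {1..n}"
      by (rule chains_permutes[OF y p pairs(1)])
    have "y j = p j"
      using y by (rule chains_untouched) (use j in auto)
    then have ex: "exchange y 1 j 1 = n"
      using j by (simp add: exchange_apply)
    have exp: "exchange y 1 j permutes {1..n}"
      using j by (intro exchange_permutes yp) auto
    have "v 1 < n"
      using permutes_in_image[OF v(1), of 1] v(2) j(1) by auto
    have none: "\<not> ?P z" if "(d, z) \<in># up_chains ?Y (exchange y 1 j)" for d z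
      using first_value_mono[OF chains_le[OF that exp pairs(2)]] ex \<open>v 1 < n\<close> by auto
    have "filter_mset (\<lambda>(d, b). ?P b) (image_mset (map_prod Suc id) (up_chains ?Y (exchange y 1 j))) = {#}"
      using none by (intro filter_mset_none) auto
    then show ?thesis by simp
  qed
  then have "graded_bind (up_chains ?X p) (\<lambda>y. filter_mset (\<lambda>(d, b). ?P b) (up_chains ((1, j) # ?Y) y)) =
      graded_bind (up_chains ?X p) (\<lambda>y. filter_mset (\<lambda>(d, b). ?P b) (up_chains ?Y y))"
    by (rule graded_bind_cong)
  then show ?thesis
    unfolding L map_append chains_append filter_graded_bind .
qed

text \<open>The second list contains the exchange $(1, i)$ in the place where the star at 1 meets
  the position \<open>j\<close>, after the positions between \<open>i\<close> and \<open>j\<close>.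
  The first list contains it before them. The difference is made up by
  \<open>star_star_equiv\<close> for the segment between \<open>i\<close> and
  \<open>j\<close>.\<close>

lemma star_pass_equiv:
  assumes "1 < i" "i < j" "j \<le> n"
  shows "star 1 ([2..<j] @ [Suc j..<Suc n]) @ star i [Suc i..<j] \<approx>
    star i [Suc i..<j] @ map (map_prod (transpose i j) (transpose i j)) (star 1 ([2..<i] @ [Suc i..<Suc n]))"
proof -
  let ?A = "star 1 [2..<i]" and ?M = "star 1 [Suc i..<j]" and ?Z = "star 1 [Suc j..<Suc n]"
    and ?S = "star i [Suc i..<j]"
  have l1: "[2..<j] = [2..<i] @ i # [Suc i..<j]"
    using assms by (intro upt_split_at) auto
  have l2: "[Suc i..<Suc n] = [Suc i..<j] @ j # [Suc j..<Suc n]"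
    using assms by (intro upt_split_at) auto
  have keep: "map (map_prod (transpose i j) (transpose i j)) (star 1 qs) = star 1 qs"
    if "i \<notin> set qs" "j \<notin> set qs" for qs
    using that assms by (auto simp: transpose_def)
  have "star 1 ([2..<j] @ [Suc j..<Suc n]) @ ?S = (?A @ [(1, i)] @ ?M) @ (?Z @ ?S)"
    unfolding l1 by simp
  also have "\<dots> \<approx> (?A @ [(1, i)] @ ?M) @ (?S @ ?Z)"
    using assms by (intro chain_equiv_append_left chain_equiv_commute) auto
  also have "\<dots> = ?A @ ([(1, i)] @ ?M @ ?S) @ ?Z"
    by simp
  also have "\<dots> \<approx> ?A @ (?S @ ?M @ [(1, i)]) @ ?Z"
    using assms by (intro chain_equiv_context star_star_equiv) auto
  also have "\<dots> = (?A @ ?S) @ (?M @ [(1, i)] @ ?Z)"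
    by simp
  also have "\<dots> \<approx> (?S @ ?A) @ (?M @ [(1, i)] @ ?Z)"
    using assms by (intro chain_equiv_append_right chain_equiv_commute) auto
  also have "\<dots> = ?S @ map (map_prod (transpose i j) (transpose i j)) (star 1 ([2..<i] @ [Suc i..<Suc n]))"
  proof -
    have "map (map_prod (transpose i j) (transpose i j)) [(1, j)] = [(1, i)]"
      using assms by (simp add: transpose_def)
    moreover have "star 1 ([2..<i] @ [Suc i..<Suc n]) = ?A @ ?M @ [(1, j)] @ ?Z"
      unfolding l2 by simp
    ultimately show ?thesis
      using keep[of "[2..<i]"] keep[of "[Suc i..<j]"] keep[of "[Suc j..<Suc n]"] assms
      by (simp only: map_append append_assoc) simp
  qed
  finally show ?thesis .
qed

lemma top_position_mono:
  assumes uv: "bruhat_le n u v" and ij: "i \<in> {1..n}" "j \<in> {1..n}" "u j = n" "v i = n"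
  shows "i \<le> j"
proof -
  interpret bruhat_involution n "antitranspose n"
    by (rule antitranspose_involution)
  note perm = bruhat_le_permutes[OF uv]
  have one: "reversal n n = 1"
    using ij(1) by (simp add: reversal_def)
  have "top_position n u = reversal n j" "top_position n v = reversal n i"
    using antitranspose_apply[OF perm(1), of j] antitranspose_apply[OF perm(2), of i]
      ij(3,4) by (simp_all only: one)
  then have "reversal n j \<le> reversal n i"
    using first_value_mono[OF le[OF uv]] by simp
  then show ?thesis
    using reversal_less_iff[OF ij(1,2)] by (simp add: not_less[symmetric])
qed

text \<open>The exchange of \<open>i\<close> and \<open>j\<close> moves the largest value. In the
  first order it comes last anyway; in the second one it is moved to the end by
  \<open>chains_exchange\<close>. The conditions on the intermediate element follow from those on
  the final one, because chains go up and, in the first order, the later exchanges keep the first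
  entry.\<close>

lemma bind_top_position:
  assumes u: "u permutes {1..n}" and v: "v permutes {1..n}" and ij: "1 < i" "i < j" "j \<le> n"
    and top: "u j = n" "v i = n"
  defines "h \<equiv> \<lambda>y. exchange y i j"
  defines "K \<equiv> \<lambda>y. bruhat_le n (h y) v \<and> h y 1 = v 1"
  shows "graded_bind (shortcut_mset n (\<lambda>x. x 1) u v) (\<lambda>p. shortcut_mset n (top_position n) p v) =
      image_mset (map_prod Suc h) (filter_mset (\<lambda>(d, y). K y)
        (up_chains (star 1 ([2..<j] @ [Suc j..<Suc n]) @ star i [Suc i..<j]) u))"
    and "graded_bind (shortcut_mset n (top_position n) u v) (\<lambda>p. shortcut_mset n (\<lambda>x. x 1) p v) =
      image_mset (map_prod Suc h) (filter_mset (\<lambda>(d, y). K y)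
        (up_chains (star i [Suc i..<j] @
          map (map_prod (transpose i j) (transpose i j)) (star 1 ([2..<i] @ [Suc i..<Suc n]))) u))"
proof -
  let ?S = "star i [Suc i..<j]" and ?Lj = "star 1 ([2..<j] @ [Suc j..<Suc n])"
    and ?Li = "star 1 ([2..<i] @ [Suc i..<Suc n])"
  let ?P = "\<lambda>p. bruhat_le n p v \<and> p 1 = v 1"
  have n: "1 \<le> n" and ij_in: "i \<in> {1..n}" "j \<in> {1..n}" "j \<in> {2..n}" "i \<in> {2..n}"
    using ij by auto
  have v1: "v 1 \<noteq> n"
    using permutes_eq_iff[OF v, of 1 i] top(2) ij(1) by auto
  have pairs: "set ?S \<subseteq> position_pairs n" "set ?Lj \<subseteq> position_pairs n" "set ?Li \<subseteq> position_pairs n"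
    using ij by (auto simp: position_pairs_def)
  have h1: "h y 1 = y 1" for y
    using ij by (simp add: h_def exchange_apply)
  have hh: "h (h y) = y" for y
    by (simp add: h_def)
  have perm: "p permutes {1..n}" if "p \<in> fiber_shortcuts n f u v" for p f
    using fiber_shortcutsD[OF that] bruhat_le_permutes by blast
  have le_h: "bruhat_le n y (h y)" if y: "y permutes {1..n}" "y j = n" for y
  proof -
    have "y i \<le> n" "y i \<noteq> n"
      using permutes_in_image[OF y(1), of i] permutes_eq_iff[OF y(1), of i j] y(2) ij ij_in by auto
    then show ?thesis
      unfolding h_def using y ij ij_in by (intro bruhat_edge_le bruhat_edgeI) auto
  qed
  show "graded_bind (shortcut_mset n (\<lambda>x. x 1) u v) (\<lambda>p. shortcut_mset n (top_position n) p v) =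
      image_mset (map_prod Suc h) (filter_mset (\<lambda>(d, y). K y) (up_chains (?Lj @ ?S) u))"
  proof -
    have S: "shortcut_mset n (\<lambda>x. x 1) u v = filter_mset (\<lambda>(d, p). ?P p) (up_chains ?Lj u)"
      unfolding first_value_shortcut_mset[OF u n]
      by (rule filter_star_skip_top[OF u ij_in(3) top(1) v v1])
    have "(if ?P p then shortcut_mset n (top_position n) p v else {#}) =
        image_mset (map_prod Suc h) (filter_mset (\<lambda>(d, y). K y) (up_chains ?S p))"
      if p: "(d, p) \<in># up_chains ?Lj u" for d p
    proof -
      have pp: "p permutes {1..n}"
        by (rule chains_permutes[OF p u pairs(2)])
      have "p j = u j"
        using p by (rule chains_untouched) (use ij in auto)
      then have pj: "p j = n"
        using top(1) by simp
      have below: "bruhat_le n p (h y)" "h y 1 = p 1" if y: "(d, y) \<in># up_chains ?S p" for d y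
      proof -
        have "y j = p j"
          using y by (rule chains_untouched) (use ij in auto)
        then show "bruhat_le n p (h y)"
          using bruhat_le_trans[OF chains_le[OF y pp pairs(1)] le_h[OF chains_permutes[OF y pp pairs(1)]]] pj
          by simp
        have "y 1 = p 1"
          using y by (rule chains_untouched) (use ij in auto)
        then show "h y 1 = p 1"
          by (simp only: h1)
      qed
      show ?thesis
      proof (cases "?P p")
        case True
        have "filter_mset (\<lambda>(d, y). bruhat_le n (h y) v) (up_chains ?S p) =
            filter_mset (\<lambda>(d, y). K y) (up_chains ?S p)"
          using below(2) True by (intro filter_mset_cong) (auto simp: K_def)
        then show ?thesis
          using True top_position_shortcut_mset[OF pp v ij_in(1,2) ij(2) pj top(2)] by (simp add: h_def)
      next
        case False
        have "\<not> K y" if "(d, y) \<in># up_chains ?S p" for d y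
          using False below[OF that] bruhat_le_trans unfolding K_def by metis
        then have "filter_mset (\<lambda>(d, y). K y) (up_chains ?S p) = {#}"
          by (intro filter_mset_none) auto
        then show ?thesis
          by (simp only: if_not_P[OF False] image_mset_empty)
      qed
    qed
    then have "graded_bind (shortcut_mset n (\<lambda>x. x 1) u v) (\<lambda>p. shortcut_mset n (top_position n) p v) =
        graded_bind (up_chains ?Lj u) (\<lambda>p. image_mset (map_prod Suc h) (filter_mset (\<lambda>(d, y). K y) (up_chains ?S p)))"
      unfolding S graded_bind_filter by (rule graded_bind_cong)
    then show ?thesis
      by (simp only: map_Suc_graded_bind filter_graded_bind chains_append)
  qed
  show "graded_bind (shortcut_mset n (top_position n) u v) (\<lambda>p. shortcut_mset n (\<lambda>x. x 1) p v) =
      image_mset (map_prod Suc h) (filter_mset (\<lambda>(d, y). K y)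
        (up_chains (?S @ map (map_prod (transpose i j) (transpose i j)) ?Li) u))"
  proof -
    let ?T = "map (map_prod (transpose i j) (transpose i j)) ?Li"
    have S: "shortcut_mset n (top_position n) u v =
        image_mset (map_prod Suc h) (filter_mset (\<lambda>(d, y). bruhat_le n (h y) v) (up_chains ?S u))"
      unfolding h_def by (rule top_position_shortcut_mset[OF u v ij_in(1,2) ij(2) top])
    have "(if bruhat_le n (h y) v then shortcut_mset n (\<lambda>x. x 1) (h y) v else {#}) =
        image_mset (map_prod id h) (filter_mset (\<lambda>(d, z). K z) (up_chains ?T y))"
      if y: "(d, y) \<in># up_chains ?S u" for d y
    proof -
      have yp: "y permutes {1..n}"
        by (rule chains_permutes[OF y u pairs(1)])
      have hy: "h y permutes {1..n}"
        unfolding h_def using ij_in by (intro exchange_permutes yp)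
      have "y j = u j"
        using y by (rule chains_untouched) (use ij in auto)
      then have hyi: "h y i = n"
        using top(1) by (simp add: h_def exchange_apply)
      have chains_h: "up_chains ?Li (h y) = image_mset (map_prod id h) (up_chains ?T y)"
        unfolding h_def by (rule chains_exchange)
      have "shortcut_mset n (\<lambda>x. x 1) (h y) v = filter_mset (\<lambda>(d, b). ?P b) (up_chains ?Li (h y))"
        unfolding first_value_shortcut_mset[OF hy n]
        by (rule filter_star_skip_top[OF hy ij_in(4) hyi v v1])
      also have "\<dots> = image_mset (map_prod id h) (filter_mset (\<lambda>(d, z). K z) (up_chains ?T y))"
        unfolding chains_h by (simp add: filter_mset_image_mset case_prod_unfold K_def)
      finally have eq: "shortcut_mset n (\<lambda>x. x 1) (h y) v =
        image_mset (map_prod id h) (filter_mset (\<lambda>(d, z). K z) (up_chains ?T y))" .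
      show ?thesis
      proof (cases "bruhat_le n (h y) v")
        case False
        have "\<not> K z" if z: "(d, z) \<in># up_chains ?T y" for d z
        proof -
          have "(d, h z) \<in># up_chains ?Li (h y)"
            unfolding chains_h using z by (force simp: image_iff)
          then have "bruhat_le n (h y) (h z)"
            by (rule chains_le[OF _ hy pairs(3)])
          then show ?thesis
            using False bruhat_le_trans unfolding K_def by blast
        qed
        then have "filter_mset (\<lambda>(d, z). K z) (up_chains ?T y) = {#}"
          by (intro filter_mset_none) auto
        then show ?thesis
          by (simp only: if_not_P[OF False] image_mset_empty)
      next
        case True
        then show ?thesis
          by (simp only: if_True eq)
      qed
    qed
    then have "graded_bind (up_chains ?S u)
          (\<lambda>y. if bruhat_le n (h y) v then shortcut_mset n (\<lambda>x. x 1) (h y) v else {#}) =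
        graded_bind (up_chains ?S u)
          (\<lambda>y. image_mset (map_prod id h) (filter_mset (\<lambda>(d, z). K z) (up_chains ?T y)))"
      by (rule graded_bind_cong)
    also have "\<dots> = image_mset (map_prod id h) (filter_mset (\<lambda>(d, z). K z) (up_chains (?S @ ?T) u))"
      by (simp only: image_graded_bind[symmetric] filter_graded_bind chains_append)
    finally show ?thesis
      unfolding S graded_bind_map_Suc graded_bind_filter
      by (simp add: multiset.map_comp map_prod.comp del: map_append)
  qed
qed

text \<open>If the largest value ends at position 1 the two fibers coincide, and if it never moves
  one of the two steps is trivial. Otherwise both multisets count chains in equivalent lists of
  exchanges, followed by the exchange of \<open>i\<close> and \<open>j\<close>.\<close>

lemma first_top_commute:
  assumes uv: "bruhat_le n u v" and n: "1 \<le> n"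
  shows "graded_bind (shortcut_mset n (\<lambda>x. x 1) u v) (\<lambda>p. shortcut_mset n (top_position n) p v) =
    graded_bind (shortcut_mset n (top_position n) u v) (\<lambda>p. shortcut_mset n (\<lambda>x. x 1) p v)"
proof -
  note u = bruhat_le_permutes(1)[OF uv] and v = bruhat_le_permutes(2)[OF uv]
  interpret F: bruhat_fibration n "\<lambda>x. x 1"
    by (rule first_value_fibration[OF n])
  interpret R: bruhat_involution n "antitranspose n"
    by (rule antitranspose_involution)
  interpret T: bruhat_fibration n "top_position n"
    by (rule R.fibration_comp[OF F.bruhat_fibration_axioms])
  obtain i j where top: "u j = n" "v i = n"
    using permutes_surj[OF u] permutes_surj[OF v] by (metis surjD)
  have "u j \<in> {1..n}" "v i \<in> {1..n}"
    using top n by auto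
  then have ij: "i \<in> {1..n}" "j \<in> {1..n}"
    by (simp_all only: permutes_in_image[OF u] permutes_in_image[OF v])
  have "i \<le> j"
    by (rule top_position_mono[OF uv ij top])
  then consider "i = 1" | "i = j" | "1 < i" "i < j"
    using ij by fastforce
  then show ?thesis
  proof cases
    case 1
    \<comment> \<open>Both fibers consist of the permutations that begin with their largest value.\<close>
    have "x 1 = v 1 \<longleftrightarrow> top_position n x = top_position n v" if "x permutes {1..n}" for x
      using top_position_eq_iff[OF that v top(2) n] top(2) 1 by simp
    then have "fiber n (\<lambda>x. x 1) p v = fiber n (top_position n) p v" for p
      unfolding fiber_def bruhat_interval_iff using bruhat_le_permutes by blast
    then have "shortcut_mset n (\<lambda>x. x 1) p v = shortcut_mset n (top_position n) p v" for p
      by (simp add: shortcut_mset_def fiber_shortcuts_def)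
    then show ?thesis by simp
  next
    case 2
    have "top_position n u = top_position n v"
      using top_position_eq_iff[OF u v top(2) n] top(1) 2 by simp
    then have triv: "shortcut_mset n (top_position n) p v = {#(0, p)#}"
      if "bruhat_le n u p" "bruhat_le n p v" for p
    proof -
      have "top_position n p = top_position n v"
        using \<open>top_position n u = top_position n v\<close> by (rule T.top_fiber_upward[OF that])
      then have "fiber_shortcuts n (top_position n) p v = {p}"
        by (rule fiber_shortcuts_trivial[OF that(2)])
      moreover have "bruhat_dist n p p = 0"
        unfolding bruhat_dist_eq[OF bruhat_le_permutes(2)[OF that(1)]] by (rule Least_eq_0) simp
      ultimately show ?thesis
        by (simp add: shortcut_mset_def)
    qed
    have "graded_bind (shortcut_mset n (\<lambda>x. x 1) u v) (\<lambda>p. shortcut_mset n (top_position n) p v) =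
      graded_bind (shortcut_mset n (\<lambda>x. x 1) u v) (\<lambda>p. {#(0, p)#})"
      by (intro graded_bind_cong triv)
        (auto simp: shortcut_mset_def finite_fiber_shortcuts dest: fiber_shortcutsD)
    then show ?thesis
      by (simp only: triv[OF bruhat_le_refl[OF u] uv] graded_bind_return graded_bind_return_right)
  next
    case 3
    have "j \<le> n"
      using ij by simp
    note eqs = bind_top_position[OF u v 3 this top]
    have "up_chains (star 1 ([2..<j] @ [Suc j..<Suc n]) @ star i [Suc i..<j]) u =
      up_chains (star i [Suc i..<j] @
        map (map_prod (transpose i j) (transpose i j)) (star 1 ([2..<i] @ [Suc i..<Suc n]))) u"
      using star_pass_equiv[OF 3 \<open>j \<le> n\<close>] permutes_inj[OF u] unfolding chain_equiv_def by blast
    then show ?thesis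
      unfolding eqs by (simp only:)
  qed
qed

section \<open>The standard hypercube decompositions\<close>

lemma simple_refl_eq_iff: "simple_refl i = simple_refl k \<longleftrightarrow> i = k"
proof
  assume "simple_refl i = simple_refl k"
  then have "simple_refl i i = simple_refl k i"
    by simp
  then show "i = k"
    by (auto simp: simple_refl_def transpose_def split: if_splits)
qed simp

lemma word_in_generate:
  "set ss \<subseteq> H \<Longrightarrow> foldr (\<circ>) ss id \<in> generate (sym_group n) H"
proof (induction ss)
  case Nil
  have "foldr (\<circ>) [] id = id"
    by simp
  then show ?case
    using generate.one[of "sym_group n" H] unfolding sym_group_one by metis
next
  case (Cons s ss)
  then have sub: "s \<in> H" "set ss \<subseteq> H"
    by simp_all
  have "s \<otimes>\<^bsub>sym_group n\<^esub> foldr (\<circ>) ss id \<in> generate (sym_group n) H"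
    by (rule generate.eng[OF generate.incl[OF sub(1)] Cons.IH[OF sub(2)]])
  then show ?case
    by (simp only: sym_group_mult foldr_Cons o_apply[of "(\<circ>) s"])
qed

text \<open>Omitting the first or the last simple reflection leaves the permutations of an interval,
  that is, the stabilizer of the remaining point \<open>c\<close>.\<close>

lemma parabolic_maximal_eq_stabilizer:
  assumes lm: "{1..n - 1} - {k} = {l..<m}" "{1..n} - {c} = {l..m}"
  shows "parabolic n (simple_refls n - {simple_refl k}) = {w. w permutes {1..n} \<and> w c = c}"
proof -
  have "inj simple_refl"
    by (rule injI) (simp only: simple_refl_eq_iff)
  then have H: "simple_refls n - {simple_refl k} = simple_refl ` {l..<m}"
    unfolding lm(1)[symmetric] simple_refls_def by (simp only: image_set_diff image_insert image_empty)
  have sub: "{l..m} \<subseteq> {1..n}" and c: "c \<notin> {l..m}"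
    unfolding lm(2)[symmetric] by blast+
  show ?thesis
    unfolding parabolic_def H
  proof (intro equalityI subsetI CollectI)
    fix w assume "w \<in> generate (sym_group n) (simple_refl ` {l..<m})"
    then have "w permutes {l..m}"
    proof (induction rule: generate.induct)
      case one
      show ?case by (simp only: sym_group_one permutes_id)
    next
      case (incl h)
      then obtain i where "i \<in> {l..<m}" "h = transpose i (i + 1)"
        by (auto simp: simple_refl_def)
      then show ?case by (auto intro: permutes_swap_id)
    next
      case (inv h)
      then obtain i where "i \<in> {l..<m}" "h = transpose i (i + 1)"
        by (auto simp: simple_refl_def)
      then have h: "h permutes {l..m}"
        by (auto intro: permutes_swap_id)
      then have "h \<in> carrier (sym_group n)"
        using permutes_subset[OF _ sub] by (simp only: sym_group_carrier)
      then show ?case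
        using permutes_inv[OF h] by (simp only: sym_group_inv_equality)
    next
      case (eng h1 h2)
      then show ?case
        by (simp only: sym_group_mult permutes_compose)
    qed
    then show "w permutes {1..n} \<and> w c = c"
      using permutes_subset[OF _ sub] c permutes_not_in by metis
  next
    fix w assume "w \<in> {w. w permutes {1..n} \<and> w c = c}"
    then have w: "w permutes {1..n}" "w c = c"
      by auto
    have "w permutes {l..m}"
      by (rule permutes_superset[OF w(1)]) (use w(2) lm(2) in blast)
    then obtain ss where "set ss \<subseteq> simple_refl ` {l..<m}" "foldr (\<circ>) ss id = w"
      using reduced_word_exists by blast
    then show "w \<in> generate (sym_group n) (simple_refl ` {l..<m})"
      using word_in_generate by metis
  qed
qed

lemma stabilizer_right_coset_iff:
  assumes x: "x permutes {1..n}" and v: "v permutes {1..n}"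
  shows "x \<in> {w. w permutes {1..n} \<and> w c = c} #>\<^bsub>sym_group n\<^esub> v \<longleftrightarrow> inv' x c = inv' v c"
proof
  assume "x \<in> {w. w permutes {1..n} \<and> w c = c} #>\<^bsub>sym_group n\<^esub> v"
  then obtain w where w: "w permutes {1..n}" "w c = c" "x = w \<circ> v"
    by (auto simp: r_coset_def sym_group_mult)
  have "x (inv' v c) = c"
    using w(2,3) permutes_inverses(1)[OF v] by simp
  then show "inv' x c = inv' v c"
    using permutes_inv_eq[OF x] by metis
next
  assume eq: "inv' x c = inv' v c"
  let ?w = "x \<circ> inv' v"
  have "?w permutes {1..n}"
    by (intro permutes_compose permutes_inv v x)
  moreover have "?w c = c"
    using permutes_inverses(1)[OF x] by (simp add: eq[symmetric])
  moreover have "x = ?w \<circ> v"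
    by (simp only: comp_assoc permutes_inv_o(2)[OF v] comp_id)
  ultimately show "x \<in> {w. w permutes {1..n} \<and> w c = c} #>\<^bsub>sym_group n\<^esub> v"
    unfolding r_coset_def sym_group_mult by blast
qed

lemma stabilizer_left_coset_iff:
  assumes x: "x permutes {1..n}" and v: "v permutes {1..n}"
  shows "x \<in> v <#\<^bsub>sym_group n\<^esub> {w. w permutes {1..n} \<and> w c = c} \<longleftrightarrow> x c = v c"
proof
  assume "x \<in> v <#\<^bsub>sym_group n\<^esub> {w. w permutes {1..n} \<and> w c = c}"
  then obtain w where w: "w permutes {1..n}" "w c = c" "x = v \<circ> w"
    by (auto simp: l_coset_def sym_group_mult)
  then show "x c = v c"
    by simp
next
  assume eq: "x c = v c"
  let ?w = "inv' v \<circ> x"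
  have "?w permutes {1..n}"
    by (intro permutes_compose permutes_inv v x)
  moreover have "?w c = c"
    using permutes_inverses(2)[OF v] by (simp add: eq)
  moreover have "x = v \<circ> ?w"
    by (simp only: comp_assoc[symmetric] permutes_inv_o(1)[OF v] id_comp)
  ultimately show "x \<in> v <#\<^bsub>sym_group n\<^esub> {w. w permutes {1..n} \<and> w c = c}"
    unfolding l_coset_def sym_group_mult by blast
qed

lemma interval_inter_eq_fiber:
  assumes "\<And>x. x permutes {1..n} \<Longrightarrow> x \<in> A \<longleftrightarrow> f x = f v"
  shows "bruhat_interval n u v \<inter> A = fiber n f u v"
  using assms bruhat_le_permutes by (auto simp: fiber_def bruhat_interval_iff)

lemma min_of_fiber:
  assumes "bruhat_fibration n f" "bruhat_le n u v"
  shows "is_bruhat_min n (fiber n f u v) (bruhat_min n (fiber n f u v))"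
  using bruhat_fibration.fiber_min_exists[OF assms] bruhat_min_eqI by metis

theorem corollary3p3:
  fixes n :: nat and u v z_n z_1 z'_n z'_1 :: perm
  assumes "n \<ge> 2"
    and "u \<in> carrier (sym_group n)" and "v \<in> carrier (sym_group n)"
    and "bruhat_le n u v"
    and "z_n = bruhat_min n (bruhat_interval n u v \<inter>
           (parabolic n (simple_refls n - {simple_refl (n - 1)}) #>\<^bsub>sym_group n\<^esub> v))"
    and "z_1 = bruhat_min n (bruhat_interval n u v \<inter>
           (parabolic n (simple_refls n - {simple_refl 1}) #>\<^bsub>sym_group n\<^esub> v))"
    and "z'_n = bruhat_min n (bruhat_interval n u v \<inter>
           (v <#\<^bsub>sym_group n\<^esub> parabolic n (simple_refls n - {simple_refl (n - 1)})))"
    and "z'_1 = bruhat_min n (bruhat_interval n u v \<inter>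
           (v <#\<^bsub>sym_group n\<^esub> parabolic n (simple_refls n - {simple_refl 1})))"
  shows "\<exists>C \<in> amazing_decomps n u v // ds_equiv n u v. {z_n, z_1, z'_n, z'_1} \<subseteq> C"
proof -
  have n: "1 \<le> n" "1 < n"
    using assms(1) by auto
  note uv = assms(4)
  note u = bruhat_le_permutes(1)[OF uv] and v = bruhat_le_permutes(2)[OF uv]
  interpret I: bruhat_involution n inv'
    by (rule inverse_involution)
  let ?f = "\<lambda>x :: perm. x 1" and ?g = "\<lambda>x :: perm. inv' x 1"
  have fib: "bruhat_fibration n ?f" "bruhat_fibration n (last_value n)"
    "bruhat_fibration n (top_position n)" "bruhat_fibration n ?g"
    using first_value_fibration[OF n(1)]
      bruhat_involution.fibration_comp[OF reverse_complement_involution first_value_fibration[OF n(1)]]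
      bruhat_involution.fibration_comp[OF antitranspose_involution first_value_fibration[OF n(1)]]
      I.fibration_comp[OF first_value_fibration[OF n(1)]] by blast+
  have one: "reversal n 1 = n"
    using n by (simp add: reversal_def)
  have st_n: "parabolic n (simple_refls n - {simple_refl (n - 1)}) = {w. w permutes {1..n} \<and> w n = n}"
    by (rule parabolic_maximal_eq_stabilizer[of _ _ 1 "n - 1"]) (use n in auto)
  have st_1: "parabolic n (simple_refls n - {simple_refl 1}) = {w. w permutes {1..n} \<and> w 1 = 1}"
    by (rule parabolic_maximal_eq_stabilizer[of _ _ 2 n]) (use n in auto)
  have "z_n = bruhat_min n (fiber n (top_position n) u v)"
    unfolding assms(5) st_n
    by (rule arg_cong[of _ _ "bruhat_min n"], rule interval_inter_eq_fiber)
      (simp only: stabilizer_right_coset_iff[OF _ v] antitranspose_def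
        reverse_complement_apply one reversal_eq_iff)
  then have zn: "is_bruhat_min n (fiber n (top_position n) u v) z_n"
    using min_of_fiber[OF fib(3) uv] by simp
  have "z_1 = bruhat_min n (fiber n ?g u v)"
    unfolding assms(6) st_1
    by (rule arg_cong[of _ _ "bruhat_min n"], rule interval_inter_eq_fiber)
      (simp only: stabilizer_right_coset_iff[OF _ v])
  then have z1: "is_bruhat_min n (fiber n ?g u v) z_1"
    using min_of_fiber[OF fib(4) uv] by simp
  have "z'_n = bruhat_min n (fiber n (last_value n) u v)"
    unfolding assms(7) st_n
    by (rule arg_cong[of _ _ "bruhat_min n"], rule interval_inter_eq_fiber)
      (simp only: stabilizer_left_coset_iff[OF _ v] last_value_eq_iff[OF n(1)])
  then have zn': "is_bruhat_min n (fiber n (last_value n) u v) z'_n"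
    using min_of_fiber[OF fib(2) uv] by simp
  have "z'_1 = bruhat_min n (fiber n ?f u v)"
    unfolding assms(8) st_1
    by (rule arg_cong[of _ _ "bruhat_min n"], rule interval_inter_eq_fiber)
      (simp only: stabilizer_left_coset_iff[OF _ v])
  then have z1': "is_bruhat_min n (fiber n ?f u v) z'_1"
    using min_of_fiber[OF fib(1) uv] by simp
  note ds = double_shortcuts_eq_bind[OF fib(1) fib(2) z1' zn'] double_shortcuts_eq_bind[OF fib(2) fib(1) zn' z1']
    double_shortcuts_eq_bind[OF fib(1) fib(3) z1' zn] double_shortcuts_eq_bind[OF fib(3) fib(1) zn z1']
    double_shortcuts_eq_bind[OF fib(4) fib(3) z1 zn] double_shortcuts_eq_bind[OF fib(3) fib(4) zn z1]
  have d1: "double_shortcuts n u v z'_1 z'_n = double_shortcuts n u v z'_n z'_1"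
    unfolding ds by (rule first_last_commute[OF u v n(2)])
  have d2: "double_shortcuts n u v z'_1 z_n = double_shortcuts n u v z_n z'_1"
    unfolding ds by (rule first_top_commute[OF uv n(1)])
  \<comment> \<open>Inversion turns the first and the last entry into the positions of 1 and \<open>n\<close>.\<close>
  have d3: "double_shortcuts n u v z_1 z_n = double_shortcuts n u v z_n z_1"
    unfolding ds antitranspose_def
      I.graded_bind_shortcuts[OF u v, of ?f "last_value n"] I.graded_bind_shortcuts[OF u v, of "last_value n" ?f]
    by (simp only: first_last_commute[OF I.maps[OF u] I.maps[OF v] n(2)])
  let ?A = "amazing_decomps n u v"
  have A: "z_n \<in> ?A" "z_1 \<in> ?A" "z'_n \<in> ?A" "z'_1 \<in> ?A"
    unfolding amazing_decomps_def
    using bruhat_fibration.min_amazing[OF fib(3) zn] bruhat_fibration.min_amazing[OF fib(4) z1]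
      bruhat_fibration.min_amazing[OF fib(2) zn'] bruhat_fibration.min_amazing[OF fib(1) z1'] by simp_all
  let ?r = "\<lambda>x y. x \<in> ?A \<and> y \<in> ?A \<and> double_shortcuts n u v x y = double_shortcuts n u v y x"
  have r1: "equivclp ?r z'_1 z'_n" and r2: "equivclp ?r z'_1 z_n" and r3: "equivclp ?r z_n z_1"
    using A d1 d2 d3 by (intro r_into_equivclp; simp)+
  have "equivclp ?r z'_1 z_1"
    using r2 r3 by (rule equivclp_trans)
  then have "{z_n, z_1, z'_n, z'_1} \<subseteq> ds_equiv n u v `` {z'_1}"
    using A r1 r2 equivclp_refl[of ?r z'_1] by (simp add: ds_equiv_def)
  moreover have "ds_equiv n u v `` {z'_1} \<in> ?A // ds_equiv n u v"
    by (rule quotientI[OF A(4)])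
  ultimately show ?thesis by blast
qed

end
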